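(* Let $M^n$ be a complete hypersurface with constant weighted mean curvature $\lambda$ properly immersed in the Gaussian space $\mathbb{R}^{n+1}$, and let $1\le p\le n+1$ be an integer. Suppose that the image of the Gauss map $N: M\to S^n$ is contained in the intersection of the closed hemispheres $x_{n+2-p}\ge 0,\dots,x_{n+1}\ge 0$ of $S^n$. Then either (i) $M$ is a hyperplane, or (ii) $M$ splits isometrically as $M^n=\tilde{M}^{n-p}\times\mathbb{R}^p$, where $\tilde{M}^{n-p}$ is a hypersurface with constant weighted mean curvature $\lambda$ in the Gaussian space $\mathbb{R}^{n+1-p}\times\{0\}^p$.
   Context: The Gaussian space $\mathbb{R}^{m}$ is $\mathbb{R}^{m}$ with its canonical metric and the weight function $f(x)=|x|^2/4$ (weighted measure $e^{-f}\,d\mathrm{vol}$); $\mathbb{R}^{n+1-p}\times\{0\}^p\subset\mathbb{R}^{n+1}$ is identified with the Gaussian space $\mathbb{R}^{n+1-p}$. Hypersurfaces are smooth, connected, immersed, and carry a smooth unit normal field $N$; the map $N: M\to S^n$ is the Gauss map. "Complete" refers to the induced metric. "Hyperplane" means affine hyperplane (not necessarily through the origin). With $\bar\nabla$ the flat connection, the mean curvature is the trace of the second fundamental form, $H=\sum_i\langle\bar\nabla_{e_i}e_i,N\rangle$ for a local orthonormal frame $e_1,\dots,e_n$ of $TM$. The hypersurface has constant weighted mean curvature $\lambda$ (with $\lambda\in\mathbb{R}$ constant) if $H+\frac12\langle x,N\rangle=\lambda$ on $M$, where $x$ is the position vector. The same definition is used for $\tilde M$ in $\mathbb{R}^{n+1-p}$,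 with respect to a suitable unit normal field of $\tilde M$. The splitting in (ii) is understood as a splitting of the hypersurface inside $\mathbb{R}^{n+1}=\mathbb{R}^{n+1-p}\times\mathbb{R}^p$: $M$ is the generalized cylinder over $\tilde M\subset\mathbb{R}^{n+1-p}\times\{0\}^p$ whose factor $\mathbb{R}^p$ consists of the $p$-planes parallel to the span of the last $p$ coordinate axes. When $p=n$, $\tilde M^0$ is a point (with $H=0$); when $p=n+1$, alternative (ii) is void. *)

theory Defs
  imports "HOL-Analysis.Analysis"
begin

fun Ck_on :: "nat \<Rightarrow> 'a::euclidean_space set \<Rightarrow> ('a \<Rightarrow> 'b::real_normed_vector) \<Rightarrow> bool" where
  "Ck_on 0 W f \<longleftrightarrow> continuous_on W f"
| "Ck_on (Suc k) W f \<longleftrightarrow> (\<forall>x\<in>W. f differentiable at x) \<and>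
     (\<forall>b\<in>Basis. Ck_on k W (\<lambda>x. frechet_derivative f (at x) b))"

text \<open>
  Smoothness on an arbitrary set means local extendability to smooth functions on open
  sets. It is used below only for relatively open subsets of a linear subspace, where it is
  ordinary smoothness on an open subset of a lower-dimensional Euclidean space.
\<close>

definition smooth_on :: "'a::euclidean_space set \<Rightarrow> ('a \<Rightarrow> 'b::real_normed_vector) \<Rightarrow> bool" where
  "smooth_on S f \<longleftrightarrow>
     (\<forall>x\<in>S. \<exists>W F. open W \<and> x \<in> W \<and> (\<forall>k. Ck_on k W F) \<and> (\<forall>y\<in>S \<inter> W. F y = f y))"

definition dir_deriv :: "('a::real_normed_vector \<Rightarrow> 'b::real_normed_vector) \<Rightarrow> 'a \<Rightarrow> 'a \<Rightarrow> 'b" where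
  "dir_deriv f y v = vector_derivative (\<lambda>t. f (y + t *\<^sub>R v)) (at 0)"

text \<open>
  The Euclidean spaces of the various dimensions all live inside one type: if \<open>e\<close> enumerates
  the standard basis, \<open>coord_space e m\<close> is the m-dimensional space of the first m coordinates,
  sitting in the ambient space with all remaining coordinates zero.
\<close>

definition coord_space :: "(nat \<Rightarrow> 'a::euclidean_space) \<Rightarrow> nat \<Rightarrow> 'a set" where
  "coord_space e m = span (e ` {1..m})"

type_synonym ('m, 'a) chart = "'m set \<times> ('m \<Rightarrow> 'a)"

text \<open>
  The model space \<open>E\<close> is a linear subspace; the dimension of the manifold is \<open>dim E\<close>.
\<close>

definition smooth_manifold ::
    "'a::euclidean_space set \<Rightarrow> 'm topology \<Rightarrow> ('m, 'a) chart set \<Rightarrow> bool" where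
  "smooth_manifold E M A \<longleftrightarrow>
     Hausdorff_space M \<and> second_countable M \<and>
     (\<Union>(U, \<phi>)\<in>A. U) = topspace M \<and>
     (\<forall>(U, \<phi>)\<in>A. openin M U \<and> openin (top_of_set E) (\<phi> ` U) \<and>
        homeomorphic_map (subtopology M U) (top_of_set (\<phi> ` U)) \<phi>) \<and>
     (\<forall>(U, \<phi>)\<in>A. \<forall>(W, \<psi>)\<in>A. smooth_on (\<phi> ` (U \<inter> W)) (\<psi> \<circ> inv_into U \<phi>))"

definition smooth_fun ::
    "('m, 'a::euclidean_space) chart set \<Rightarrow> ('m \<Rightarrow> 'b::real_normed_vector) \<Rightarrow> bool" where
  "smooth_fun A f \<longleftrightarrow> (\<forall>(U, \<phi>)\<in>A. smooth_on (\<phi> ` U) (f \<circ> inv_into U \<phi>))"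

definition smooth_map ::
    "('m, 'a::euclidean_space) chart set \<Rightarrow> ('k, 'b::euclidean_space) chart set \<Rightarrow>
     ('m \<Rightarrow> 'k) \<Rightarrow> bool" where
  "smooth_map A B F \<longleftrightarrow>
     (\<forall>(U, \<phi>)\<in>A. \<forall>(W, \<psi>)\<in>B. smooth_on (\<phi> ` {q \<in> U. F q \<in> W}) (\<psi> \<circ> F \<circ> inv_into U \<phi>))"

definition diffeomorphism ::
    "'m topology \<Rightarrow> ('m, 'a::euclidean_space) chart set \<Rightarrow>
     'k topology \<Rightarrow> ('k, 'b::euclidean_space) chart set \<Rightarrow> ('m \<Rightarrow> 'k) \<Rightarrow> bool" where
  "diffeomorphism M A M' A' F \<longleftrightarrow>
     homeomorphic_map M M' F \<and> smooth_map A A' F \<and> smooth_map A' A (inv_into (topspace M) F)"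

text \<open>
  An immersion \<open>X\<close> in the chart \<open>(U, \<phi>)\<close>: the differential of \<open>X\<close> at \<open>q\<close> applied to the
  tangent vector with coordinates \<open>v\<close>, and the metric induced by \<open>X\<close>.
\<close>

definition differential ::
    "('m \<Rightarrow> 'b::real_normed_vector) \<Rightarrow> ('m, 'a::euclidean_space) chart \<Rightarrow> 'm \<Rightarrow> 'a \<Rightarrow> 'b" where
  "differential X c q v = dir_deriv (X \<circ> inv_into (fst c) (snd c)) (snd c q) v"

definition induced_metric ::
    "('m \<Rightarrow> 'b::real_inner) \<Rightarrow> ('m, 'a::euclidean_space) chart \<Rightarrow> 'm \<Rightarrow> 'a \<Rightarrow> 'a \<Rightarrow> real" where
  "induced_metric X c q v w = differential X c q v \<bullet> differential X c q w"

text \<open>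
  A connected immersed hypersurface of dimension \<open>d\<close> in the Euclidean space of dimension
  \<open>d + 1\<close>: manifold \<open>M\<close> with atlas \<open>A\<close>, immersion \<open>X\<close>, smooth unit normal field \<open>N\<close>.
\<close>

definition hypersurface ::
    "(nat \<Rightarrow> 'a::euclidean_space) \<Rightarrow> nat \<Rightarrow> 'm topology \<Rightarrow> ('m, 'a) chart set \<Rightarrow>
     ('m \<Rightarrow> 'a) \<Rightarrow> ('m \<Rightarrow> 'a) \<Rightarrow> bool" where
  "hypersurface e d M A X N \<longleftrightarrow>
     smooth_manifold (coord_space e d) M A \<and>
     connected_space M \<and> topspace M \<noteq> {} \<and>
     smooth_fun A X \<and> X ` topspace M \<subseteq> coord_space e (d + 1) \<and>
     (\<forall>c\<in>A. \<forall>q\<in>fst c. \<forall>v\<in>coord_space e d. differential X c q v = 0 \<longrightarrow> v = 0) \<and>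
     smooth_fun A N \<and> N ` topspace M \<subseteq> coord_space e (d + 1) \<and>
     (\<forall>q\<in>topspace M. norm (N q) = 1) \<and>
     (\<forall>c\<in>A. \<forall>q\<in>fst c. \<forall>v\<in>coord_space e d. N q \<bullet> differential X c q v = 0)"

text \<open>
  Local orthonormal frames of the tangent bundle on an open subset of the chart \<open>(U, \<phi>)\<close> with
  coordinate image \<open>W\<close>. The field \<open>v i\<close> is the coordinate expression of the i-th frame vector
  field, and \<open>frame_field X (U, \<phi>) v i\<close> is that field as a map from \<open>W\<close> into the ambient space.
\<close>

definition frame_field ::
    "('m \<Rightarrow> 'a) \<Rightarrow> ('m, 'a::euclidean_space) chart \<Rightarrow> (nat \<Rightarrow> 'a \<Rightarrow> 'a) \<Rightarrow> nat \<Rightarrow> 'a \<Rightarrow> 'a" where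
  "frame_field X c v i y = differential X c (inv_into (fst c) (snd c) y) (v i y)"

definition local_orthonormal_frame ::
    "(nat \<Rightarrow> 'a::euclidean_space) \<Rightarrow> nat \<Rightarrow> ('m \<Rightarrow> 'a) \<Rightarrow> ('m, 'a) chart \<Rightarrow> 'a set \<Rightarrow>
     (nat \<Rightarrow> 'a \<Rightarrow> 'a) \<Rightarrow> bool" where
  "local_orthonormal_frame e d X c W v \<longleftrightarrow>
     openin (top_of_set (coord_space e d)) W \<and> W \<subseteq> snd c ` fst c \<and>
     (\<forall>i\<in>{1..d}. smooth_on W (v i) \<and> v i ` W \<subseteq> coord_space e d) \<and>
     (\<forall>y\<in>W. \<forall>i\<in>{1..d}. \<forall>j\<in>{1..d}.
        frame_field X c v i y \<bullet> frame_field X c v j y = (if i = j then 1 else 0))"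

text \<open>
  The sum below is \<open>\<Sum>i. \<langle>\<nabla>\<^bsub>e i\<^esub> e i, N\<rangle>\<close> for the flat connection. It does not depend on the chart
  and the frame.
\<close>

definition mean_curvature ::
    "(nat \<Rightarrow> 'a::euclidean_space) \<Rightarrow> nat \<Rightarrow> ('m, 'a) chart set \<Rightarrow>
     ('m \<Rightarrow> 'a) \<Rightarrow> ('m \<Rightarrow> 'a) \<Rightarrow> 'm \<Rightarrow> real" where
  "mean_curvature e d A X N q =
     (THE h. \<exists>c\<in>A. \<exists>W v. q \<in> fst c \<and> snd c q \<in> W \<and> local_orthonormal_frame e d X c W v \<and>
        h = (\<Sum>i=1..d. dir_deriv (frame_field X c v i) (snd c q) (v i (snd c q)) \<bullet> N q))"

text \<open>
  Gaussian weight \<open>f x = |x|\<^sup>2 / 4\<close>, whose gradient is \<open>x / 2\<close>.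
\<close>

definition const_weighted_mean_curvature ::
    "(nat \<Rightarrow> 'a::euclidean_space) \<Rightarrow> nat \<Rightarrow> 'm topology \<Rightarrow> ('m, 'a) chart set \<Rightarrow>
     ('m \<Rightarrow> 'a) \<Rightarrow> ('m \<Rightarrow> 'a) \<Rightarrow> real \<Rightarrow> bool" where
  "const_weighted_mean_curvature e d M A X N lam \<longleftrightarrow>
     (\<forall>q\<in>topspace M. mean_curvature e d A X N q + (1/2) * (X q \<bullet> N q) = lam)"

text \<open>
  Riemannian distance of the induced metric. As \<open>X\<close> is an immersion, a path \<open>\<gamma>\<close> in \<open>M\<close> is
  piecewise C1 iff \<open>X \<circ> \<gamma>\<close> is, and its speed is that of \<open>X \<circ> \<gamma>\<close>. Only rectifiable paths are
  admitted (\<open>has_integral L\<close>), because derivatives may be unbounded near the break points.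
\<close>

definition induced_dist ::
    "'m topology \<Rightarrow> ('m \<Rightarrow> 'a::euclidean_space) \<Rightarrow> 'm \<Rightarrow> 'm \<Rightarrow> real" where
  "induced_dist M X a b =
     (if a \<in> topspace M \<and> b \<in> topspace M then
        Inf {L. \<exists>\<gamma>. pathin M \<gamma> \<and> \<gamma> 0 = a \<and> \<gamma> 1 = b \<and>
               (X \<circ> \<gamma>) piecewise_C1_differentiable_on {0..1} \<and>
               ((\<lambda>t. norm (vector_derivative (X \<circ> \<gamma>) (at t))) has_integral L) {0..1}}
      else 0)"

definition complete_hypersurface :: "'m topology \<Rightarrow> ('m \<Rightarrow> 'a::euclidean_space) \<Rightarrow> bool" where
  "complete_hypersurface M X \<longleftrightarrow> Metric_space.mcomplete (topspace M) (induced_dist M X)"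

text \<open>
  \<open>X\<close> being an immersion, a homeomorphism onto the hyperplane is a diffeomorphism onto it.
\<close>

definition is_hyperplane :: "'m topology \<Rightarrow> ('m \<Rightarrow> 'a::euclidean_space) \<Rightarrow> bool" where
  "is_hyperplane M X \<longleftrightarrow>
     (\<exists>a b. a \<noteq> 0 \<and> homeomorphic_map M (top_of_set {x. a \<bullet> x = b}) X)"

text \<open>
  Product of a manifold with a linear subspace \<open>R\<close>. It is a manifold when \<open>R\<close> meets the model
  space of the first factor only in 0; the new model space is the sum of the two.
\<close>

definition prod_chart ::
    "'a::euclidean_space set \<Rightarrow> ('m, 'a) chart \<Rightarrow> ('m \<times> 'a, 'a) chart" where
  "prod_chart R c = (fst c \<times> R, \<lambda>(q, t). snd c q + t)"

text \<open>
  \<open>M\<close> is, via the diffeomorphism \<open>\<Phi>\<close>, the generalized cylinder over \<open>M'\<close> with factor the span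
  \<open>R\<close> of the last \<open>p\<close> of the \<open>n + 1\<close> coordinate axes. The last conjunct says that \<open>\<Phi>\<close> is an
  isometry: the pullback of the metric of \<open>M\<close>, which is the metric induced by \<open>X \<circ> \<Phi>\<close>, is the
  product metric.
\<close>

definition splits_as_cylinder ::
    "(nat \<Rightarrow> 'a::euclidean_space) \<Rightarrow> nat \<Rightarrow> nat \<Rightarrow>
     'm topology \<Rightarrow> ('m, 'a) chart set \<Rightarrow> ('m \<Rightarrow> 'a) \<Rightarrow>
     'k topology \<Rightarrow> ('k, 'a) chart set \<Rightarrow> ('k \<Rightarrow> 'a) \<Rightarrow> bool" where
  "splits_as_cylinder e n p M A X M' A' X' \<longleftrightarrow>
     (let R = span (e ` {n + 2 - p..n + 1}) in
      \<exists>\<Phi>. diffeomorphism (prod_topology M' (top_of_set R)) (prod_chart R ` A') M A \<Phi> \<and>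
          (\<forall>q\<in>topspace M'. \<forall>t\<in>R. X (\<Phi> (q, t)) = X' q + t) \<and>
          (\<forall>c\<in>A'. \<forall>q\<in>fst c. \<forall>t\<in>R.
             \<forall>v\<in>coord_space e (n - p). \<forall>w\<in>coord_space e (n - p). \<forall>r\<in>R. \<forall>s\<in>R.
               induced_metric (X \<circ> \<Phi>) (prod_chart R c) (q, t) (v + r) (w + s) =
               induced_metric X' c q v w + r \<bullet> s))"

end

theory Submission
  imports Defs
begin

text \<open>
  Fix a vector \<open>a\<close> and consider the height \<open>h = N \<bullet> a\<close> on a hypersurface of constant weighted mean
  curvature in the Gaussian space. Translations of the ambient space change the weighted mean
  curvature only through the weight, and differentiating the curvature equation gives
  \<open>\<Delta> h - 1/2 \<langle>x, \<nabla> h\<rangle> + |A|\<^sup>2 h = 0\<close> (\<open>Jacobi_equation\<close>), where \<open>A\<close> is the second fundamental form.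
  A nonnegative height is therefore superharmonic for the drift Laplacian \<open>L = \<Delta> - 1/2 \<langle>x, \<nabla>\<rangle>\<close>.
  On the other hand \<open>L |x|\<^sup>2 = 2 n + 2 \<lambda> \<langle>x, N\<rangle> - |x|\<^sup>2\<close> is negative outside a compact part of a properly
  immersed hypersurface. Thus the minimum of \<open>h + \<epsilon> |x|\<^sup>2\<close> is attained in one compact set for all
  \<open>\<epsilon> > 0\<close>, so \<open>h\<close> attains its minimum (\<open>height_attains_minimum\<close>), and the strong maximum principle
  (\<open>height_locally_constant_at_minimum\<close>) makes \<open>h\<close> constant (\<open>height_constant\<close>).

  Apply this to the last \<open>p\<close> coordinate vectors. If one of these constant heights is positive, the
  equation leaves \<open>A = 0\<close>, and the hypersurface is a hyperplane (\<open>positive_height_imp_hyperplane\<close>).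
  Otherwise these coordinate vectors are tangent everywhere. A tangent translation lifts to the
  hypersurface, and properness lets the lifts continue for all times (\<open>translation_action\<close>), so the
  hypersurface is the product of the translations and its cross section by the coordinate subspace
  (\<open>hypersurface_slice\<close>, \<open>weighted_slice\<close>, \<open>slice_splits\<close>).

  All local computations take place in flat space. Near a point \<open>q0\<close> the hypersurface is a graph over
  its tangent hyperplane (locale \<open>normal_graph\<close>), and functions on it become functions on an ambient
  ball that are constant in the direction of \<open>N q0\<close>. Since the graph is tangent to its domain at
  \<open>q0\<close>, the flat Laplacian of such a function at the centre of the ball is the Laplacian of the
  hypersurface at \<open>q0\<close>. The Jacobi equation and the maximum principle only ever evaluate Laplacians
  at such a centre, which changes with the point under consideration.
\<close>

section \<open>Smooth functions on open sets\<close>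

text \<open>
  \<open>Ck_on\<close> speaks about the value of \<open>frechet_derivative\<close>. This rule replaces it by any derivative
  that is at hand; the closure properties below are inductions through this rule.
\<close>

lemma Ck_on_SucI:
  assumes "\<And>x. x \<in> W \<Longrightarrow> (f has_derivative f' x) (at x)" "\<And>b. b \<in> Basis \<Longrightarrow> Ck_on k W (\<lambda>x. f' x b)" "open W"
  shows "Ck_on (Suc k) W f"
proof -
  have cong: "Ck_on k W g" if "Ck_on k W f" "\<And>x. x \<in> W \<Longrightarrow> f x = g x" for f g :: "'a \<Rightarrow> 'b" and k
    using that
  proof (induction k arbitrary: f g)
    case 0 then show ?case by (metis Ck_on.simps(1) continuous_on_eq)
  next
    case (Suc k)
    have d: "(g has_derivative frechet_derivative f (at x)) (at x)" if "x \<in> W" for x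
      using Suc.prems that \<open>open W\<close>
      by (metis Ck_on.simps(2) frechet_derivative_works has_derivative_transform_within_open)
    then have "frechet_derivative g (at x) = frechet_derivative f (at x)" if "x \<in> W" for x
      using that frechet_derivative_at by metis
    moreover have "Ck_on k W (\<lambda>x. frechet_derivative g (at x) b)" if "b \<in> Basis" for b
      by (rule Suc.IH[of "\<lambda>x. frechet_derivative f (at x) b"]) (use Suc.prems that calculation in auto)
    ultimately show ?case using d unfolding Ck_on.simps differentiable_def by blast
  qed
  have e: "frechet_derivative f (at x) = f' x" if "x \<in> W" for x
    using frechet_derivative_at[OF assms(1)[OF that]] by simp
  show ?thesis unfolding Ck_on.simps
    using assms(1) cong[OF assms(2)] e by (auto simp: differentiable_def)
qed

lemma Ck_on_SucD:
  assumes "Ck_on (Suc k) W f"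
  shows "x \<in> W \<Longrightarrow> (f has_derivative frechet_derivative f (at x)) (at x)"
    "b \<in> Basis \<Longrightarrow> Ck_on k W (\<lambda>x. frechet_derivative f (at x) b)"
  using assms by (auto simp: frechet_derivative_works[symmetric])

lemma Ck_on_imp_continuous: "Ck_on k W f \<Longrightarrow> continuous_on W f"
  by (cases k) (auto simp: continuous_at_imp_continuous_on differentiable_imp_continuous_within)

lemma Ck_on_SucD': "Ck_on (Suc k) W f \<Longrightarrow> Ck_on k W f"
proof (induction k arbitrary: f)
  case 0 then show ?case using Ck_on_imp_continuous by fastforce
qed auto

lemma Ck_on_subset: "Ck_on k W f \<Longrightarrow> U \<subseteq> W \<Longrightarrow> Ck_on k U f"
  by (induction k arbitrary: f) (auto intro: continuous_on_subset)

lemma Ck_on_cong: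
  assumes "Ck_on k W f" "\<And>x. x \<in> W \<Longrightarrow> f x = g x" "open W"
  shows "Ck_on k W g"
proof (cases k)
  case 0 then show ?thesis using assms by (metis Ck_on.simps(1) continuous_on_eq)
next
  case (Suc j)
  show ?thesis unfolding Suc
  proof (rule Ck_on_SucI[OF _ _ assms(3)])
    show "(g has_derivative frechet_derivative f (at x)) (at x)" if "x \<in> W" for x
      using Ck_on_SucD(1)[OF assms(1)[unfolded Suc] that] that assms(2,3)
      by (metis has_derivative_transform_within_open)
    show "Ck_on j W (\<lambda>x. frechet_derivative f (at x) b)" if "b \<in> Basis" for b
      using Ck_on_SucD(2)[OF assms(1)[unfolded Suc] that] .
  qed
qed

lemma Ck_on_const: "Ck_on k W (\<lambda>x. c)"
  by (induction k arbitrary: c) auto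

lemma Ck_on_linear:
  assumes "bounded_linear L" "open W" "Ck_on k W f" shows "Ck_on k W (\<lambda>x. L (f x))"
  using assms(3)
proof (induction k arbitrary: f)
  case 0 then show ?case using bounded_linear.continuous_on[OF assms(1)] by simp
next
  case (Suc k)
  show ?case
    by (rule Ck_on_SucI[OF bounded_linear.has_derivative[OF assms(1) Ck_on_SucD(1)[OF Suc.prems]]])
       (use Suc assms in auto)
qed

lemma Ck_on_id: "open W \<Longrightarrow> Ck_on k W (\<lambda>x. x)"
proof (cases k)
  case (Suc j)
  then show "open W \<Longrightarrow> ?thesis"
    using Ck_on_SucI[of W "\<lambda>x. x" "\<lambda>_ x. x" j] by (simp add: Ck_on_const del: Ck_on.simps)
qed simp

lemma Ck_on_add:
  assumes "open W" "Ck_on k W f" "Ck_on k W g" shows "Ck_on k W (\<lambda>x. f x + g x)"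
  using assms(2,3)
proof (induction k arbitrary: f g)
  case 0 then show ?case by (auto intro: continuous_intros)
next
  case (Suc k)
  show ?case
    by (rule Ck_on_SucI[OF has_derivative_add[OF Ck_on_SucD(1)[OF Suc.prems(1)] Ck_on_SucD(1)[OF Suc.prems(2)]]])
       (use Suc assms in auto)
qed

text \<open>
  By the Leibniz rule the derivative is a sum of two terms of the same bilinear shape, so that
  one induction covers products, inner products, scalings and compositions of linear maps.
\<close>

lemma Ck_on_bilinear:
  fixes f :: "'a::euclidean_space \<Rightarrow> _"
  assumes "bounded_bilinear B" "open W" "Ck_on k W f" "Ck_on k W g" shows "Ck_on k W (\<lambda>x. B (f x) (g x))"
  using assms(3,4)
proof (induction k arbitrary: f g)
  case 0 then show ?case by (auto intro: bounded_bilinear.continuous_on[OF assms(1)])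
next
  case (Suc k)
  show ?case
  proof (rule Ck_on_SucI[OF bounded_bilinear.FDERIV[OF assms(1) Ck_on_SucD(1)[OF Suc.prems(1)] Ck_on_SucD(1)[OF Suc.prems(2)]]])
    fix b :: 'a assume b: "b \<in> Basis"
    show "Ck_on k W (\<lambda>x. B (f x) (frechet_derivative g (at x) b) + B (frechet_derivative f (at x) b) (g x))"
      using Ck_on_SucD(2)[OF Suc.prems(1) b] Ck_on_SucD(2)[OF Suc.prems(2) b]
        Suc.prems[THEN Ck_on_SucD'] by (intro Ck_on_add assms(2) Suc.IH)
  qed (use assms(2) in auto)
qed

lemma Ck_on_sum:
  assumes "open W" "finite I" "\<And>i. i \<in> I \<Longrightarrow> Ck_on k W (f i)" shows "Ck_on k W (\<lambda>x. \<Sum>i\<in>I. f i x)"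
  using assms(2,3) by (induction I rule: finite_induct) (auto intro: Ck_on_const Ck_on_add assms(1))

lemma linear_expand:
  fixes D :: "'a::euclidean_space \<Rightarrow> 'b::real_vector"
  assumes "linear D" shows "D x = (\<Sum>c\<in>Basis. (x \<bullet> c) *\<^sub>R D c)"
proof -
  have "D x = D (\<Sum>c\<in>Basis. (x \<bullet> c) *\<^sub>R c)" by (simp add: euclidean_representation)
  then show ?thesis using assms by (simp add: linear_sum linear_scale)
qed

text \<open>
  Expanding the outer derivative in the standard basis turns the chain rule into a sum of
  products of functions to which the induction hypothesis applies.
\<close>

lemma Ck_on_compose:
  fixes f :: "'a::euclidean_space \<Rightarrow> 'c::euclidean_space" and g :: "'c \<Rightarrow> 'd::real_normed_vector"
  assumes "open W" "open Z" "Ck_on k W f" "Ck_on k Z g" "\<And>x. x \<in> W \<Longrightarrow> f x \<in> Z"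
  shows "Ck_on k W (\<lambda>x. g (f x))"
  using assms(3,4)
proof (induction k arbitrary: g)
  case 0 then show ?case using assms(5) by (auto intro: continuous_on_compose2)
next
  case (Suc k)
  have fd: "((\<lambda>x. g (f x)) has_derivative (\<lambda>h. frechet_derivative g (at (f x)) (frechet_derivative f (at x) h))) (at x)"
    if "x \<in> W" for x
    using has_derivative_compose[OF Ck_on_SucD(1)[OF Suc.prems(1) that] Ck_on_SucD(1)[OF Suc.prems(2) assms(5)[OF that]]] .
  show ?case
  proof (rule Ck_on_SucI[OF fd])
    fix b :: 'a assume b: "b \<in> Basis"
    have "Ck_on k W (\<lambda>x. \<Sum>c\<in>Basis. (frechet_derivative f (at x) b \<bullet> c) *\<^sub>R frechet_derivative g (at (f x)) c)"
      using Ck_on_SucD(2)[OF Suc.prems(1) b] Ck_on_SucD(2)[OF Suc.prems(2)] Suc.prems(1)[THEN Ck_on_SucD']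
      by (intro Ck_on_sum Ck_on_bilinear[OF bounded_bilinear_scaleR] Ck_on_linear[OF bounded_linear_inner_left]
          Suc.IH) (auto simp: assms)
    then show "Ck_on k W (\<lambda>x. frechet_derivative g (at (f x)) (frechet_derivative f (at x) b))"
    proof (rule Ck_on_cong)
      fix x assume "x \<in> W"
      then have "linear (frechet_derivative g (at (f x)))"
        using Ck_on_SucD(1)[OF Suc.prems(2) assms(5)] has_derivative_linear by blast
      then show "(\<Sum>c\<in>Basis. (frechet_derivative f (at x) b \<bullet> c) *\<^sub>R frechet_derivative g (at (f x)) c) =
         frechet_derivative g (at (f x)) (frechet_derivative f (at x) b)"
        by (rule linear_expand[symmetric])
    qed (rule assms)
  qed (use assms in auto)
qed

definition smooth_open :: "'a::euclidean_space set \<Rightarrow> ('a \<Rightarrow> 'b::real_normed_vector) \<Rightarrow> bool" where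
  "smooth_open W f \<longleftrightarrow> open W \<and> (\<forall>k. Ck_on k W f)"

lemma smooth_open_open: "smooth_open W f \<Longrightarrow> open W"
  by (simp add: smooth_open_def)

lemma smooth_open_deriv: "smooth_open W f \<Longrightarrow> x \<in> W \<Longrightarrow> (f has_derivative frechet_derivative f (at x)) (at x)"
  using Ck_on_SucD(1) smooth_open_def by blast

lemma smooth_open_linear_deriv: "smooth_open W f \<Longrightarrow> x \<in> W \<Longrightarrow> linear (frechet_derivative f (at x))"
  using smooth_open_deriv has_derivative_linear by blast

lemma smooth_open_continuous: "smooth_open W f \<Longrightarrow> continuous_on W f"
  by (auto simp: smooth_open_def dest: Ck_on_imp_continuous)

lemma smooth_open_subset: "smooth_open W f \<Longrightarrow> open U \<Longrightarrow> U \<subseteq> W \<Longrightarrow> smooth_open U f"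
  by (auto simp: smooth_open_def intro: Ck_on_subset)

lemma smooth_open_cong: "smooth_open W f \<Longrightarrow> (\<And>x. x \<in> W \<Longrightarrow> f x = g x) \<Longrightarrow> smooth_open W g"
  unfolding smooth_open_def using Ck_on_cong by blast

lemma smooth_open_const: "open W \<Longrightarrow> smooth_open W (\<lambda>x. c)"
  by (simp add: smooth_open_def Ck_on_const)

lemma smooth_open_id: "open W \<Longrightarrow> smooth_open W (\<lambda>x. x)"
  by (simp add: smooth_open_def Ck_on_id)

lemma smooth_open_linear: "bounded_linear L \<Longrightarrow> smooth_open W f \<Longrightarrow> smooth_open W (\<lambda>x. L (f x))"
  by (simp add: smooth_open_def Ck_on_linear)

lemma smooth_open_add: "smooth_open W f \<Longrightarrow> smooth_open W g \<Longrightarrow> smooth_open W (\<lambda>x. f x + g x)"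
  by (simp add: smooth_open_def Ck_on_add)

lemma smooth_open_bilinear:
  "bounded_bilinear B \<Longrightarrow> smooth_open W f \<Longrightarrow> smooth_open W g \<Longrightarrow> smooth_open W (\<lambda>x. B (f x) (g x))"
  by (simp add: smooth_open_def Ck_on_bilinear)

lemma smooth_open_diff:
  assumes "smooth_open W f" "smooth_open W g" shows "smooth_open W (\<lambda>x. f x - g x)"
  using smooth_open_add[OF assms(1) smooth_open_linear[OF bounded_linear_minus[OF bounded_linear_ident] assms(2)]] by simp

lemma smooth_open_sum:
  "open W \<Longrightarrow> finite I \<Longrightarrow> (\<And>i. i \<in> I \<Longrightarrow> smooth_open W (f i)) \<Longrightarrow> smooth_open W (\<lambda>x. \<Sum>i\<in>I. f i x)"
  by (simp add: smooth_open_def Ck_on_sum)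

lemma smooth_open_compose:
  fixes f :: "'a::euclidean_space \<Rightarrow> 'c::euclidean_space"
  shows "smooth_open W f \<Longrightarrow> smooth_open Z g \<Longrightarrow> (\<And>x. x \<in> W \<Longrightarrow> f x \<in> Z) \<Longrightarrow> smooth_open W (\<lambda>x. g (f x))"
  by (auto simp: smooth_open_def intro: Ck_on_compose)

lemma smooth_open_inner: "smooth_open W f \<Longrightarrow> smooth_open W g \<Longrightarrow> smooth_open W (\<lambda>x. f x \<bullet> g x)"
  using smooth_open_bilinear[OF bounded_bilinear_inner] .

lemma smooth_open_scaleR: "smooth_open W f \<Longrightarrow> smooth_open W g \<Longrightarrow> smooth_open W (\<lambda>x. f x *\<^sub>R g x)"
  using smooth_open_bilinear[OF bounded_bilinear_scaleR] .

lemma smooth_open_mult: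
  fixes f g :: "'a::euclidean_space \<Rightarrow> real"
  shows "smooth_open W f \<Longrightarrow> smooth_open W g \<Longrightarrow> smooth_open W (\<lambda>x. f x * g x)"
  using smooth_open_bilinear[OF bounded_bilinear_mult] .

lemma smooth_open_directional:
  fixes f :: "'a::euclidean_space \<Rightarrow> 'b::real_normed_vector"
  assumes "smooth_open W f" shows "smooth_open W (\<lambda>x. frechet_derivative f (at x) v)"
proof -
  have "smooth_open W (\<lambda>x. frechet_derivative f (at x) b)" if "b \<in> Basis" for b
    using assms that Ck_on_SucD(2) unfolding smooth_open_def by blast
  then have "smooth_open W (\<lambda>x. \<Sum>b\<in>Basis. (v \<bullet> b) *\<^sub>R frechet_derivative f (at x) b)"
    using assms by (intro smooth_open_sum smooth_open_linear[OF bounded_linear_scaleR_right] )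
        (auto dest: smooth_open_open)
  then show ?thesis
    by (rule smooth_open_cong) (rule linear_expand[symmetric], rule smooth_open_linear_deriv[OF assms], assumption)
qed

text \<open>
  The outer function comes with the sequence \<open>g 0, g 1, \<dots>\<close> of its derivatives. Its uses are the
  reciprocal and the exponential barriers of the maximum principle.
\<close>

lemma smooth_open_real_compose:
  fixes f :: "'a::euclidean_space \<Rightarrow> real" and g :: "nat \<Rightarrow> real \<Rightarrow> real"
  assumes "smooth_open W f" "\<And>j t. t \<in> T \<Longrightarrow> (g j has_real_derivative g (Suc j) t) (at t)"
    "\<And>x. x \<in> W \<Longrightarrow> f x \<in> T"
  shows "smooth_open W (\<lambda>x. g 0 (f x))"
proof -
  have o: "open W" using assms(1) smooth_open_open by blast
  have "Ck_on k W (\<lambda>x. g j (f x))" for k j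
  proof (induction k arbitrary: j)
    case 0
    have "isCont (g j) (f x)" if "x \<in> W" for x using assms(2,3) that DERIV_isCont by blast
    moreover have "isCont f x" if "x \<in> W" for x
      using that assms(1) o smooth_open_continuous continuous_on_eq_continuous_at by blast
    ultimately show ?case by (simp add: continuous_at_imp_continuous_on isCont_o2)
  next
    case (Suc k)
    show ?case
    proof (rule Ck_on_SucI[OF _ _ o])
      show "((\<lambda>x. g j (f x)) has_derivative (\<lambda>h. frechet_derivative f (at x) h * g (Suc j) (f x))) (at x)" if "x \<in> W" for x
        using has_derivative_compose[OF smooth_open_deriv[OF assms(1) that] assms(2)[OF assms(3)[OF that], unfolded has_field_derivative_def]]
        by (simp add: mult.commute)
      show "Ck_on k W (\<lambda>x. frechet_derivative f (at x) b * g (Suc j) (f x))" for b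
        using smooth_open_directional[OF assms(1), of b] Suc o
        by (auto simp: smooth_open_def intro: Ck_on_bilinear[OF bounded_bilinear_mult])
    qed
  qed
  then show ?thesis using o smooth_open_def by blast
qed

lemma smooth_open_inverse:
  fixes f :: "'a::euclidean_space \<Rightarrow> real"
  assumes "smooth_open W f" "\<And>x. x \<in> W \<Longrightarrow> f x \<noteq> 0" shows "smooth_open W (\<lambda>x. 1 / f x)"
proof -
  let ?g = "\<lambda>j t. (-1) ^ j * fact j * inverse t ^ Suc j :: real"
  have "smooth_open W (\<lambda>x. ?g 0 (f x))"
  proof (rule smooth_open_real_compose[where T="- {0}" and g="?g"])
    fix j and t :: real assume "t \<in> - {0}"
    then have "((\<lambda>t. inverse t ^ Suc j) has_real_derivative
        real (Suc j) * (- (inverse t ^ Suc (Suc 0))) * inverse t ^ j) (at t)"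
      using DERIV_power[OF DERIV_inverse[of t UNIV], of "Suc j"] by (simp add: mult_ac)
    from DERIV_cmult[OF this, of "(-1) ^ j * fact j"]
    show "(?g j has_real_derivative ?g (Suc j) t) (at t)"
      by (simp add: mult_ac)
  qed (use assms in auto)
  then show ?thesis by (simp add: inverse_eq_divide)
qed

text \<open>
  Only the continuity clause of \<open>Ck_on\<close> refers to the set as a whole, and on open sets continuity
  is local too.
\<close>

lemma smooth_open_local:
  assumes "\<And>x. x \<in> V \<Longrightarrow> \<exists>U. x \<in> U \<and> U \<subseteq> V \<and> smooth_open U f"
  shows "smooth_open V f"
proof -
  have "\<exists>T. open T \<and> x \<in> T \<and> T \<subseteq> V" if "x \<in> V" for x
    using assms[OF that] smooth_open_open by metis
  then have o: "open V" using open_subopen[of V] by blast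
  have "Ck_on k V f" if "\<And>x. x \<in> V \<Longrightarrow> \<exists>U. open U \<and> x \<in> U \<and> U \<subseteq> V \<and> Ck_on k U f" for k
    using that
  proof (induction k arbitrary: f)
    case 0
    show ?case unfolding Ck_on.simps
    proof (rule continuous_at_imp_continuous_on, rule ballI)
      fix x assume "x \<in> V"
      then show "isCont f x" using 0 continuous_on_eq_continuous_at by (metis Ck_on.simps(1))
    qed
  next
    case (Suc k)
    show ?case unfolding Ck_on.simps
    proof (intro conjI ballI)
      show "f differentiable at x" if "x \<in> V" for x using Suc.prems[OF that] by auto
      fix b :: 'a assume b: "b \<in> Basis"
      show "Ck_on k V (\<lambda>x. frechet_derivative f (at x) b)"
      proof (rule Suc.IH)
        fix x assume "x \<in> V"
        from Suc.prems[OF this] b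
        show "\<exists>U. open U \<and> x \<in> U \<and> U \<subseteq> V \<and> Ck_on k U (\<lambda>x. frechet_derivative f (at x) b)" by auto
      qed
    qed
  qed
  moreover have "\<exists>U. open U \<and> x \<in> U \<and> U \<subseteq> V \<and> Ck_on k U f" if "x \<in> V" for k x
    using assms[OF that] unfolding smooth_open_def by blast
  ultimately show ?thesis using o unfolding smooth_open_def by blast
qed

lemma smooth_on_iff_smooth_open:
  "smooth_on S f \<longleftrightarrow> (\<forall>x\<in>S. \<exists>W F. x \<in> W \<and> smooth_open W F \<and> (\<forall>y\<in>S \<inter> W. F y = f y))"
  unfolding smooth_on_def smooth_open_def by (rule ball_cong[OF refl]) blast

lemma smooth_open_differentiable: "smooth_open W f \<Longrightarrow> x \<in> W \<Longrightarrow> f differentiable (at x)"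
  using smooth_open_deriv differentiable_def by blast

lemma frechet_derivative_eqI: "(f has_derivative f') (at x) \<Longrightarrow> frechet_derivative f (at x) v = f' v"
  by (simp flip: frechet_derivative_at)

lemma frechet_derivative_cong:
  assumes "open V" "z \<in> V" "\<And>y. y \<in> V \<Longrightarrow> f y = g y" "f differentiable (at z)"
  shows "frechet_derivative f (at z) = frechet_derivative g (at z)"
proof -
  have "(f has_derivative frechet_derivative f (at z)) (at z)" using assms(4) frechet_derivative_works by blast
  then have "(g has_derivative frechet_derivative f (at z)) (at z)"
    by (rule has_derivative_transform_within_open[OF _ assms(1,2)]) (rule assms(3))
  then show ?thesis by (rule frechet_derivative_at)
qed

lemma eventually_line_in_open:
  fixes y v :: "'a::real_normed_vector"
  assumes "open T" "y \<in> T" shows "eventually (\<lambda>t. y + t *\<^sub>R v \<in> T) (nhds 0)"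
proof -
  have "((\<lambda>t. y + t *\<^sub>R v) \<longlongrightarrow> y + 0 *\<^sub>R v) (nhds 0)"
    by (intro tendsto_intros filterlim_ident)
  then show ?thesis using assms by (intro topological_tendstoD) auto
qed

lemma has_vector_derivative_line:
  assumes "(F has_derivative F') (at y)" shows "((\<lambda>t. F (y + t *\<^sub>R v)) has_vector_derivative F' v) (at 0)"
proof -
  have "((\<lambda>t::real. y + t *\<^sub>R v) has_derivative (\<lambda>s. s *\<^sub>R v)) (at 0)"
    by (auto intro!: derivative_eq_intros)
  moreover have "(F has_derivative F') (at (y + 0 *\<^sub>R v))" using assms by simp
  ultimately have "((\<lambda>t. F (y + t *\<^sub>R v)) has_derivative (\<lambda>s. F' (s *\<^sub>R v))) (at 0)"
    by (rule has_derivative_compose)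
  moreover have "F' (s *\<^sub>R v) = s *\<^sub>R F' v" for s
    using assms has_derivative_linear linear_scale by blast
  ultimately show ?thesis by (simp add: has_vector_derivative_def)
qed

lemma dir_deriv_eqI:
  assumes "(F has_derivative F') (at y)" "eventually (\<lambda>t. f (y + t *\<^sub>R v) = F (y + t *\<^sub>R v)) (nhds 0)"
  shows "((\<lambda>t. f (y + t *\<^sub>R v)) has_vector_derivative F' v) (at 0)" "dir_deriv f y v = F' v"
proof -
  have "eventually (\<lambda>t. F (y + t *\<^sub>R v) = f (y + t *\<^sub>R v)) (nhds 0)" using assms(2) by eventually_elim simp
  moreover from this have "F (y + 0 *\<^sub>R v) = f (y + 0 *\<^sub>R v)" by (rule eventually_nhds_x_imp_x)
  ultimately show 1: "((\<lambda>t. f (y + t *\<^sub>R v)) has_vector_derivative F' v) (at 0)"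
    using has_vector_derivative_line[OF assms(1), of v] has_vector_derivative_cong_ev[where x=0 and S=UNIV and f="\<lambda>t. F (y + t *\<^sub>R v)" and g="\<lambda>t. f (y + t *\<^sub>R v)"]
    by (simp add: eventually_mono)
  show "dir_deriv f y v = F' v" unfolding dir_deriv_def using vector_derivative_at[OF 1] .
qed

lemma derivative_zero_of_constant_direction:
  assumes "(f has_derivative f') (at x)" "eventually (\<lambda>t. f (x + t *\<^sub>R v) = f x) (nhds 0)"
  shows "f' v = 0"
  using dir_deriv_eqI(1)[OF has_derivative_const[of "f x"] assms(2)] has_vector_derivative_line[OF assms(1)]
    vector_derivative_unique_at by blast

section \<open>The smooth inverse function theorem\<close>

text \<open>
  Near a zero \<open>x\<close> of \<open>g\<close> the product differs from \<open>P (f x) (g y)\<close> by \<open>P (f y - f x) (g y)\<close>, which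
  is \<open>o(|y - x|)\<close>. This differentiates the inverse of an operator as soon as it is known to be
  continuous.
\<close>

lemma has_derivative_mult_vanishing:
  assumes P: "bounded_bilinear P" and f: "isCont f x" and g: "(g has_derivative g') (at x)" "g x = 0"
  shows "((\<lambda>y. P (f y) (g y)) has_derivative (\<lambda>h. P (f x) (g' h))) (at x)"
proof -
  interpret bounded_bilinear P by fact
  have 1: "((\<lambda>y. P (f x) (g y)) has_derivative (\<lambda>h. P (f x) (g' h))) (at x)"
    by (rule bounded_linear.has_derivative[OF bounded_linear_right g(1)])
  have bl: "bounded_linear g'" using g(1) has_derivative_bounded_linear by blast
  then obtain K where K: "\<And>h. norm (g' h) \<le> norm h * K" using bounded_linear.bounded by blast
  have lim: "((\<lambda>y. (g y - g' (y - x)) /\<^sub>R norm (y - x)) \<longlongrightarrow> 0) (at x)"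
    using g by (simp add: has_derivative_at_within)
  have C: "eventually (\<lambda>y. norm ((g y - g' (y - x)) /\<^sub>R norm (y - x)) < 1) (at x)"
    using tendsto_norm_zero[OF lim] by (rule order_tendstoD) simp
  have "Bfun (\<lambda>y. g y /\<^sub>R norm (y - x)) (at x)"
  proof (rule BfunI)
    show "eventually (\<lambda>y. norm (g y /\<^sub>R norm (y - x)) \<le> 1 + K) (at x)"
      using C eventually_neq_at_within[of x x UNIV]
    proof (eventually_elim)
      case (elim y)
      then have "y \<noteq> x" by simp
      have "norm (g y /\<^sub>R norm (y - x)) \<le> norm ((g y - g' (y - x)) /\<^sub>R norm (y - x)) + norm (g' (y - x) /\<^sub>R norm (y - x))"
        by (metis diff_add_cancel norm_triangle_ineq scaleR_add_right)
      moreover have "norm (g' (y - x) /\<^sub>R norm (y - x)) \<le> K"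
        using K[of "y - x"] \<open>y \<noteq> x\<close> by (simp add: field_simps)
      ultimately show ?case using elim by linarith
    qed
  qed
  moreover have "Zfun (\<lambda>y. f y - f x) (at x)"
    using f by (simp add: isCont_def tendsto_Zfun_iff)
  ultimately have "Zfun (\<lambda>y. P (f y - f x) (g y /\<^sub>R norm (y - x))) (at x)"
    by (rule Zfun_prod_Bfun[rotated])
  then have "((\<lambda>y. P (f y - f x) (g y) /\<^sub>R norm (y - x)) \<longlongrightarrow> 0) (at x)"
    by (simp add: tendsto_Zfun_iff scaleR_right)
  then have 2: "((\<lambda>y. P (f y - f x) (g y)) has_derivative (\<lambda>h. 0)) (at x)"
    using g(2) by (simp add: has_derivative_at_within zero_right zero_left)
  show ?thesis
    using has_derivative_add[OF 1 2] by (simp add: diff_left)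
qed

text \<open>
  Everything follows from the identity \<open>B y - B x = - B y (A y - A x) B x\<close>: first a bound for
  \<open>B\<close> near \<open>x\<close> and continuity, then the derivative \<open>- B A' B\<close>, and by induction as many derivatives
  as \<open>A\<close> has.
\<close>

lemma Ck_on_blinfun_inverse:
  fixes A B :: "'a::euclidean_space \<Rightarrow> ('b::real_normed_vector \<Rightarrow>\<^sub>L 'b)"
  assumes W: "open W" and AB: "\<And>x. x \<in> W \<Longrightarrow> A x o\<^sub>L B x = id_blinfun" "\<And>x. x \<in> W \<Longrightarrow> B x o\<^sub>L A x = id_blinfun"
    and "Ck_on k W A"
  shows "Ck_on k W B"
  using assms(4)
proof (induction k)
  interpret c: bounded_bilinear "(o\<^sub>L) :: ('b \<Rightarrow>\<^sub>L 'b) \<Rightarrow> ('b \<Rightarrow>\<^sub>L 'b) \<Rightarrow> _" by (rule bounded_bilinear_blinfun_compose)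
  have diff: "B y = B x - (B y o\<^sub>L ((A y - A x) o\<^sub>L B x))" if "x \<in> W" "y \<in> W" for x y
  proof -
    have "B y o\<^sub>L ((A y - A x) o\<^sub>L B x) = ((B y o\<^sub>L A y) o\<^sub>L B x) - (B y o\<^sub>L (A x o\<^sub>L B x))"
      by (auto intro!: blinfun_eqI simp: blinfun.bilinear_simps)
    moreover have "id_blinfun o\<^sub>L B x = B x" "B y o\<^sub>L id_blinfun = B y" by (auto intro!: blinfun_eqI)
    ultimately show ?thesis using AB that by simp
  qed
  have cont: "isCont B x" if "continuous_on W A" "x \<in> W" for x
  proof -
    have cA: "(A \<longlongrightarrow> A x) (at x)" using that W by (metis continuous_on_eq_continuous_at isCont_def)
    then have z: "((\<lambda>y. norm (A y - A x)) \<longlongrightarrow> 0) (at x)" by (simp add: LIM_zero tendsto_norm_zero)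
    then have z': "((\<lambda>y. norm (A y - A x) * norm (B x)) \<longlongrightarrow> 0) (at x)" by (rule tendsto_mult_left_zero)
    have e1: "eventually (\<lambda>y. norm (A y - A x) * norm (B x) < 1/2) (at x)"
      using z' by (rule order_tendstoD) simp
    have e2: "eventually (\<lambda>y. y \<in> W) (at x)" using W that(2) by (rule topological_tendstoD[OF tendsto_ident_at])
    have "((\<lambda>y. 2 * norm (B x) * (norm (A y - A x) * norm (B x))) \<longlongrightarrow> 0) (at x)"
      using z' by (rule tendsto_mult_right_zero)
    moreover have "eventually (\<lambda>y. norm (B y - B x) \<le> 2 * norm (B x) * (norm (A y - A x) * norm (B x))) (at x)"
      using e1 e2
    proof eventually_elim
      case (elim y)
      let ?t = "norm (A y - A x) * norm (B x)"
      have "B y - B x = - (B y o\<^sub>L ((A y - A x) o\<^sub>L B x))" using diff[OF that(2) elim(2)] by (simp add: algebra_simps)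
      then have "norm (B y - B x) = norm (B y o\<^sub>L ((A y - A x) o\<^sub>L B x))" by simp
      also have "\<dots> \<le> norm (B y) * norm ((A y - A x) o\<^sub>L B x)" by (rule norm_blinfun_compose)
      also have "\<dots> \<le> norm (B y) * ?t" by (intro mult_left_mono norm_blinfun_compose) simp
      finally have 1: "norm (B y - B x) \<le> norm (B y) * ?t" .
      have "norm (B y) \<le> norm (B x) + norm (B y - B x)" by (metis add.commute diff_add_cancel norm_triangle_ineq)
      also have "norm (B y - B x) \<le> norm (B y) * (1/2)"
        using 1 elim(1) by (meson less_imp_le mult_left_mono norm_ge_zero order_trans)
      finally have "norm (B y) \<le> 2 * norm (B x)" by simp
      then have "norm (B y) * ?t \<le> 2 * norm (B x) * ?t" by (intro mult_right_mono) auto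
      with 1 show ?case by linarith
    qed
    ultimately have "((\<lambda>y. B y - B x) \<longlongrightarrow> 0) (at x)" by (rule Lim_null_comparison[rotated])
    then show ?thesis by (simp add: isCont_def LIM_zero_iff)
  qed
  {
    case 0
    then show ?case using cont by (simp add: continuous_at_imp_continuous_on)
  next
    case (Suc k)
    have d: "(B has_derivative (\<lambda>h. - (B x o\<^sub>L (frechet_derivative A (at x) h o\<^sub>L B x)))) (at x)" if "x \<in> W" for x
    proof -
      have cB: "isCont B x" using cont that Ck_on_imp_continuous[OF Suc.prems] by blast
      have "((\<lambda>y. (A y - A x) o\<^sub>L B x) has_derivative (\<lambda>h. (frechet_derivative A (at x) h - 0) o\<^sub>L B x)) (at x)"
        by (intro bounded_linear.has_derivative[OF c.bounded_linear_left] has_derivative_diff has_derivative_const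
            Ck_on_SucD(1)[OF Suc.prems that])
      then have "((\<lambda>y. B y o\<^sub>L ((A y - A x) o\<^sub>L B x)) has_derivative (\<lambda>h. B x o\<^sub>L ((frechet_derivative A (at x) h - 0) o\<^sub>L B x))) (at x)"
        by (rule has_derivative_mult_vanishing[OF bounded_bilinear_blinfun_compose cB]) simp
      then have "((\<lambda>y. B x - (B y o\<^sub>L ((A y - A x) o\<^sub>L B x))) has_derivative (\<lambda>h. - (B x o\<^sub>L (frechet_derivative A (at x) h o\<^sub>L B x)))) (at x)"
        using has_derivative_diff[OF has_derivative_const[of "B x"]] by force
      then show ?thesis
        by (rule has_derivative_transform_within_open[OF _ W that]) (rule diff[OF that, symmetric])
    qed
    show ?case
    proof (rule Ck_on_SucI[OF d _ W])
      fix b :: 'a assume b: "b \<in> Basis"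
      show "Ck_on k W (\<lambda>x. - (B x o\<^sub>L (frechet_derivative A (at x) b o\<^sub>L B x)))"
        using Suc.IH[OF Ck_on_SucD'[OF Suc.prems]] Ck_on_SucD(2)[OF Suc.prems b]
        by (intro Ck_on_linear[OF bounded_linear_minus[OF bounded_linear_ident] W]
            Ck_on_bilinear[OF bounded_bilinear_blinfun_compose W])
    qed
  }
qed

text \<open>
  A linear map is the sum, over the standard basis, of the rank-one maps made from its columns.
\<close>

lemma smooth_open_Blinfun:
  fixes D :: "'a::euclidean_space \<Rightarrow> 'b::euclidean_space \<Rightarrow> 'c::real_normed_vector"
  assumes "open W" "\<And>x. x \<in> W \<Longrightarrow> bounded_linear (D x)" "\<And>b. b \<in> Basis \<Longrightarrow> smooth_open W (\<lambda>x. D x b)"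
  shows "smooth_open W (\<lambda>x. Blinfun (D x))"
proof -
  have "smooth_open W (\<lambda>x. \<Sum>c\<in>Basis. blinfun_scaleR_left (D x c) o\<^sub>L blinfun_inner_left c)"
  proof (intro smooth_open_sum assms(1) finite_Basis)
    fix c :: 'b assume "c \<in> Basis"
    have "bounded_linear (\<lambda>v. blinfun_scaleR_left v o\<^sub>L blinfun_inner_left c :: 'b \<Rightarrow>\<^sub>L 'c)"
      by (rule bounded_linear_compose[OF bounded_bilinear.bounded_linear_left[OF bounded_bilinear_blinfun_compose] bounded_linear_blinfun_scaleR_left])
    then show "smooth_open W (\<lambda>x. blinfun_scaleR_left (D x c) o\<^sub>L blinfun_inner_left c)"
      using assms(3)[OF \<open>c \<in> Basis\<close>] by (rule smooth_open_linear)
  qed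
  then show ?thesis
  proof (rule smooth_open_cong)
    fix x assume x: "x \<in> W"
    show "(\<Sum>c\<in>Basis. blinfun_scaleR_left (D x c) o\<^sub>L blinfun_inner_left c) = Blinfun (D x)"
    proof (rule blinfun_eqI)
      fix h
      show "blinfun_apply (\<Sum>c\<in>Basis. blinfun_scaleR_left (D x c) o\<^sub>L blinfun_inner_left c) h = blinfun_apply (Blinfun (D x)) h"
        using linear_expand[OF bounded_linear.linear[OF assms(2)[OF x]], of h]
        by (simp add: blinfun.sum_left bounded_linear_Blinfun_apply[OF assms(2)[OF x]] inner_commute)
    qed
  qed
qed

text \<open>
  The \<open>C\<^sup>1\<close> theorem provides \<open>G\<close> with derivative \<open>(F' \<circ> G)\<^sup>-\<^sup>1\<close>. If \<open>G\<close> is \<open>C\<^sup>k\<close>, then so are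
  \<open>F' \<circ> G\<close> and its inverse, and \<open>G\<close> is \<open>C\<^sup>k\<^sup>+\<^sup>1\<close>.
\<close>

lemma smooth_inverse_function:
  fixes F :: "'a::euclidean_space \<Rightarrow> 'a"
  assumes F: "smooth_open W F" and w0: "w0 \<in> W" and inj: "inj (frechet_derivative F (at w0))"
  obtains U V G where "open U" "U \<subseteq> W" "w0 \<in> U" "open V" "F w0 \<in> V" "homeomorphism U V F G"
    "smooth_open V G" "\<And>y. y \<in> V \<Longrightarrow> bij (frechet_derivative F (at (G y)))"
    "\<And>y. y \<in> V \<Longrightarrow> frechet_derivative G (at y) = inv (frechet_derivative F (at (G y)))"
proof -
  define f' where "f' = (\<lambda>x. Blinfun (frechet_derivative F (at x)))"
  have W: "open W" using F smooth_open_open by blast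
  have bl: "bounded_linear (frechet_derivative F (at x))" if "x \<in> W" for x
    using smooth_open_deriv[OF F that] has_derivative_bounded_linear by blast
  have ap: "blinfun_apply (f' x) = frechet_derivative F (at x)" if "x \<in> W" for x
    unfolding f'_def using bounded_linear_Blinfun_apply[OF bl[OF that]] .
  have sf: "smooth_open W f'" unfolding f'_def
    using smooth_open_Blinfun[OF W bl smooth_open_directional[OF F]] by simp
  have lin0: "linear (frechet_derivative F (at w0))" using smooth_open_linear_deriv[OF F w0] .
  obtain g0 where g0: "linear g0" "g0 \<circ> frechet_derivative F (at w0) = id"
    using linear_injective_left_inverse[OF lin0 inj] by blast
  have invf: "Blinfun g0 o\<^sub>L f' w0 = id_blinfun"
  proof (rule blinfun_eqI)
    fix h
    have "blinfun_apply (Blinfun g0) (frechet_derivative F (at w0) h) = h"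
      using g0 bounded_linear_Blinfun_apply[of g0] linear_conv_bounded_linear by (metis comp_apply id_apply)
    then show "blinfun_apply (Blinfun g0 o\<^sub>L f' w0) h = blinfun_apply id_blinfun h"
      by (simp add: ap[OF w0])
  qed
  have der: "(F has_derivative blinfun_apply (f' x)) (at x)" if "x \<in> W" for x
    using smooth_open_deriv[OF F that] ap[OF that] by simp
  obtain U V G g' where *: "open U" "U \<subseteq> W" "w0 \<in> U" "open V" "F w0 \<in> V" "homeomorphism U V F G"
    "\<And>y. y \<in> V \<Longrightarrow> (G has_derivative (g' y)) (at y)"
    "\<And>y. y \<in> V \<Longrightarrow> g' y = inv (blinfun_apply (f'(G y)))"
    "\<And>y. y \<in> V \<Longrightarrow> bij (blinfun_apply (f'(G y)))"
    using inverse_function_theorem[OF W der smooth_open_continuous[OF sf] w0 invf] by blast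
  have GU: "G y \<in> U" "G y \<in> W" if "y \<in> V" for y
    using that *(2,6) by (auto simp: homeomorphism_def)
  define B where "B = (\<lambda>y. Blinfun (g' y))"
  have apB: "blinfun_apply (B y) = g' y" if "y \<in> V" for y
    unfolding B_def using bounded_linear_Blinfun_apply *(7)[OF that] has_derivative_bounded_linear by blast
  have AB: "f' (G y) o\<^sub>L B y = id_blinfun" "B y o\<^sub>L f' (G y) = id_blinfun" if "y \<in> V" for y
    using *(8,9)[OF that] apB[OF that] by (auto intro!: blinfun_eqI simp: bij_is_surj surj_f_inv_f bij_is_inj)
  have "Ck_on k V G" for k
  proof (induction k)
    case 0 then show ?case using *(6) by (simp add: homeomorphism_def)
  next
    case (Suc k)
    have "Ck_on k V (\<lambda>y. f' (G y))"
      using Ck_on_compose[OF *(4) W Suc, of f'] sf GU by (auto simp: smooth_open_def)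
    then have B: "Ck_on k V B" by (rule Ck_on_blinfun_inverse[OF *(4) AB, rotated 2])
    have d: "(G has_derivative blinfun_apply (B y)) (at y)" if "y \<in> V" for y
      using *(7)[OF that] apB[OF that] by simp
    show ?case
    proof (rule Ck_on_SucI[OF d _ *(4)])
      show "Ck_on k V (\<lambda>y. blinfun_apply (B y) b)" for b
        using Ck_on_linear[OF blinfun.bounded_linear_left *(4) B] .
    qed
  qed
  then have "smooth_open V G" using *(4) smooth_open_def by blast
  moreover have "frechet_derivative G (at y) = inv (frechet_derivative F (at (G y)))" if "y \<in> V" for y
    using *(7,8)[OF that] ap[OF GU(2)[OF that]] frechet_derivative_at by metis
  moreover have "bij (frechet_derivative F (at (G y)))" if "y \<in> V" for y
    using *(9)[OF that] ap[OF GU(2)[OF that]] by simp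
  ultimately show ?thesis using that * by blast
qed

section \<open>Second derivatives\<close>

lemma smooth_open_line_derivative:
  fixes f :: "'a::euclidean_space \<Rightarrow> real"
  assumes "smooth_open W f" "x + t *\<^sub>R v \<in> W"
  shows "((\<lambda>t. f (x + t *\<^sub>R v)) has_real_derivative frechet_derivative f (at (x + t *\<^sub>R v)) v) (at t)"
proof -
  have "((\<lambda>t. x + t *\<^sub>R v) has_derivative (\<lambda>s. s *\<^sub>R v)) (at t)"
    by (auto intro!: derivative_eq_intros)
  from has_derivative_compose[OF this smooth_open_deriv[OF assms]]
  moreover have "(\<lambda>s. frechet_derivative f (at (x + t *\<^sub>R v)) (s *\<^sub>R v)) = (*) (frechet_derivative f (at (x + t *\<^sub>R v)) v)"
    using linear_scale[OF smooth_open_linear_deriv[OF assms]] by (simp add: fun_eq_iff)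
  ultimately show ?thesis by (simp add: has_field_derivative_def)
qed

lemma constant_directional_derivative:
  fixes f :: "'a::euclidean_space \<Rightarrow> real"
  assumes f: "smooth_open V f" "convex V" and z: "z \<in> V" "z + w \<in> V" and k: "\<And>y. y \<in> V \<Longrightarrow> frechet_derivative f (at y) w = k"
  shows "f (z + w) = f z + k"
proof -
  have seg: "z + t *\<^sub>R w \<in> V" if "0 \<le> t" "t \<le> 1" for t
  proof -
    have "(1 - t) *\<^sub>R z + t *\<^sub>R (z + w) \<in> V" using f(2) z that by (simp add: convex_alt)
    then show ?thesis by (simp add: algebra_simps)
  qed
  have "\<exists>t>0. t < 1 \<and> f (z + 1 *\<^sub>R w) - f (z + 0 *\<^sub>R w) = (1 - 0) * frechet_derivative f (at (z + t *\<^sub>R w)) w"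
    by (rule MVT2) (use seg smooth_open_line_derivative[OF f(1)] in auto)
  then obtain t where "0 < t" "t < 1" "f (z + w) - f z = frechet_derivative f (at (z + t *\<^sub>R w)) w" by auto
  then show ?thesis using k[OF seg[of t]] by simp
qed

text \<open>
  Two applications of the mean value theorem to a second difference that is symmetric in \<open>a\<close>
  and \<open>b\<close>; exchanging the two directions yields the symmetry of second derivatives.
\<close>

lemma mixed_difference_quotient:
  fixes f :: "'a::euclidean_space \<Rightarrow> real"
  assumes f: "smooth_open W f" and h: "0 < h" and W: "\<And>s t. 0 \<le> s \<Longrightarrow> s \<le> h \<Longrightarrow> 0 \<le> t \<Longrightarrow> t \<le> h \<Longrightarrow> x + s *\<^sub>R a + t *\<^sub>R b \<in> W"
  obtains s t where "0 \<le> s" "s \<le> h" "0 \<le> t" "t \<le> h"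
   "f (x + h *\<^sub>R a + h *\<^sub>R b) - f (x + h *\<^sub>R a) - f (x + h *\<^sub>R b) + f x =
      h * (h * frechet_derivative (\<lambda>y. frechet_derivative f (at y) a) (at (x + s *\<^sub>R a + t *\<^sub>R b)) b)"
proof -
  let ?g = "\<lambda>s. f (x + h *\<^sub>R b + s *\<^sub>R a) - f (x + s *\<^sub>R a)"
  have "\<exists>s>0. s < h \<and> ?g h - ?g 0 = (h - 0) * (frechet_derivative f (at (x + h *\<^sub>R b + s *\<^sub>R a)) a - frechet_derivative f (at (x + s *\<^sub>R a)) a)"
  proof (rule MVT2[OF h])
    fix s assume s: "0 \<le> s" "s \<le> h"
    show "(?g has_real_derivative frechet_derivative f (at (x + h *\<^sub>R b + s *\<^sub>R a)) a - frechet_derivative f (at (x + s *\<^sub>R a)) a) (at s)"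
      using W[of s h] W[of s 0] s h
      by (intro DERIV_diff smooth_open_line_derivative[OF f]) (auto simp: algebra_simps)
  qed
  then obtain s where s: "0 < s" "s < h" "?g h - ?g 0 = h * (frechet_derivative f (at (x + h *\<^sub>R b + s *\<^sub>R a)) a - frechet_derivative f (at (x + s *\<^sub>R a)) a)"
    by auto
  let ?k = "\<lambda>t. frechet_derivative f (at (x + s *\<^sub>R a + t *\<^sub>R b)) a"
  have "\<exists>t>0. t < h \<and> ?k h - ?k 0 = (h - 0) * frechet_derivative (\<lambda>y. frechet_derivative f (at y) a) (at (x + s *\<^sub>R a + t *\<^sub>R b)) b"
    using W s h by (intro MVT2 smooth_open_line_derivative[OF smooth_open_directional[OF f]]) auto
  then obtain t where t: "0 < t" "t < h" "?k h - ?k 0 = h * frechet_derivative (\<lambda>y. frechet_derivative f (at y) a) (at (x + s *\<^sub>R a + t *\<^sub>R b)) b"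
    by auto
  have "?g h - ?g 0 = h * (?k h - ?k 0)" using s(3) by (simp add: algebra_simps)
  then show ?thesis using that[of s t] s t by (simp add: algebra_simps)
qed

lemma second_derivative_symmetric:
  fixes f :: "'a::euclidean_space \<Rightarrow> real"
  assumes f: "smooth_open W f" and x: "x \<in> W"
  shows "frechet_derivative (\<lambda>y. frechet_derivative f (at y) a) (at x) b =
         frechet_derivative (\<lambda>y. frechet_derivative f (at y) b) (at x) a" (is "?D a b x = ?D b a x")
proof (rule ccontr)
  assume ne: "?D a b x \<noteq> ?D b a x"
  have W: "open W" using f smooth_open_open by blast
  have cont: "isCont (?D a b) x" for a b
    using smooth_open_continuous[OF smooth_open_directional[OF smooth_open_directional[OF f]]] W x
    by (metis continuous_on_eq_continuous_at)
  define \<epsilon> where "\<epsilon> = \<bar>?D a b x - ?D b a x\<bar> / 2"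
  have \<epsilon>: "\<epsilon> > 0" using ne by (simp add: \<epsilon>_def)
  obtain d1 where d1: "d1 > 0" "\<And>y. dist y x < d1 \<Longrightarrow> \<bar>?D a b y - ?D a b x\<bar> < \<epsilon>"
    using cont[of a b] \<epsilon> unfolding continuous_at_eps_delta dist_real_def by blast
  obtain d2 where d2: "d2 > 0" "\<And>y. dist y x < d2 \<Longrightarrow> \<bar>?D b a y - ?D b a x\<bar> < \<epsilon>"
    using cont[of b a] \<epsilon> unfolding continuous_at_eps_delta dist_real_def by blast
  obtain d3 where d3: "d3 > 0" "\<And>y. dist y x < d3 \<Longrightarrow> y \<in> W" using W x open_dist by metis
  define d where "d = min d1 (min d2 d3)"
  define h where "h = (d / 2) / (norm a + norm b + 1)"
  have d: "d > 0" using d1 d2 d3 by (simp add: d_def)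
  have np: "norm a + norm b + 1 > 0" by (simp add: add_nonneg_pos)
  have h: "h > 0" using d np by (simp add: h_def)
  have near: "dist (x + s *\<^sub>R a + t *\<^sub>R b) x < d" if "0 \<le> s" "s \<le> h" "0 \<le> t" "t \<le> h" for s t
  proof -
    have "dist (x + s *\<^sub>R a + t *\<^sub>R b) x = norm (s *\<^sub>R a + t *\<^sub>R b)" by (simp add: dist_norm add.assoc)
    also have "\<dots> \<le> s * norm a + t * norm b" using norm_triangle_ineq[of "s *\<^sub>R a" "t *\<^sub>R b"] that by simp
    also have "\<dots> \<le> h * norm a + h * norm b" using that by (intro add_mono mult_right_mono) auto
    also have "\<dots> \<le> h * (norm a + norm b + 1)" using h by (simp add: algebra_simps)
    also have "\<dots> = d / 2" unfolding h_def using np by (subst nonzero_eq_divide_eq[symmetric]) auto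
    finally show ?thesis using d by linarith
  qed
  have W1: "x + s *\<^sub>R a + t *\<^sub>R b \<in> W" if "0 \<le> s" "s \<le> h" "0 \<le> t" "t \<le> h" for s t
    using near[OF that] d3 by (simp add: d_def)
  have W2: "x + s *\<^sub>R b + t *\<^sub>R a \<in> W" if "0 \<le> s" "s \<le> h" "0 \<le> t" "t \<le> h" for s t
    using W1[OF that(3,4,1,2)] by (simp add: algebra_simps)
  obtain s t where st: "0 \<le> s" "s \<le> h" "0 \<le> t" "t \<le> h"
   "f (x + h *\<^sub>R a + h *\<^sub>R b) - f (x + h *\<^sub>R a) - f (x + h *\<^sub>R b) + f x = h * (h * ?D a b (x + s *\<^sub>R a + t *\<^sub>R b))"
    using mixed_difference_quotient[OF f h W1] by blast
  obtain s' t' where st': "0 \<le> s'" "s' \<le> h" "0 \<le> t'" "t' \<le> h"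
   "f (x + h *\<^sub>R b + h *\<^sub>R a) - f (x + h *\<^sub>R b) - f (x + h *\<^sub>R a) + f x = h * (h * ?D b a (x + s' *\<^sub>R b + t' *\<^sub>R a))"
    using mixed_difference_quotient[OF f h W2] by blast
  have sw: "x + s' *\<^sub>R b + t' *\<^sub>R a = x + t' *\<^sub>R a + s' *\<^sub>R b" by (simp add: algebra_simps)
  have "h * (h * ?D a b (x + s *\<^sub>R a + t *\<^sub>R b)) = h * (h * ?D b a (x + t' *\<^sub>R a + s' *\<^sub>R b))"
    using st(5) st'(5) unfolding sw by (simp add: algebra_simps)
  then have "?D a b (x + s *\<^sub>R a + t *\<^sub>R b) = ?D b a (x + t' *\<^sub>R a + s' *\<^sub>R b)" using h by simp
  moreover have "\<bar>?D a b (x + s *\<^sub>R a + t *\<^sub>R b) - ?D a b x\<bar> < \<epsilon>"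
    using near[OF st(1-4)] by (intro d1) (simp add: d_def)
  moreover have "\<bar>?D b a (x + t' *\<^sub>R a + s' *\<^sub>R b) - ?D b a x\<bar> < \<epsilon>"
    using near[OF st'(3,4,1,2)] by (intro d2) (simp add: d_def)
  ultimately show False unfolding \<epsilon>_def by (simp add: abs_if split: if_splits)
qed

text \<open>
  If the second derivative along \<open>v\<close> were negative, the first one, which vanishes at \<open>x\<close>, would be
  negative just after \<open>x\<close> and the function would decrease there.
\<close>

lemma local_minimum_derivatives:
  fixes g :: "'a::euclidean_space \<Rightarrow> real"
  assumes g: "smooth_open W g" and x: "x \<in> W" and D: "open D" "x \<in> D" "\<And>y. y \<in> D \<Longrightarrow> y \<in> W \<Longrightarrow> g x \<le> g y"
  shows "frechet_derivative g (at x) v = 0"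
    and "frechet_derivative (\<lambda>y. frechet_derivative g (at y) v) (at x) v \<ge> 0"
proof -
  have W: "open W" using g smooth_open_open by blast
  have "frechet_derivative g (at x) = (\<lambda>v. 0)"
    by (rule differential_zero_maxmin[of x "D \<inter> W", OF _ _ smooth_open_deriv[OF g x]]) (use D W x in auto)
  then show 1: "frechet_derivative g (at x) v = 0" by simp
  show "frechet_derivative (\<lambda>y. frechet_derivative g (at y) v) (at x) v \<ge> 0"
  proof (rule ccontr)
    assume "\<not> ?thesis"
    then have neg: "frechet_derivative (\<lambda>y. frechet_derivative g (at y) v) (at x) v < 0" by simp
    let ?p = "\<lambda>t. frechet_derivative g (at (x + t *\<^sub>R v)) v"
    have "(?p has_real_derivative frechet_derivative (\<lambda>y. frechet_derivative g (at y) v) (at x) v) (at 0)"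
      using smooth_open_line_derivative[OF smooth_open_directional[OF g], of x 0 v v] x by simp
    from DERIV_neg_dec_right[OF this neg] obtain d where d: "d > 0" "\<And>h. 0 < h \<Longrightarrow> h < d \<Longrightarrow> ?p h < 0"
      using 1 by auto
    have "((\<lambda>t. x + t *\<^sub>R v) \<longlongrightarrow> x + 0 *\<^sub>R v) (at 0)" by (intro tendsto_intros)
    then have "eventually (\<lambda>t. x + t *\<^sub>R v \<in> D \<inter> W) (at 0)"
      using D(1,2) W x by (intro topological_tendstoD) auto
    then obtain r where r: "r > 0" "\<And>t. t \<noteq> 0 \<Longrightarrow> \<bar>t\<bar> < r \<Longrightarrow> x + t *\<^sub>R v \<in> D \<inter> W"
      by (auto simp: eventually_at)
    define h where "h = min d r / 2"
    have h: "0 < h" "h < d" "h < r" using d r by (auto simp: h_def)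
    have in_W: "x + t *\<^sub>R v \<in> W" if "0 \<le> t" "t \<le> h" for t
      using r(2)[of t] that h x by (cases "t = 0") auto
    have "\<exists>z>0. z < h \<and> g (x + h *\<^sub>R v) - g (x + 0 *\<^sub>R v) = (h - 0) * ?p z"
      using in_W h by (intro MVT2 smooth_open_line_derivative[OF g]) auto
    then obtain z where z: "0 < z" "z < h" "g (x + h *\<^sub>R v) - g x = h * ?p z" by auto
    have "h * ?p z < 0" using d(2)[of z] z h by (simp add: mult_pos_neg)
    moreover have "g x \<le> g (x + h *\<^sub>R v)" using r(2)[of h] h by (intro D(3)) auto
    ultimately show False using z(3) by linarith
  qed
qed

section \<open>Orthonormal families, reflections and coordinate subspaces\<close>

lemma orthonormal_family_expand:
  fixes f :: "'i \<Rightarrow> 'a::euclidean_space"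
  assumes "finite I" "card I = DIM('a)" "\<And>i j. i \<in> I \<Longrightarrow> j \<in> I \<Longrightarrow> f i \<bullet> f j = (if i = j then 1 else 0)"
  shows "(\<Sum>i\<in>I. (x \<bullet> f i) *\<^sub>R f i) = x"
proof -
  have inj: "inj_on f I"
    by (rule inj_onI) (metis assms(3) zero_neq_one)
  have po: "pairwise orthogonal (f ` I)"
    using assms(3) by (auto simp: pairwise_def orthogonal_def)
  have nz: "norm y = 1" if "y \<in> f ` I" for y
    using that assms(3) by (auto simp: norm_eq_1)
  then have "0 \<notin> f ` I" by fastforce
  with po have ind: "independent (f ` I)" by (rule pairwise_orthogonal_independent)
  have "card (f ` I) = dim (UNIV :: 'a set)" using card_image[OF inj] assms(2) by simp
  then have "span (f ` I) = UNIV"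
    using ind card_ge_dim_independent[of "f ` I" UNIV] by auto
  then have "(\<Sum>y\<in>f ` I. (x \<bullet> y) *\<^sub>R y) = x"
    using orthonormal_basis_expand[OF po nz] assms(1) by auto
  then show ?thesis by (simp add: sum.reindex[OF inj])
qed

text \<open>
  A mean curvature is a trace over a tangent frame, a divergence is a trace over the standard
  basis. This lemma makes them comparable.
\<close>

lemma trace_orthonormal:
  fixes f :: "'i \<Rightarrow> 'a::euclidean_space"
  assumes "finite I" "card I = DIM('a)" "\<And>i j. i \<in> I \<Longrightarrow> j \<in> I \<Longrightarrow> f i \<bullet> f j = (if i = j then 1 else 0)"
    and L: "linear L"
  shows "(\<Sum>i\<in>I. f i \<bullet> L (f i)) = (\<Sum>b\<in>Basis. b \<bullet> L b)"
proof -
  have "(\<Sum>b\<in>Basis. b \<bullet> L b) = (\<Sum>b\<in>Basis. \<Sum>i\<in>I. (b \<bullet> f i) * (b \<bullet> L (f i)))"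
  proof (rule sum.cong[OF refl])
    fix b :: 'a
    have "L b = L (\<Sum>i\<in>I. (b \<bullet> f i) *\<^sub>R f i)" using orthonormal_family_expand[OF assms(1-3)] by simp
    then show "b \<bullet> L b = (\<Sum>i\<in>I. (b \<bullet> f i) * (b \<bullet> L (f i)))"
      using L by (simp add: linear_sum linear_scale inner_sum_right)
  qed
  also have "\<dots> = (\<Sum>i\<in>I. \<Sum>b\<in>Basis. (f i \<bullet> b) * (L (f i) \<bullet> b))"
    by (subst sum.swap) (simp add: inner_commute)
  also have "\<dots> = (\<Sum>i\<in>I. f i \<bullet> L (f i))" by (simp add: euclidean_inner[symmetric])
  finally show ?thesis by simp
qed

text \<open>
  The reflection at the hyperplane orthogonal to \<open>w\<close>. For \<open>w = 0\<close> division by zero makes it the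
  identity, so that \<open>reflection (a - b)\<close> exchanges two unit vectors \<open>a\<close> and \<open>b\<close> even if they agree.
\<close>

definition reflection :: "'a::real_inner \<Rightarrow> 'a \<Rightarrow> 'a" where
  "reflection w x = x - (2 * (x \<bullet> w) / (w \<bullet> w)) *\<^sub>R w"

lemma bounded_linear_reflection: "bounded_linear (reflection w)"
proof -
  have "bounded_linear (\<lambda>x. x - (2 / (w \<bullet> w)) *\<^sub>R ((x \<bullet> w) *\<^sub>R w))"
    by (intro bounded_linear_sub bounded_linear_ident bounded_linear_compose[OF bounded_linear_scaleR_right]
        bounded_linear_compose[OF bounded_linear_scaleR_left bounded_linear_inner_left])
  then show ?thesis by (simp add: reflection_def[abs_def])
qed

lemma reflection_inner: "reflection w x \<bullet> reflection w y = x \<bullet> y"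
  by (cases "w = 0") (simp_all add: reflection_def inner_diff_left inner_diff_right inner_commute)

lemma reflection_involution: "reflection w (reflection w x) = x"
  by (cases "w = 0") (simp_all add: reflection_def inner_diff_left)

lemma reflection_swap:
  assumes "norm a = norm b" shows "reflection (a - b) b = a"
proof (cases "a = b")
  case False
  have "a \<bullet> a = b \<bullet> b" using assms by (simp add: norm_eq)
  then have "(a - b) \<bullet> (a - b) = - 2 * (b \<bullet> (a - b))" by (simp add: inner_diff_left inner_diff_right inner_commute)
  moreover have "(a - b) \<bullet> (a - b) \<noteq> 0" using False by simp
  ultimately have "2 * (b \<bullet> (a - b)) / ((a - b) \<bullet> (a - b)) = -1" by (simp add: field_simps)
  then show ?thesis by (simp add: reflection_def)
qed (simp add: reflection_def)

lemma smooth_open_reflection: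
  assumes "smooth_open V w" "\<And>z. z \<in> V \<Longrightarrow> w z \<noteq> 0"
  shows "smooth_open V (\<lambda>z. reflection (w z) x)"
proof -
  have o: "open V" using assms(1) smooth_open_open by blast
  have "smooth_open V (\<lambda>z. x - ((2 * (x \<bullet> w z)) * (1 / (w z \<bullet> w z))) *\<^sub>R w z)"
    by (intro smooth_open_diff smooth_open_const smooth_open_scaleR smooth_open_mult smooth_open_inverse
        smooth_open_inner o assms(1)) (use assms(2) in auto)
  then show ?thesis by (simp add: reflection_def)
qed

definition coord_proj :: "(nat \<Rightarrow> 'a::euclidean_space) \<Rightarrow> nat set \<Rightarrow> 'a \<Rightarrow> 'a" where
  "coord_proj e I x = (\<Sum>i\<in>I. (x \<bullet> e i) *\<^sub>R e i)"

lemma bounded_linear_coord_proj: "bounded_linear (coord_proj e I)"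
  unfolding coord_proj_def
  by (intro bounded_linear_sum bounded_linear_compose[OF bounded_linear_scaleR_left bounded_linear_inner_left])

lemmas linear_coord_proj = bounded_linear.linear[OF bounded_linear_coord_proj]

locale coordinates =
  fixes e :: "nat \<Rightarrow> 'a::euclidean_space" and D :: nat
  assumes e_basis: "bij_betw e {1..D} Basis"
begin

lemma e_in_Basis: "i \<in> {1..D} \<Longrightarrow> e i \<in> Basis"
  using e_basis bij_betwE by blast

lemma e_inner: "i \<in> {1..D} \<Longrightarrow> j \<in> {1..D} \<Longrightarrow> e i \<bullet> e j = (if i = j then 1 else 0)"
  using e_basis e_in_Basis by (auto simp: inner_Basis bij_betw_def dest: inj_onD)

lemma D_eq: "D = DIM('a)"
  using bij_betw_same_card[OF e_basis] by simp

lemma eq_by_coords: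
  assumes "\<And>i. i \<in> {1..D} \<Longrightarrow> x \<bullet> e i = y \<bullet> e i" shows "x = y"
proof (rule euclidean_eqI)
  fix b :: 'a assume "b \<in> Basis"
  then obtain i where "i \<in> {1..D}" "b = e i" using e_basis by (metis bij_betw_def imageE)
  then show "x \<bullet> b = y \<bullet> b" using assms by simp
qed

lemma coord_proj_inner:
  assumes "I \<subseteq> {1..D}" "j \<in> {1..D}" shows "coord_proj e I x \<bullet> e j = (if j \<in> I then x \<bullet> e j else 0)"
proof -
  have fin: "finite I" using assms(1) finite_subset by blast
  have "coord_proj e I x \<bullet> e j = (\<Sum>i\<in>I. if i = j then x \<bullet> e i else 0)"
    unfolding coord_proj_def inner_sum_left
    by (rule sum.cong[OF refl]) (use e_inner assms in \<open>auto simp: subset_iff\<close>)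
  then show ?thesis using fin by simp
qed

lemma coord_proj_in_span: "coord_proj e I x \<in> span (e ` I)"
  unfolding coord_proj_def by (intro span_sum span_scale span_base imageI)

lemma in_span_iff:
  assumes "I \<subseteq> {1..D}" shows "x \<in> span (e ` I) \<longleftrightarrow> (\<forall>j\<in>{1..D} - I. x \<bullet> e j = 0)"
proof
  assume x: "x \<in> span (e ` I)"
  show "\<forall>j\<in>{1..D} - I. x \<bullet> e j = 0"
  proof
    fix j assume j: "j \<in> {1..D} - I"
    have "subspace {y. y \<bullet> e j = 0}" by (auto simp: subspace_def inner_left_distrib)
    moreover have "e ` I \<subseteq> {y. y \<bullet> e j = 0}" using e_inner assms j by (auto simp: subset_iff)
    ultimately have "span (e ` I) \<subseteq> {y. y \<bullet> e j = 0}" by (rule span_minimal[rotated])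
    with x show "x \<bullet> e j = 0" by auto
  qed
next
  assume "\<forall>j\<in>{1..D} - I. x \<bullet> e j = 0"
  then have "coord_proj e I x = x" using coord_proj_inner[OF assms] by (intro eq_by_coords) auto
  then show "x \<in> span (e ` I)" using coord_proj_in_span by metis
qed

lemma coord_proj_id_iff:
  assumes "I \<subseteq> {1..D}" shows "coord_proj e I x = x \<longleftrightarrow> x \<in> span (e ` I)"
  using coord_proj_in_span[of I x] in_span_iff[OF assms, of x] coord_proj_inner[OF assms]
  by (metis DiffI eq_by_coords)

lemma coord_proj_zero_iff:
  assumes "I \<subseteq> {1..D}" shows "coord_proj e I x = 0 \<longleftrightarrow> (\<forall>i\<in>I. x \<bullet> e i = 0)"
proof
  assume "coord_proj e I x = 0"
  then show "\<forall>i\<in>I. x \<bullet> e i = 0" using coord_proj_inner[OF assms, of _ x] assms by (metis inner_zero_left subset_iff)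
qed (simp add: coord_proj_def)

lemma coord_proj_split:
  assumes "finite I" "finite J" "I \<inter> J = {}" shows "coord_proj e (I \<union> J) x = coord_proj e I x + coord_proj e J x"
  unfolding coord_proj_def using assms by (rule sum.union_disjoint)

lemma coord_proj_all: "coord_proj e {1..D} x = x"
  by (rule eq_by_coords) (simp add: coord_proj_inner)

lemma coord_proj_adjoint: "coord_proj e I x \<bullet> y = x \<bullet> coord_proj e I y"
  by (simp add: coord_proj_def inner_sum_left inner_sum_right mult.commute inner_commute)

lemma coord_proj_orthogonal:
  assumes "I \<subseteq> {1..D}" "x \<in> span (e ` I)" "J \<subseteq> {1..D}" "I \<inter> J = {}" shows "coord_proj e J x = 0"
  using assms in_span_iff[OF assms(1)] by (subst coord_proj_zero_iff) auto

end

section \<open>Charts of an immersed hypersurface\<close>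

lemma homeomorphic_chart_inverse:
  assumes "openin Y U" "homeomorphic_map (subtopology Y U) (top_of_set (\<phi> ` U)) \<phi>"
  shows "inj_on \<phi> U" "continuous_map (top_of_set (\<phi> ` U)) Y (inv_into U \<phi>)"
proof -
  have U: "U \<subseteq> topspace Y" using assms(1) openin_subset by blast
  then have ts: "topspace (subtopology Y U) = U" by auto
  show inj: "inj_on \<phi> U" using homeomorphic_imp_injective_map[OF assms(2)] ts by simp
  obtain g where "homeomorphic_maps (subtopology Y U) (top_of_set (\<phi> ` U)) \<phi> g"
    using assms(2) homeomorphic_map_maps by blast
  then have g: "continuous_map (top_of_set (\<phi> ` U)) (subtopology Y U) g" "\<And>q. q \<in> U \<Longrightarrow> g (\<phi> q) = q"
    using ts unfolding homeomorphic_maps_def by auto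
  have "continuous_map (top_of_set (\<phi> ` U)) Y g" using g(1) continuous_map_into_fulltopology by blast
  then show "continuous_map (top_of_set (\<phi> ` U)) Y (inv_into U \<phi>)"
    by (rule continuous_map_eq) (use g(2) inj in \<open>auto simp: inv_into_f_f\<close>)
qed

text \<open>
  The ambient space of the hypersurface is the span \<open>E1\<close> of the first \<open>d + 1\<close> of the \<open>D\<close> standard
  basis vectors, and \<open>pQ\<close> projects to the remaining directions. The case \<open>D > d + 1\<close> occurs for the
  cross section of a cylinder, which lies in a proper coordinate subspace.
\<close>

locale immersed_hypersurface = coordinates e D
  for e :: "nat \<Rightarrow> 'a::euclidean_space" and D +
  fixes d :: nat and M :: "'m topology" and A :: "('m, 'a) chart set" and X N :: "'m \<Rightarrow> 'a"
  assumes hyp: "hypersurface e d M A X N" and dD: "d + 1 \<le> D"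
begin

abbreviation E where "E \<equiv> coord_space e d"

abbreviation E1 where "E1 \<equiv> coord_space e (d + 1)"

abbreviation pE where "pE \<equiv> coord_proj e {1..d}"

abbreviation pE1 where "pE1 \<equiv> coord_proj e {1..d + 1}"

abbreviation pQ where "pQ \<equiv> coord_proj e {d + 2..D}"

lemma coord_subsets: "{1..d} \<subseteq> {1..D}" "{1..d + 1} \<subseteq> {1..D}" "{d + 2..D} \<subseteq> {1..D}"
  using dD by auto

lemma pE_in: "pE x \<in> E" unfolding coord_space_def by (rule coord_proj_in_span)

lemma pE_id: "x \<in> E \<Longrightarrow> pE x = x" unfolding coord_space_def by (rule coord_proj_id_iff[OF coord_subsets(1), THEN iffD2])

lemma pE1_id: "x \<in> E1 \<Longrightarrow> pE1 x = x" unfolding coord_space_def by (rule coord_proj_id_iff[OF coord_subsets(2), THEN iffD2])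

lemma pQ_E1: "x \<in> E1 \<Longrightarrow> pQ x = 0"
  unfolding coord_space_def by (rule coord_proj_orthogonal[OF coord_subsets(2) _ coord_subsets(3)]) auto

lemma split_E1_Q: "x = pE1 x + pQ x"
proof -
  have "{1..d+1} \<union> {d+2..D} = {1..D}" using dD by auto
  then show ?thesis using coord_proj_split[of "{1..d+1}" "{d+2..D}" x] coord_proj_all[of x] by auto
qed

lemma split_E_E1: "pE1 x = pE x + (x \<bullet> e (d+1)) *\<^sub>R e (d+1)"
  using coord_proj_split[of "{1..d}" "{d+1}" x] by (simp add: coord_proj_def atLeastAtMostSuc_conv add.commute)

lemma manifold:
  shows "smooth_manifold E M A" "connected_space M" "topspace M \<noteq> {}" "smooth_fun A X" "smooth_fun A N"
  using hyp unfolding hypersurface_def by auto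

lemma X_in: "q \<in> topspace M \<Longrightarrow> X q \<in> E1" and N_in: "q \<in> topspace M \<Longrightarrow> N q \<in> E1"
  and N_norm: "q \<in> topspace M \<Longrightarrow> norm (N q) = 1"
  and N_unit: "q \<in> topspace M \<Longrightarrow> N q \<bullet> N q = 1"
  using hyp unfolding hypersurface_def by (auto simp: norm_eq_1)

lemma immersion: "c \<in> A \<Longrightarrow> q \<in> fst c \<Longrightarrow> v \<in> E \<Longrightarrow> differential X c q v = 0 \<Longrightarrow> v = 0"
  and normal: "c \<in> A \<Longrightarrow> q \<in> fst c \<Longrightarrow> v \<in> E \<Longrightarrow> N q \<bullet> differential X c q v = 0"
  using hyp unfolding hypersurface_def by auto

lemma chart_exists: "q \<in> topspace M \<Longrightarrow> \<exists>U \<phi>. (U, \<phi>) \<in> A \<and> q \<in> U"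
proof -
  assume "q \<in> topspace M"
  moreover have "(\<Union>(U, \<phi>)\<in>A. U) = topspace M" using manifold(1) by (simp add: smooth_manifold_def)
  ultimately have "q \<in> (\<Union>(U, \<phi>)\<in>A. U)" by simp
  then show "\<exists>U \<phi>. (U, \<phi>) \<in> A \<and> q \<in> U" by auto
qed

lemma Hausdorff: "Hausdorff_space M"
  using manifold(1) unfolding smooth_manifold_def by auto

lemma chart:
  assumes "(U, \<phi>) \<in> A"
  shows "openin M U" "U \<subseteq> topspace M" "inj_on \<phi> U" "openin (top_of_set E) (\<phi> ` U)" "\<phi> ` U \<subseteq> E"
    "continuous_map (subtopology M U) euclidean \<phi>" "continuous_map (top_of_set (\<phi> ` U)) M (inv_into U \<phi>)"
proof -
  have *: "openin M U" "openin (top_of_set E) (\<phi> ` U)" "homeomorphic_map (subtopology M U) (top_of_set (\<phi> ` U)) \<phi>"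
    using manifold(1) assms unfolding smooth_manifold_def by auto
  show "openin M U" "openin (top_of_set E) (\<phi> ` U)" by fact+
  show "U \<subseteq> topspace M" using * openin_subset by blast
  show "inj_on \<phi> U" "continuous_map (top_of_set (\<phi> ` U)) M (inv_into U \<phi>)"
    by (rule homeomorphic_chart_inverse[OF *(1,3)])+
  show "\<phi> ` U \<subseteq> E" using *(2) openin_imp_subset by blast
  show "continuous_map (subtopology M U) euclidean \<phi>"
    using homeomorphic_imp_continuous_map[OF *(3)] continuous_map_into_fulltopology by blast
qed

text \<open>
  The smooth extension furnished by the definition is composed with the projection to the model
  space. It thus becomes constant in the directions orthogonal to the model space.
\<close>

lemma chart_extension:
  fixes f :: "'m \<Rightarrow> 'b::real_normed_vector"
  assumes c: "(U, \<phi>) \<in> A" and y: "y \<in> \<phi> ` U" and f: "smooth_fun A f"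
  obtains T F where "smooth_open T F" "y \<in> T" "\<And>w. w \<in> T \<Longrightarrow> pE w \<in> \<phi> ` U"
    "\<And>w. w \<in> T \<Longrightarrow> F w = f (inv_into U \<phi> (pE w))"
proof -
  have "smooth_on (\<phi> ` U) (f \<circ> inv_into U \<phi>)" using f c unfolding smooth_fun_def by auto
  then obtain W F where WF: "y \<in> W" "smooth_open W F" "\<forall>w\<in>\<phi> ` U \<inter> W. F w = f (inv_into U \<phi> w)"
    unfolding smooth_on_iff_smooth_open using y by fastforce
  obtain O' where O': "open O'" "\<phi> ` U = E \<inter> O'" using chart(4)[OF c] openin_open by metis
  define T where "T = pE -` (W \<inter> O')"
  have "open T" unfolding T_def
    using smooth_open_open[OF WF(2)] O' bounded_linear.linear[OF bounded_linear_coord_proj[of e "{1..d}"]]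
    by (intro continuous_open_vimage linear_continuous_on[OF bounded_linear_coord_proj] continuous_at_imp_continuous_on ballI)
       (auto intro: linear_continuous_at[OF bounded_linear_coord_proj])
  have yE: "y \<in> E" using y chart(5)[OF c] by blast
  have pp: "pE w \<in> \<phi> ` U" "pE w \<in> W" if "w \<in> T" for w using that O' pE_in unfolding T_def by auto
  have "smooth_open T pE" using smooth_open_linear[OF bounded_linear_coord_proj smooth_open_id[OF \<open>open T\<close>]] by simp
  then have "smooth_open T (\<lambda>w. F (pE w))" using smooth_open_compose[OF _ WF(2)] pp(2) by blast
  moreover have "y \<in> T" using pE_id[OF yE] WF(1) y O' by (simp add: T_def)
  moreover have "F (pE w) = f (inv_into U \<phi> (pE w))" if "w \<in> T" for w using WF(3) pp[OF that] by auto
  ultimately show ?thesis using that pp by blast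
qed

lemma differential_eq:
  assumes c: "(U, \<phi>) \<in> A" and q: "q \<in> U" and T: "smooth_open T F" "\<phi> q \<in> T"
    "\<And>w. w \<in> T \<Longrightarrow> w \<in> E \<Longrightarrow> F w = f (inv_into U \<phi> w)" and v: "v \<in> E"
  shows "differential f (U, \<phi>) q v = frechet_derivative F (at (\<phi> q)) v"
  unfolding differential_def fst_conv snd_conv
proof (rule dir_deriv_eqI(2)[OF smooth_open_deriv[OF T(1,2)]])
  have "\<phi> q \<in> E" using chart(5)[OF c] q by auto
  then have "\<phi> q + t *\<^sub>R v \<in> E" for t using v unfolding coord_space_def by (intro span_add span_scale)
  then show "eventually (\<lambda>t. (f \<circ> inv_into U \<phi>) (\<phi> q + t *\<^sub>R v) = F (\<phi> q + t *\<^sub>R v)) (nhds 0)"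
    using eventually_line_in_open[OF smooth_open_open[OF T(1)] T(2), of v] T(3)
    by (auto elim: eventually_mono)
qed

text \<open>
  Functions on the hypersurface are smooth through local extensions only. Here these extensions
  are glued, once and for all, along a map into a chart domain.
\<close>

lemma compose_with_inverse_chart:
  fixes f :: "'m \<Rightarrow> 'b::real_normed_vector" and \<theta> :: "'c::euclidean_space \<Rightarrow> 'a"
  assumes c: "(U, \<phi>) \<in> A" and \<theta>: "smooth_open V \<theta>" "\<And>z. z \<in> V \<Longrightarrow> \<theta> z \<in> \<phi> ` U" and f: "smooth_fun A f"
  shows "smooth_open V (\<lambda>z. f (inv_into U \<phi> (\<theta> z)))"
    and "z \<in> V \<Longrightarrow> frechet_derivative \<theta> (at z) v \<in> E"
    and "z \<in> V \<Longrightarrow> frechet_derivative (\<lambda>z. f (inv_into U \<phi> (\<theta> z))) (at z) v =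
      differential f (U, \<phi>) (inv_into U \<phi> (\<theta> z)) (frechet_derivative \<theta> (at z) v)"
proof -
  have V: "open V" using \<theta>(1) smooth_open_open by blast
  have cE: "\<phi> ` U \<subseteq> E" using chart(5)[OF c] .
  have DE: "frechet_derivative \<theta> (at z) v \<in> E" if z: "z \<in> V" for z v
  proof -
    have "((\<lambda>z. pE (\<theta> z)) has_derivative (\<lambda>h. pE (frechet_derivative \<theta> (at z) h))) (at z)"
      by (rule bounded_linear.has_derivative[OF bounded_linear_coord_proj smooth_open_deriv[OF \<theta>(1) z]])
    then have "(\<theta> has_derivative (\<lambda>h. pE (frechet_derivative \<theta> (at z) h))) (at z)"
      by (rule has_derivative_transform_within_open[OF _ V z]) (use pE_id \<theta>(2) cE in blast)
    then have "frechet_derivative \<theta> (at z) v = pE (frechet_derivative \<theta> (at z) v)"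
      using frechet_derivative_at by metis
    then show ?thesis using pE_in by metis
  qed
  then show "z \<in> V \<Longrightarrow> frechet_derivative \<theta> (at z) v \<in> E" .
  have loc: "\<exists>V'. z \<in> V' \<and> V' \<subseteq> V \<and> smooth_open V' (\<lambda>z. f (inv_into U \<phi> (\<theta> z))) \<and>
     frechet_derivative (\<lambda>z. f (inv_into U \<phi> (\<theta> z))) (at z) v =
      differential f (U, \<phi>) (inv_into U \<phi> (\<theta> z)) (frechet_derivative \<theta> (at z) v)" if z: "z \<in> V" for z v
  proof -
    obtain T F where TF: "smooth_open T F" "\<theta> z \<in> T" "\<And>w. w \<in> T \<Longrightarrow> pE w \<in> \<phi> ` U"
      "\<And>w. w \<in> T \<Longrightarrow> F w = f (inv_into U \<phi> (pE w))"
      using chart_extension[OF c \<theta>(2)[OF z] f] by metis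
    define V' where "V' = V \<inter> \<theta> -` T"
    have V': "open V'" "z \<in> V'" "V' \<subseteq> V" unfolding V'_def
      using continuous_open_preimage[OF smooth_open_continuous[OF \<theta>(1)] V smooth_open_open[OF TF(1)]] z TF(2) by auto
    have agree: "F (\<theta> x) = f (inv_into U \<phi> (\<theta> x))" if "x \<in> V'" for x
      using that TF(4)[of "\<theta> x"] pE_id[of "\<theta> x"] \<theta>(2)[of x] cE unfolding V'_def by auto
    have "smooth_open V' (\<lambda>x. F (\<theta> x))"
      by (rule smooth_open_compose[OF smooth_open_subset[OF \<theta>(1) V'(1,3)] TF(1)]) (simp add: V'_def)
    then have s: "smooth_open V' (\<lambda>z. f (inv_into U \<phi> (\<theta> z)))" by (rule smooth_open_cong) (rule agree)
    have "((\<lambda>x. F (\<theta> x)) has_derivative (\<lambda>h. frechet_derivative F (at (\<theta> z)) (frechet_derivative \<theta> (at z) h))) (at z)"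
      by (rule has_derivative_compose[OF smooth_open_deriv[OF \<theta>(1) z] smooth_open_deriv[OF TF(1,2)]])
    then have "((\<lambda>z. f (inv_into U \<phi> (\<theta> z))) has_derivative (\<lambda>h. frechet_derivative F (at (\<theta> z)) (frechet_derivative \<theta> (at z) h))) (at z)"
      by (rule has_derivative_transform_within_open[OF _ V'(1,2)]) (rule agree)
    then have "frechet_derivative (\<lambda>z. f (inv_into U \<phi> (\<theta> z))) (at z) v = frechet_derivative F (at (\<theta> z)) (frechet_derivative \<theta> (at z) v)"
      using frechet_derivative_at by metis
    also have "\<dots> = differential f (U, \<phi>) (inv_into U \<phi> (\<theta> z)) (frechet_derivative \<theta> (at z) v)"
    proof -
      have eq: "\<phi> (inv_into U \<phi> (\<theta> z)) = \<theta> z" using \<theta>(2)[OF z] f_inv_into_f by metis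
      have "differential f (U, \<phi>) (inv_into U \<phi> (\<theta> z)) (frechet_derivative \<theta> (at z) v) =
         frechet_derivative F (at (\<phi> (inv_into U \<phi> (\<theta> z)))) (frechet_derivative \<theta> (at z) v)"
        by (rule differential_eq[OF c _ TF(1) _ _ DE[OF z]])
           (use eq TF pE_id \<theta>(2)[OF z] inv_into_into[of "\<theta> z" \<phi> U] in auto)
      then show ?thesis using eq by simp
    qed
    finally show ?thesis using V' s by blast
  qed
  show "smooth_open V (\<lambda>z. f (inv_into U \<phi> (\<theta> z)))"
    by (rule smooth_open_local) (use loc in blast)
  show "z \<in> V \<Longrightarrow> frechet_derivative (\<lambda>z. f (inv_into U \<phi> (\<theta> z))) (at z) v =
      differential f (U, \<phi>) (inv_into U \<phi> (\<theta> z)) (frechet_derivative \<theta> (at z) v)"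
    using loc by blast
qed

end

\<comment> \<open>keeps index sets such as \<open>{1..d}\<close> in the form in which the projections are stated\<close>
declare One_nat_def [simp del]

context immersed_hypersurface
begin

lemma Suc_d_in: "d + 1 \<in> {1..D}" using dD by auto

lemma pE1_zero:
  assumes "pE1 k = 0" shows "pE k = 0" "k \<bullet> e (d + 1) = 0" "pQ k = k"
proof -
  have *: "\<forall>i\<in>{1..d+1}. k \<bullet> e i = 0" using assms coord_proj_zero_iff[OF coord_subsets(2)] by simp
  then show "pE k = 0" by (subst coord_proj_zero_iff[OF coord_subsets(1)]) auto
  show "k \<bullet> e (d + 1) = 0" using * by simp
  show "pQ k = k" using split_E1_Q[of k] assms by simp
qed

lemma pE1_e: "pE1 (e j) = 0" if "j \<in> {d+2..D}"
  using that e_inner by (subst coord_proj_zero_iff[OF coord_subsets(2)]) auto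

lemma pE_e_Suc: "pE (e (d + 1)) = 0" "pQ (e (d + 1)) = 0"
  using dD by (subst coord_proj_zero_iff[OF coord_subsets(1)] coord_proj_zero_iff[OF coord_subsets(3)]; auto simp: e_inner)+

lemma pQ_idem: "pQ (pQ x) = pQ x"
  using coord_proj_id_iff[OF coord_subsets(3)] coord_proj_in_span by blast

lemma E1_iff_pQ: "x \<in> E1 \<longleftrightarrow> pQ x = 0"
proof
  assume "pQ x = 0"
  then have "pE1 x = x" using split_E1_Q[of x] by simp
  then show "x \<in> E1" unfolding coord_space_def using coord_proj_in_span by metis
qed (rule pQ_E1)

lemma E1_orth: "x \<in> E1 \<Longrightarrow> pE1 k = 0 \<Longrightarrow> x \<bullet> k = 0"
  using pE1_id[of x] coord_proj_adjoint[of "{1..d+1}" x k] by simp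

lemma E_subset_E1: "E \<subseteq> E1"
  unfolding coord_space_def by (intro span_mono image_mono) auto

lemma smooth_fun_continuous:
  fixes f :: "'m \<Rightarrow> 'b::real_normed_vector"
  assumes f: "smooth_fun A f" shows "continuous_map M euclidean f"
  unfolding continuous_map_def
proof (intro conjI allI impI)
  fix S :: "'b set" assume "openin euclidean S"
  then have S: "open S" by simp
  show "openin M {q \<in> topspace M. f q \<in> S}"
  proof (subst openin_subopen, rule ballI)
    fix q assume "q \<in> {q \<in> topspace M. f q \<in> S}"
    then have q: "q \<in> topspace M" "f q \<in> S" by auto
    obtain U \<phi> where c: "(U, \<phi>) \<in> A" and qU: "q \<in> U" using chart_exists[OF q(1)] by blast
    obtain T F where TF: "smooth_open T F" "\<phi> q \<in> T" "\<And>w. w \<in> T \<Longrightarrow> F w = f (inv_into U \<phi> (pE w))"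
      using chart_extension[OF c imageI[OF qU] f] by metis
    have agree: "F (\<phi> q') = f q'" if "q' \<in> U" "\<phi> q' \<in> T" for q'
    proof -
      have "\<phi> q' \<in> E" using chart(5)[OF c] that(1) by blast
      then show ?thesis using TF(3)[OF that(2)] pE_id that(1) chart(3)[OF c] by (simp add: inv_into_f_f)
    qed
    define O' where "O' = {q' \<in> U. \<phi> q' \<in> T \<inter> F -` S}"
    have "open (T \<inter> F -` S)"
      using continuous_open_preimage[OF smooth_open_continuous[OF TF(1)] smooth_open_open[OF TF(1)] S] .
    then have "openin (subtopology M U) {x \<in> topspace (subtopology M U). \<phi> x \<in> T \<inter> F -` S}"
      using chart(6)[OF c] by (intro openin_continuous_map_preimage) auto
    moreover have "{x \<in> topspace (subtopology M U). \<phi> x \<in> T \<inter> F -` S} = O'"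
      using chart(2)[OF c] by (auto simp: O'_def)
    ultimately have "openin M O'" using openin_open_subtopology[OF chart(1)[OF c]] by simp
    moreover have "q \<in> O'" using qU TF(2) agree q(2) by (simp add: O'_def)
    moreover have "O' \<subseteq> {q \<in> topspace M. f q \<in> S}" using agree chart(2)[OF c] by (auto simp: O'_def)
    ultimately show "\<exists>T. openin M T \<and> q \<in> T \<and> T \<subseteq> {q \<in> topspace M. f q \<in> S}" by blast
  qed
qed simp

lemma continuous_X: "continuous_map M euclidean X"
  by (rule smooth_fun_continuous[OF manifold(4)])

lemma continuous_height: "continuous_map M euclideanreal (\<lambda>q. N q \<bullet> a)"
proof -
  have "continuous_map M euclideanreal ((\<lambda>x. x \<bullet> a) \<circ> N)"
    by (rule continuous_map_compose[OF smooth_fun_continuous[OF manifold(5)]]) (auto intro: continuous_intros)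
  then show ?thesis by (simp add: comp_def)
qed

lemma locally_constant_imp_constant:
  assumes loc: "\<And>q. q \<in> topspace M \<Longrightarrow> \<exists>O'. openin M O' \<and> q \<in> O' \<and> (\<forall>q'\<in>O'. f q' = f q)"
    and q: "q1 \<in> topspace M" "q2 \<in> topspace M"
  shows "f q1 = f q2"
proof -
  let ?Z = "{q \<in> topspace M. f q = f q2}"
  have op: "openin M {q \<in> topspace M. Q (f q)}" for Q
  proof (subst openin_subopen, rule ballI)
    fix q assume q: "q \<in> {q \<in> topspace M. Q (f q)}"
    then obtain T where T: "openin M T" "q \<in> T" "\<forall>q'\<in>T. f q' = f q" using loc by blast
    have "T \<subseteq> {q \<in> topspace M. Q (f q)}"
    proof
      fix x assume x: "x \<in> T"
      then have "x \<in> topspace M" "f x = f q" using T(3) openin_subset[OF T(1)] by auto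
      then show "x \<in> {q \<in> topspace M. Q (f q)}" using q by simp
    qed
    then show "\<exists>T. openin M T \<and> q \<in> T \<and> T \<subseteq> {q \<in> topspace M. Q (f q)}" using T(1,2) by blast
  qed
  have "openin M ?Z" by (rule op)
  moreover have "topspace M - ?Z = {q \<in> topspace M. f q \<noteq> f q2}" by auto
  then have "openin M (topspace M - ?Z)" using op[of "\<lambda>y. y \<noteq> f q2"] by simp
  then have "closedin M ?Z" by (simp add: closedin_def)
  ultimately have "?Z = topspace M" using manifold(2) q unfolding connected_space_clopen_in by blast
  then show ?thesis using q by blast
qed

lemma differential_in_E1:
  assumes c: "(U, \<phi>) \<in> A" and q: "q \<in> U" and v: "v \<in> E" shows "differential X (U, \<phi>) q v \<in> E1"
proof -
  obtain T F where TF: "smooth_open T F" "\<phi> q \<in> T" "\<And>w. w \<in> T \<Longrightarrow> pE w \<in> \<phi> ` U"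
    "\<And>w. w \<in> T \<Longrightarrow> F w = X (inv_into U \<phi> (pE w))"
    using chart_extension[OF c imageI[OF q] manifold(4)] by metis
  have "((\<lambda>w. pQ (F w)) has_derivative (\<lambda>h. pQ (frechet_derivative F (at (\<phi> q)) h))) (at (\<phi> q))"
    by (rule bounded_linear.has_derivative[OF bounded_linear_coord_proj smooth_open_deriv[OF TF(1,2)]])
  moreover have "pQ (F w) = 0" if "w \<in> T" for w
  proof -
    have "inv_into U \<phi> (pE w) \<in> topspace M" using inv_into_into[OF TF(3)[OF that]] chart(2)[OF c] by blast
    then show ?thesis using TF(4)[OF that] pQ_E1[OF X_in] by simp
  qed
  then have "eventually (\<lambda>t. pQ (F (\<phi> q + t *\<^sub>R v)) = pQ (F (\<phi> q))) (nhds 0)"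
    using eventually_line_in_open[OF smooth_open_open[OF TF(1)] TF(2), of v] TF(2) by (auto elim: eventually_mono)
  ultimately have "pQ (frechet_derivative F (at (\<phi> q)) v) = 0" by (rule derivative_zero_of_constant_direction)
  moreover have "differential X (U, \<phi>) q v = frechet_derivative F (at (\<phi> q)) v"
    by (rule differential_eq[OF c q TF(1,2) _ v]) (use TF pE_id in auto)
  ultimately show ?thesis using E1_iff_pQ by simp
qed

end

section \<open>Hypersurfaces as graphs over tangent hyperplanes\<close>

text \<open>
  A neighbourhood of \<open>q0\<close> as a graph over the tangent hyperplane. For \<open>z\<close> in a ball about
  \<open>X q0\<close> let \<open>\<kappa> z = inv_into U \<phi> (\<theta> z)\<close>. This is the point of the hypersurface that lies below \<open>z\<close> in the
  direction of the normal at \<open>q0\<close>, after the components of \<open>z\<close> outside \<open>E1\<close> are discarded, and \<open>s z\<close>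
  is the signed height of \<open>z\<close> above it. The derivative conditions say that \<open>\<kappa> z\<close> does not change along
  the discarded directions and along the normal, and that \<open>s\<close> grows at unit speed along the normal. The
  set \<open>U0\<close> is the part of the hypersurface that is seen inside the ball as the zero set of \<open>s\<close>.
\<close>

locale normal_graph = immersed_hypersurface e D d M A X N
  for e :: "nat \<Rightarrow> 'a::euclidean_space" and D d and M :: "'m topology" and A X N +
  fixes q0 :: 'm and U :: "'m set" and \<phi> :: "'m \<Rightarrow> 'a" and r :: real
    and \<theta> :: "'a \<Rightarrow> 'a" and s :: "'a \<Rightarrow> real" and U0 :: "'m set"
  assumes c: "(U, \<phi>) \<in> A" and q0: "q0 \<in> U0" and r: "0 < r" and U0: "openin M U0" "U0 \<subseteq> U"
    and smooth_\<theta>: "smooth_open (ball (X q0) r) \<theta>" and smooth_s: "smooth_open (ball (X q0) r) s"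
    and \<theta>_in: "\<And>z. z \<in> ball (X q0) r \<Longrightarrow> \<theta> z \<in> \<phi> ` U"
    and X_\<theta>: "\<And>z. z \<in> ball (X q0) r \<Longrightarrow> X (inv_into U \<phi> (\<theta> z)) = pE1 z - s z *\<^sub>R N q0"
    and D_normal: "\<And>z. z \<in> ball (X q0) r \<Longrightarrow> frechet_derivative \<theta> (at z) (N q0) = 0"
      "\<And>z. z \<in> ball (X q0) r \<Longrightarrow> frechet_derivative s (at z) (N q0) = 1"
    and D_Q: "\<And>z k. z \<in> ball (X q0) r \<Longrightarrow> pE1 k = 0 \<Longrightarrow> frechet_derivative \<theta> (at z) k = 0"
      "\<And>z k. z \<in> ball (X q0) r \<Longrightarrow> pE1 k = 0 \<Longrightarrow> frechet_derivative s (at z) k = 0"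
    and pos: "\<And>z. z \<in> ball (X q0) r \<Longrightarrow> 0 < N (inv_into U \<phi> (\<theta> z)) \<bullet> N q0"
    and on_U0: "\<And>q. q \<in> U0 \<Longrightarrow> X q \<in> ball (X q0) r" "\<And>q. q \<in> U0 \<Longrightarrow> \<theta> (X q) = \<phi> q" "\<And>q. q \<in> U0 \<Longrightarrow> s (X q) = 0"
    and into_U0: "\<And>z. z \<in> ball (X q0) r \<Longrightarrow> pE1 z = z \<Longrightarrow> s z = 0 \<Longrightarrow> inv_into U \<phi> (\<theta> z) \<in> U0"

text \<open>
  The map \<open>w \<mapsto> X (\<phi>\<^sup>-\<^sup>1 (pE w)) + (w \<bullet> e (d + 1)) \<nu> + pQ w\<close> adds to a parametrization of the
  hypersurface the normal direction and the directions orthogonal to \<open>E1\<close>. It is a local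
  diffeomorphism because \<open>X\<close> is an immersion; \<open>\<theta>\<close> and \<open>s\<close> are components of its inverse.
\<close>

lemma (in immersed_hypersurface) normal_graph_in_chart:
  assumes c: "(U, \<phi>) \<in> A" and q0U: "q0 \<in> U"
  obtains r \<theta> s U0 where "normal_graph e D d M A X N q0 U \<phi> r \<theta> s U0"
proof -
  have q0: "q0 \<in> topspace M" using chart(2)[OF c] q0U by blast
  define \<nu> where "\<nu> = N q0"
  have \<nu>: "\<nu> \<in> E1" "\<nu> \<bullet> \<nu> = 1" "pQ \<nu> = 0" using N_in[OF q0] N_unit[OF q0] pQ_E1 by (auto simp: \<nu>_def)
  obtain T F where TF: "smooth_open T F" "\<phi> q0 \<in> T" "\<And>w. w \<in> T \<Longrightarrow> pE w \<in> \<phi> ` U"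
    "\<And>w. w \<in> T \<Longrightarrow> F w = X (inv_into U \<phi> (pE w))"
    using chart_extension[OF c imageI[OF q0U] manifold(4)] by metis
  have T: "open T" using TF(1) smooth_open_open by blast
  define H where "H = (\<lambda>w. F w + ((w \<bullet> e (d + 1)) *\<^sub>R \<nu> + pQ w))"
  have sH: "smooth_open T H" unfolding H_def
    by (intro smooth_open_add TF(1) smooth_open_scaleR smooth_open_inner smooth_open_const smooth_open_id T
        smooth_open_linear[OF bounded_linear_coord_proj])
  have blH: "bounded_linear (\<lambda>w. (w \<bullet> e (d + 1)) *\<^sub>R \<nu> + pQ w)"
    by (rule bounded_linear_add[OF bounded_linear_compose[OF bounded_linear_scaleR_left bounded_linear_inner_left] bounded_linear_coord_proj])
  have DH: "frechet_derivative H (at w) h = frechet_derivative F (at w) h + ((h \<bullet> e (d + 1)) *\<^sub>R \<nu> + pQ h)"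
    if "w \<in> T" for w h
  proof -
    have "(H has_derivative (\<lambda>h. frechet_derivative F (at w) h + ((h \<bullet> e (d + 1)) *\<^sub>R \<nu> + pQ h))) (at w)"
      unfolding H_def
      by (rule has_derivative_add[OF smooth_open_deriv[OF TF(1) that] bounded_linear_imp_has_derivative[OF blH]])
    then show ?thesis by (rule frechet_derivative_eqI)
  qed
  have DF0: "frechet_derivative F (at w) k = 0" if w: "w \<in> T" and k: "pE k = 0" for w k
  proof (rule derivative_zero_of_constant_direction[OF smooth_open_deriv[OF TF(1) w]])
    have "pE (w + t *\<^sub>R k) = pE w" for t
      using k by (simp add: linear_add[OF linear_coord_proj] linear_scale[OF linear_coord_proj])
    then show "eventually (\<lambda>t. F (w + t *\<^sub>R k) = F w) (nhds 0)"
      using eventually_line_in_open[OF T w, of k] TF(4) w by (auto elim: eventually_mono)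
  qed
  have diffX: "differential X (U, \<phi>) q0 v = frechet_derivative F (at (\<phi> q0)) v" if "v \<in> E" for v
    by (rule differential_eq[OF c q0U TF(1,2) _ that]) (use TF pE_id in auto)
  have split: "h = pE h + (h \<bullet> e (d+1)) *\<^sub>R e (d+1) + pQ h" for h
    using split_E1_Q[of h] split_E_E1[of h] by simp
  have "inj (frechet_derivative H (at (\<phi> q0)))"
  proof (subst linear_injective_0[OF smooth_open_linear_deriv[OF sH TF(2)]], intro allI impI)
    fix h assume "frechet_derivative H (at (\<phi> q0)) h = 0"
    then have z: "frechet_derivative F (at (\<phi> q0)) h + ((h \<bullet> e (d + 1)) *\<^sub>R \<nu> + pQ h) = 0"
      using DH[OF TF(2)] by simp
    have lF: "linear (frechet_derivative F (at (\<phi> q0)))" using smooth_open_linear_deriv[OF TF(1,2)] .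
    have "frechet_derivative F (at (\<phi> q0)) h = frechet_derivative F (at (\<phi> q0)) (pE h) + frechet_derivative F (at (\<phi> q0)) (h - pE h)"
      using linear_add[OF lF, of "pE h" "h - pE h"] by simp
    moreover have "pE (h - pE h) = 0" by (simp add: linear_diff[OF linear_coord_proj] pE_id[OF pE_in])
    ultimately have Fh: "frechet_derivative F (at (\<phi> q0)) h = differential X (U, \<phi>) q0 (pE h)"
      using DF0[OF TF(2)] diffX[OF pE_in] by simp
    have "pQ (differential X (U, \<phi>) q0 (pE h)) = 0"
      using differential_in_E1[OF c q0U pE_in] E1_iff_pQ by blast
    then have "pQ (frechet_derivative F (at (\<phi> q0)) h + ((h \<bullet> e (d + 1)) *\<^sub>R \<nu> + pQ h)) = pQ h"
      using \<nu>(3) pQ_idem by (simp add: linear_add[OF linear_coord_proj] linear_scale[OF linear_coord_proj] Fh)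
    then have Q0: "pQ h = 0" using z linear_0[OF linear_coord_proj] by metis
    have "\<nu> \<bullet> differential X (U, \<phi>) q0 (pE h) = 0" using normal[OF c _ pE_in] q0U unfolding \<nu>_def by simp
    moreover have "\<nu> \<bullet> (differential X (U, \<phi>) q0 (pE h) + (h \<bullet> e (d + 1)) *\<^sub>R \<nu>) = 0" using z Fh Q0 by simp
    ultimately have h0: "h \<bullet> e (d + 1) = 0" using \<nu>(2) by (simp add: inner_add_right)
    then have "differential X (U, \<phi>) q0 (pE h) = 0" using z Fh Q0 by simp
    then have "pE h = 0" using immersion[OF c _ pE_in] q0U by simp
    then show "h = 0" using split[of h] h0 Q0 by simp
  qed
  then obtain U' V' G where G: "open U'" "U' \<subseteq> T" "\<phi> q0 \<in> U'" "open V'" "H (\<phi> q0) \<in> V'" "homeomorphism U' V' H G"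
    "smooth_open V' G" "\<And>y. y \<in> V' \<Longrightarrow> bij (frechet_derivative H (at (G y)))"
    "\<And>y. y \<in> V' \<Longrightarrow> frechet_derivative G (at y) = inv (frechet_derivative H (at (G y)))"
    using smooth_inverse_function[OF sH TF(2)] by metis
  have GV: "G z \<in> U'" "G z \<in> T" "H (G z) = z" if "z \<in> V'" for z
    using that G(2,6) by (auto simp: homeomorphism_def)
  have Hphi: "H (\<phi> q) = X q" if "q \<in> U" "\<phi> q \<in> T" for q
  proof -
    have E: "\<phi> q \<in> E" using that chart(5)[OF c] by blast
    then have "\<phi> q \<bullet> e (d+1) = 0" "pQ (\<phi> q) = 0"
      using in_span_iff[OF coord_subsets(1), of "\<phi> q"] Suc_d_in pQ_E1 E_subset_E1 by (auto simp: coord_space_def)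
    then show ?thesis using TF(4)[OF that(2)] pE_id[OF E] that(1) chart(3)[OF c] by (simp add: H_def inv_into_f_f)
  qed
  define \<theta> where "\<theta> = (\<lambda>z. pE (G z))"
  define s where "s = (\<lambda>z. G z \<bullet> e (d+1))"
  have \<theta>U: "\<theta> z \<in> \<phi> ` U" if "z \<in> V'" for z using TF(3)[OF GV(2)[OF that]] by (simp add: \<theta>_def)
  have s\<theta>: "smooth_open V' \<theta>" unfolding \<theta>_def by (rule smooth_open_linear[OF bounded_linear_coord_proj G(7)])
  have ss: "smooth_open V' s" unfolding s_def by (rule smooth_open_linear[OF bounded_linear_inner_left G(7)])
  have D\<theta>: "frechet_derivative \<theta> (at z) v = pE (frechet_derivative G (at z) v)" if "z \<in> V'" for z v
    unfolding \<theta>_def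
    by (rule frechet_derivative_eqI[OF bounded_linear.has_derivative[OF bounded_linear_coord_proj smooth_open_deriv[OF G(7) that]]])
  have Ds: "frechet_derivative s (at z) v = frechet_derivative G (at z) v \<bullet> e (d+1)" if "z \<in> V'" for z v
    unfolding s_def
    by (rule frechet_derivative_eqI[OF bounded_linear.has_derivative[OF bounded_linear_inner_left smooth_open_deriv[OF G(7) that]]])
  have DGv: "frechet_derivative G (at z) (frechet_derivative H (at (G z)) v) = v" if "z \<in> V'" for z v
    using G(8,9)[OF that] by (simp add: bij_is_inj)
  have DG\<nu>: "frechet_derivative G (at z) \<nu> = e (d+1)" if "z \<in> V'" for z
    using DGv[OF that, of "e (d+1)"] DH[OF GV(2)[OF that]] DF0[OF GV(2)[OF that] pE_e_Suc(1)] pE_e_Suc(2) e_inner[OF Suc_d_in Suc_d_in]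
    by simp
  have DGQ: "frechet_derivative G (at z) k = k" if "z \<in> V'" "pE1 k = 0" for z k
    using DGv[OF that(1), of k] DH[OF GV(2)[OF that(1)]] DF0[OF GV(2)[OF that(1)]] pE1_zero[OF that(2)] by simp
  have X\<theta>: "X (inv_into U \<phi> (\<theta> z)) = pE1 z - s z *\<^sub>R \<nu>" if z: "z \<in> V'" for z
  proof -
    have top: "inv_into U \<phi> (\<theta> z) \<in> topspace M" using inv_into_into[OF \<theta>U[OF z]] chart(2)[OF c] by blast
    have eq: "z = X (inv_into U \<phi> (\<theta> z)) + (s z *\<^sub>R \<nu> + pQ (G z))"
      using GV(3)[OF z] TF(4)[OF GV(2)[OF z]] by (simp add: H_def s_def \<theta>_def)
    then have "pQ z = pQ (X (inv_into U \<phi> (\<theta> z)) + (s z *\<^sub>R \<nu> + pQ (G z)))" by simp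
    also have "\<dots> = pQ (G z)"
      using pQ_E1[OF X_in[OF top]] \<nu>(3) pQ_idem by (simp add: linear_add[OF linear_coord_proj] linear_scale[OF linear_coord_proj])
    finally show ?thesis using eq split_E1_Q[of z] by (metis add.assoc add_diff_cancel_right' )
  qed
  define P where "P = (\<lambda>z. N (inv_into U \<phi> (\<theta> z)) \<bullet> \<nu>)"
  have "smooth_open V' (\<lambda>z. N (inv_into U \<phi> (\<theta> z)))"
    using compose_with_inverse_chart(1)[OF c s\<theta> \<theta>U manifold(5)] .
  then have "smooth_open V' P" unfolding P_def by (intro smooth_open_inner smooth_open_const G(4))
  then have "open (V' \<inter> P -` {0<..})"
    by (intro continuous_open_preimage smooth_open_continuous G(4)) auto
  moreover have G0: "G (X q0) = \<phi> q0" using G(3,6) Hphi[OF q0U TF(2)] by (metis homeomorphism_apply1)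
  have q0E: "\<phi> q0 \<in> E" using chart(5)[OF c] q0U by blast
  have "inv_into U \<phi> (\<theta> (X q0)) = q0" using G0 pE_id[OF q0E] q0U chart(3)[OF c] by (simp add: \<theta>_def inv_into_f_f)
  then have "P (X q0) = 1" using \<nu>(2) by (simp add: P_def \<nu>_def)
  moreover have XV': "X q0 \<in> V'" using G(5) Hphi[OF q0U TF(2)] by simp
  ultimately obtain r where r: "0 < r" "ball (X q0) r \<subseteq> V' \<inter> P -` {0<..}"
    using open_contains_ball by (metis IntI greaterThan_iff vimageI zero_less_one)
  then have bV: "z \<in> V'" "0 < P z" if "z \<in> ball (X q0) r" for z using that by auto
  have bV': "ball (X q0) r \<subseteq> V'" using r by auto
  define U0 where "U0 = {q \<in> U. \<phi> q \<in> U' \<and> X q \<in> ball (X q0) r}"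
  have "openin M U0"
  proof -
    have cphi: "continuous_map (subtopology M U) euclidean \<phi>" using chart(6)[OF c] .
    have "continuous_map (subtopology M U) euclidean X"
      by (rule continuous_map_from_subtopology[OF smooth_fun_continuous[OF manifold(4)]])
    then have "openin (subtopology M U) {q \<in> topspace (subtopology M U). X q \<in> ball (X q0) r}"
      by (rule openin_continuous_map_preimage) simp
    moreover have "openin (subtopology M U) {q \<in> topspace (subtopology M U). \<phi> q \<in> U'}"
      using cphi by (rule openin_continuous_map_preimage) (use G(1) in simp)
    ultimately have "openin (subtopology M U) ({q \<in> topspace (subtopology M U). X q \<in> ball (X q0) r} \<inter> {q \<in> topspace (subtopology M U). \<phi> q \<in> U'})"
      by (rule openin_Int)
    moreover have "({q \<in> topspace (subtopology M U). X q \<in> ball (X q0) r} \<inter> {q \<in> topspace (subtopology M U). \<phi> q \<in> U'}) = U0"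
      using chart(2)[OF c] unfolding U0_def by auto
    ultimately show ?thesis using openin_open_subtopology[OF chart(1)[OF c]] by simp
  qed
  have onU0: "\<theta> (X q) = \<phi> q" "s (X q) = 0" if "q \<in> U0" for q
  proof -
    have q: "q \<in> U" "\<phi> q \<in> U'" "X q \<in> ball (X q0) r" using that by (auto simp: U0_def)
    then have "G (X q) = \<phi> q" using G(2,6) Hphi by (metis homeomorphism_apply1 subsetD)
    moreover have "\<phi> q \<in> E" using chart(5)[OF c] q by blast
    ultimately show "\<theta> (X q) = \<phi> q" "s (X q) = 0"
      using pE_id in_span_iff[OF coord_subsets(1), of "\<phi> q"] Suc_d_in by (auto simp: \<theta>_def s_def coord_space_def)
  qed
  have "normal_graph e D d M A X N q0 U \<phi> r \<theta> s U0"
  proof (unfold_locales)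
    show "q0 \<in> U0" using q0U G(3) r by (simp add: U0_def)
    show "U0 \<subseteq> U" by (auto simp: U0_def)
    show "smooth_open (ball (X q0) r) \<theta>" "smooth_open (ball (X q0) r) s"
      using s\<theta> ss smooth_open_subset bV' by blast+
    fix z assume z: "z \<in> ball (X q0) r"
    show "\<theta> z \<in> \<phi> ` U" "X (inv_into U \<phi> (\<theta> z)) = pE1 z - s z *\<^sub>R N q0"
      "frechet_derivative \<theta> (at z) (N q0) = 0" "frechet_derivative s (at z) (N q0) = 1"
      using \<theta>U X\<theta> D\<theta> Ds DG\<nu> pE_e_Suc(1) bV(1)[OF z] e_inner[OF Suc_d_in Suc_d_in] by (auto simp: \<nu>_def)
    show "0 < N (inv_into U \<phi> (\<theta> z)) \<bullet> N q0" using bV(2)[OF z] by (simp add: P_def \<nu>_def)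
    show "inv_into U \<phi> (\<theta> z) \<in> U0" if "pE1 z = z" "s z = 0"
    proof -
      have Xz: "X (inv_into U \<phi> (\<theta> z)) = z" using X\<theta>[OF bV(1)[OF z]] that by simp
      have "z = X (inv_into U \<phi> (\<theta> z)) + (s z *\<^sub>R \<nu> + pQ (G z))"
        using GV(3)[OF bV(1)[OF z]] TF(4)[OF GV(2)[OF bV(1)[OF z]]] by (simp add: H_def s_def \<theta>_def)
      then have "pQ (G z) = 0" using Xz that(2) by simp
      then have "G z = \<theta> z" using split[of "G z"] that(2) by (simp add: \<theta>_def s_def)
      then have "\<phi> (inv_into U \<phi> (\<theta> z)) \<in> U'" using f_inv_into_f[OF \<theta>U[OF bV(1)[OF z]]] GV(1)[OF bV(1)[OF z]] by simp
      then show ?thesis using Xz z inv_into_into[OF \<theta>U[OF bV(1)[OF z]]] by (simp add: U0_def)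
    qed
    fix k assume k: "pE1 k = 0"
    show "frechet_derivative \<theta> (at z) k = 0" "frechet_derivative s (at z) k = 0"
      using D\<theta>[OF bV(1)[OF z]] Ds[OF bV(1)[OF z]] DGQ[OF bV(1)[OF z] k] pE1_zero[OF k] by auto
  next
    fix q assume q: "q \<in> U0"
    then show "X q \<in> ball (X q0) r" by (simp add: U0_def)
    show "\<theta> (X q) = \<phi> q" "s (X q) = 0" using onU0[OF q] by auto
  qed fact+
  then show ?thesis using that by blast
qed

lemma (in immersed_hypersurface) normal_graph_exists:
  assumes "q0 \<in> topspace M"
  obtains U \<phi> r \<theta> s U0 where "normal_graph e D d M A X N q0 U \<phi> r \<theta> s U0"
proof -
  obtain U \<phi> where "(U, \<phi>) \<in> A" "q0 \<in> U" using chart_exists[OF assms] by blast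
  then show ?thesis using normal_graph_in_chart that by metis
qed

context normal_graph
begin

abbreviation "V \<equiv> ball (X q0) r"

abbreviation "\<nu> \<equiv> N q0"

definition \<kappa> :: "'a \<Rightarrow> 'm" where "\<kappa> z = inv_into U \<phi> (\<theta> z)"

definition Nt :: "'a \<Rightarrow> 'a" where "Nt z = N (\<kappa> z)"

lemma \<kappa>_in_U: "z \<in> V \<Longrightarrow> \<kappa> z \<in> U" and \<kappa>_in: "z \<in> V \<Longrightarrow> \<kappa> z \<in> topspace M"
  using inv_into_into[OF \<theta>_in] chart(2)[OF c] by (auto simp: \<kappa>_def)

lemma q0_in: "q0 \<in> topspace M" and U0_top: "U0 \<subseteq> topspace M"
  using q0 U0 openin_subset by auto

lemma \<nu>_facts: "\<nu> \<in> E1" "\<nu> \<bullet> \<nu> = 1" "norm \<nu> = 1"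
  using N_in N_unit N_norm q0_in by auto

lemma \<kappa>_X: "q \<in> U0 \<Longrightarrow> \<kappa> (X q) = q"
  unfolding \<kappa>_def using on_U0(2) chart(3)[OF c] U0(2) by (simp add: inv_into_f_f subset_iff)

lemma Nt_X: "q \<in> U0 \<Longrightarrow> Nt (X q) = N q"
  by (simp add: Nt_def \<kappa>_X)

lemma X_\<kappa>: "z \<in> V \<Longrightarrow> X (\<kappa> z) = pE1 z - s z *\<^sub>R \<nu>"
  unfolding \<kappa>_def by (rule X_\<theta>)

lemma center: "X q0 \<in> V" "s (X q0) = 0" "\<kappa> (X q0) = q0" "Nt (X q0) = \<nu>"
  using r q0 on_U0 \<kappa>_X Nt_X by auto

lemma \<kappa>_in_U0: "z \<in> V \<Longrightarrow> pE1 z = z \<Longrightarrow> s z = 0 \<Longrightarrow> \<kappa> z \<in> U0"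
  unfolding \<kappa>_def by (rule into_U0)

lemma continuous_\<kappa>: "continuous_map (top_of_set V) M \<kappa>"
proof -
  have "continuous_map (top_of_set V) M (inv_into U \<phi> \<circ> \<theta>)"
    by (rule continuous_map_compose[OF _ chart(7)[OF c]])
       (use smooth_open_continuous[OF smooth_\<theta>] \<theta>_in in auto)
  then show ?thesis by (simp add: \<kappa>_def[abs_def] comp_def)
qed

lemma smooth_along:
  fixes f :: "'m \<Rightarrow> 'b::real_normed_vector"
  assumes "smooth_fun A f" shows "smooth_open V (\<lambda>z. f (\<kappa> z))"
  unfolding \<kappa>_def by (rule compose_with_inverse_chart(1)[OF c smooth_\<theta> \<theta>_in assms])

lemma deriv_along:
  fixes f :: "'m \<Rightarrow> 'b::real_normed_vector"
  assumes "smooth_fun A f" "z \<in> V"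
  shows "frechet_derivative (\<lambda>z. f (\<kappa> z)) (at z) v = differential f (U, \<phi>) (\<kappa> z) (frechet_derivative \<theta> (at z) v)"
  unfolding \<kappa>_def by (rule compose_with_inverse_chart(3)[OF c smooth_\<theta> \<theta>_in assms])

lemma D\<theta>_in: "z \<in> V \<Longrightarrow> frechet_derivative \<theta> (at z) v \<in> E"
  by (rule compose_with_inverse_chart(2)[OF c smooth_\<theta> \<theta>_in manifold(4)])

lemma smooth_Nt: "smooth_open V Nt"
  unfolding Nt_def[abs_def] by (rule smooth_along[OF manifold(5)])

lemma has_derivative_X\<kappa>:
  assumes "z \<in> V" shows "((\<lambda>z. X (\<kappa> z)) has_derivative (\<lambda>v. pE1 v - frechet_derivative s (at z) v *\<^sub>R \<nu>)) (at z)"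
proof -
  have "((\<lambda>z. pE1 z - s z *\<^sub>R \<nu>) has_derivative (\<lambda>v. pE1 v - frechet_derivative s (at z) v *\<^sub>R \<nu>)) (at z)"
    by (rule has_derivative_diff[OF bounded_linear_imp_has_derivative[OF bounded_linear_coord_proj]
          bounded_linear.has_derivative[OF bounded_linear_scaleR_left smooth_open_deriv[OF smooth_s assms]]])
  then show ?thesis by (rule has_derivative_transform_within_open[OF _ open_ball assms]) (simp add: X_\<kappa>)
qed

lemma differential_X_D\<theta>:
  assumes "z \<in> V"
  shows "differential X (U, \<phi>) (\<kappa> z) (frechet_derivative \<theta> (at z) v) = pE1 v - frechet_derivative s (at z) v *\<^sub>R \<nu>"
  using deriv_along[OF manifold(4) assms] frechet_derivative_eqI[OF has_derivative_X\<kappa>[OF assms]] by simp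

lemma Nt_in: "z \<in> V \<Longrightarrow> Nt z \<in> E1" and Nt_unit: "z \<in> V \<Longrightarrow> Nt z \<bullet> Nt z = 1" and Nt_norm: "z \<in> V \<Longrightarrow> norm (Nt z) = 1"
  and Nt_pos: "z \<in> V \<Longrightarrow> 0 < Nt z \<bullet> \<nu>"
  using N_in N_unit N_norm \<kappa>_in pos by (auto simp: Nt_def \<kappa>_def)

text \<open>
  The tangent vectors at \<open>\<kappa> z\<close> are the derivatives \<open>pE1 v - Ds(v) \<nu>\<close> of \<open>X \<circ> \<kappa>\<close>. Orthogonality to
  them makes the normal a multiple of the gradient of \<open>s\<close>.
\<close>

lemma Nt_gradient:
  assumes z: "z \<in> V" shows "Nt z \<bullet> v = frechet_derivative s (at z) v * (Nt z \<bullet> \<nu>)"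
proof -
  have "Nt z \<bullet> (pE1 v - frechet_derivative s (at z) v *\<^sub>R \<nu>) = 0"
  proof -
    have "N (\<kappa> z) \<bullet> differential X (U, \<phi>) (\<kappa> z) (frechet_derivative \<theta> (at z) v) = 0"
      using normal[OF c _ D\<theta>_in[OF z], of "\<kappa> z" v] \<kappa>_in_U[OF z] by simp
    then show ?thesis unfolding differential_X_D\<theta>[OF z] Nt_def .
  qed
  moreover have "Nt z \<bullet> pE1 v = Nt z \<bullet> v"
    using coord_proj_adjoint pE1_id[OF Nt_in[OF z]] by metis
  ultimately show ?thesis by (simp add: inner_diff_right)
qed

lemma DNt_vertical:
  assumes z: "z \<in> V"
  shows "frechet_derivative Nt (at z) \<nu> = 0" "pE1 k = 0 \<Longrightarrow> frechet_derivative Nt (at z) k = 0"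
proof -
  have "differential N (U, \<phi>) (\<kappa> z) 0 = 0"
    using deriv_along[OF manifold(5) z, of 0] linear_0[OF smooth_open_linear_deriv[OF smooth_\<theta> z]]
      linear_0[OF smooth_open_linear_deriv[OF smooth_along[OF manifold(5)] z]] by simp
  then show "frechet_derivative Nt (at z) \<nu> = 0" "pE1 k = 0 \<Longrightarrow> frechet_derivative Nt (at z) k = 0"
    unfolding Nt_def[abs_def] using deriv_along[OF manifold(5) z] D_normal(1)[OF z] D_Q(1)[OF z] by auto
qed

lemma DNt_orthogonal:
  assumes z: "z \<in> V" shows "frechet_derivative Nt (at z) v \<bullet> Nt z = 0"
proof -
  have "((\<lambda>z. Nt z \<bullet> Nt z) has_derivative (\<lambda>h. Nt z \<bullet> frechet_derivative Nt (at z) h + frechet_derivative Nt (at z) h \<bullet> Nt z)) (at z)"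
    by (rule has_derivative_inner[OF smooth_open_deriv[OF smooth_Nt z] smooth_open_deriv[OF smooth_Nt z]])
  moreover have "eventually (\<lambda>t. Nt (z + t *\<^sub>R v) \<bullet> Nt (z + t *\<^sub>R v) = Nt z \<bullet> Nt z) (nhds 0)"
    using eventually_line_in_open[OF open_ball z, of v] by (rule eventually_mono) (use Nt_unit z in auto)
  ultimately have "Nt z \<bullet> frechet_derivative Nt (at z) v + frechet_derivative Nt (at z) v \<bullet> Nt z = 0"
    by (rule derivative_zero_of_constant_direction)
  then show ?thesis by (simp add: inner_commute)
qed

section \<open>The mean curvature as a divergence\<close>

text \<open>
  The reflection that exchanges \<open>\<nu>\<close> with \<open>- Nt z\<close> carries a fixed orthonormal basis of the tangent
  space at \<open>q0\<close> to one of the tangent space at \<open>\<kappa> z\<close>, and it depends smoothly on \<open>z\<close>. The derivative of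
  \<open>\<theta>\<close> expresses these vectors in the chart.
\<close>

lemma frame_exists: "\<exists>W v. \<phi> q0 \<in> W \<and> local_orthonormal_frame e d X (U, \<phi>) W v"
proof -
  define x where "x = (\<lambda>i. reflection (\<nu> - e (d+1)) (e i))"
  have ne: "norm (e (d+1)) = 1" using e_inner[OF Suc_d_in Suc_d_in] by (simp add: norm_eq_1)
  have xe: "reflection (\<nu> - e (d+1)) (e (d+1)) = \<nu>" using reflection_swap ne \<nu>_facts(3) by metis
  have xx: "x i \<bullet> x j = (if i = j then 1 else 0)" "x i \<bullet> \<nu> = 0" if "i \<in> {1..d}" "j \<in> {1..d}" for i j
    using that e_inner[of i j] e_inner[of i "d+1"] reflection_inner[of "\<nu> - e (d+1)" "e i" "e j"]
      reflection_inner[of "\<nu> - e (d+1)" "e i" "e (d+1)"] dD unfolding x_def xe by auto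
  have eE1: "e i \<in> E1" if "i \<in> {1..d+1}" for i using that unfolding coord_space_def by (intro span_base imageI)
  have sub: "subspace E1" unfolding coord_space_def by simp
  have xE: "x i \<in> E1" if "i \<in> {1..d}" for i
    unfolding x_def reflection_def using that \<nu>_facts(1) eE1 sub by (intro subspace_diff subspace_scale) auto
  define f where "f = (\<lambda>i z. reflection (\<nu> + Nt z) (x i))"
  have nz: "\<nu> + Nt z \<noteq> 0" if "z \<in> V" for z
    using Nt_pos[OF that] \<nu>_facts(2) by (metis add_eq_0_iff inner_minus_left inner_add_left less_irrefl neg_0_less_iff_less zero_less_one order_less_trans)
  have sf: "smooth_open V (f i)" for i
    unfolding f_def by (rule smooth_open_reflection[OF smooth_open_add[OF smooth_open_const[OF open_ball] smooth_Nt] nz])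
  have ff: "f i z \<bullet> f j z = (if i = j then 1 else 0)" if "i \<in> {1..d}" "j \<in> {1..d}" for i j z
    using xx(1)[OF that] by (simp add: f_def reflection_inner)
  have fN: "f i z \<bullet> Nt z = 0" if i: "i \<in> {1..d}" and z: "z \<in> V" for i z
  proof -
    have "reflection (\<nu> - (- Nt z)) (- Nt z) = \<nu>" using \<nu>_facts(3) Nt_norm[OF z] by (intro reflection_swap) simp
    then have "- Nt z = reflection (\<nu> + Nt z) \<nu>" using reflection_involution by (metis diff_minus_eq_add)
    then have "f i z \<bullet> (- Nt z) = x i \<bullet> \<nu>" unfolding f_def by (simp add: reflection_inner)
    then show ?thesis using xx(2)[OF i i] by simp
  qed
  have fE: "f i z \<in> E1" if "i \<in> {1..d}" "z \<in> V" for i z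
    unfolding f_def reflection_def using that xE \<nu>_facts(1) Nt_in sub by (intro subspace_diff subspace_scale subspace_add) auto
  define v where "v = (\<lambda>i y. frechet_derivative \<theta> (at (X (inv_into U \<phi> y))) (f i (X (inv_into U \<phi> y))))"
  let ?W = "\<phi> ` U0"
  have Wy: "\<exists>q\<in>U0. y = \<phi> q \<and> inv_into U \<phi> y = q \<and> X q \<in> V \<and> \<theta> (X q) = y \<and> \<kappa> (X q) = q" if "y \<in> ?W" for y
    using that on_U0 \<kappa>_X chart(3)[OF c] U0(2) by (auto simp: inv_into_f_f subset_iff)
  have frf: "frame_field X (U, \<phi>) v i y = f i (X (inv_into U \<phi> y))" if i: "i \<in> {1..d}" and y: "y \<in> ?W" for i y
  proof -
    obtain q where q: "q \<in> U0" "y = \<phi> q" "inv_into U \<phi> y = q" "X q \<in> V" "\<kappa> (X q) = q" using Wy[OF y] by blast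
    have "frechet_derivative s (at (X q)) (f i (X q)) * (Nt (X q) \<bullet> \<nu>) = 0"
      using Nt_gradient[OF q(4), of "f i (X q)"] fN[OF i q(4)] by (simp add: inner_commute)
    then have "frechet_derivative s (at (X q)) (f i (X q)) = 0" using Nt_pos[OF q(4)] by simp
    then show ?thesis
      using differential_X_D\<theta>[OF q(4), of "f i (X q)"] q(3,5) pE1_id[OF fE[OF i q(4)]]
      by (simp add: frame_field_def v_def)
  qed
  have "local_orthonormal_frame e d X (U, \<phi>) ?W v"
    unfolding local_orthonormal_frame_def fst_conv snd_conv
  proof (intro conjI ballI)
    have "openin (top_of_set (\<phi> ` U)) {y \<in> topspace (top_of_set (\<phi> ` U)). inv_into U \<phi> y \<in> U0}"
      using chart(7)[OF c] U0(1) by (rule openin_continuous_map_preimage)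
    moreover have "{y \<in> topspace (top_of_set (\<phi> ` U)). inv_into U \<phi> y \<in> U0} = ?W"
      using chart(3)[OF c] U0(2) by (auto simp: inv_into_f_f subset_iff)
    ultimately show "openin (top_of_set (coord_space e d)) ?W" using chart(4)[OF c] openin_trans by metis
    show "?W \<subseteq> \<phi> ` U" using U0(2) by blast
    fix i assume i: "i \<in> {1..d}"
    show "v i ` ?W \<subseteq> coord_space e d"
    proof (rule image_subsetI)
      fix y assume "y \<in> ?W"
      from Wy[OF this] obtain q where "inv_into U \<phi> y = q" "X q \<in> V" by blast
      then show "v i y \<in> coord_space e d" unfolding v_def using D\<theta>_in by blast
    qed
    show "smooth_on ?W (v i)" unfolding smooth_on_iff_smooth_open
    proof
      fix y assume y: "y \<in> ?W"
      from Wy[OF y] obtain q where q: "q \<in> U0" "y = \<phi> q" "inv_into U \<phi> y = q" "X q \<in> V" by blast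
      obtain T F where TF: "smooth_open T F" "y \<in> T" "\<And>w. w \<in> T \<Longrightarrow> F w = X (inv_into U \<phi> (pE w))"
        using chart_extension[OF c _ manifold(4), of y] q U0(2) by (metis imageI subsetD)
      have fy: "F w = X (inv_into U \<phi> w)" if "w \<in> T" "w \<in> ?W" for w
        using TF(3)[OF that(1)] pE_id that(2) chart(5)[OF c] U0(2) by (metis image_mono subsetD)
      have g: "smooth_open V (\<lambda>z. frechet_derivative \<theta> (at z) (f i z))"
      proof (rule smooth_open_cong)
        show "smooth_open V (\<lambda>z. \<Sum>b\<in>Basis. (f i z \<bullet> b) *\<^sub>R frechet_derivative \<theta> (at z) b)"
          by (intro smooth_open_sum smooth_open_scaleR smooth_open_inner smooth_open_const sf smooth_open_directional[OF smooth_\<theta>]) auto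
        show "(\<Sum>b\<in>Basis. (f i z \<bullet> b) *\<^sub>R frechet_derivative \<theta> (at z) b) = frechet_derivative \<theta> (at z) (f i z)" if "z \<in> V" for z
          by (rule linear_expand[symmetric, OF smooth_open_linear_deriv[OF smooth_\<theta> that]])
      qed
      have o: "open (T \<inter> F -` V)"
        by (rule continuous_open_preimage[OF smooth_open_continuous[OF TF(1)] smooth_open_open[OF TF(1)] open_ball])
      have "smooth_open (T \<inter> F -` V) (\<lambda>w. frechet_derivative \<theta> (at (F w)) (f i (F w)))"
        by (rule smooth_open_compose[OF smooth_open_subset[OF TF(1) o] g]) auto
      moreover have "y \<in> T \<inter> F -` V" using TF(2) fy[OF TF(2) y] q by simp
      ultimately show "\<exists>W F. y \<in> W \<and> smooth_open W F \<and> (\<forall>y\<in>?W \<inter> W. F y = v i y)"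
        using fy unfolding v_def by (intro exI[of _ "T \<inter> F -` V"] exI[of _ "\<lambda>w. frechet_derivative \<theta> (at (F w)) (f i (F w))"]) auto
    qed
  next
    fix y i j assume "y \<in> ?W" "i \<in> {1..d}" "j \<in> {1..d}"
    then show "frame_field X (U, \<phi>) v i y \<bullet> frame_field X (U, \<phi>) v j y = (if i = j then 1 else 0)"
      using frf ff by simp
  qed
  then show ?thesis using q0 by blast
qed

end

context immersed_hypersurface
begin

text \<open>
  Differentiating \<open>f i \<bullet> N = 0\<close> along the frame vector \<open>f i\<close> turns each summand into
  \<open>- f i \<bullet> L (f i)\<close>. Together with \<open>N q\<close> and the basis vectors outside \<open>E1\<close>, which contribute
  \<open>0\<close>, the frame is an orthonormal basis of the ambient space, and the sum is a trace.
\<close>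

lemma frame_sum:
  assumes q: "openin M O'" "q \<in> O'" and ext: "\<And>q'. q' \<in> O' \<Longrightarrow> Nt (X q') = N q'"
    and L: "(Nt has_derivative L) (at (X q))" "L (N q) \<bullet> N q = 0" "\<And>k. pE1 k = 0 \<Longrightarrow> L k \<bullet> k = 0"
    and c: "(U, \<phi>) \<in> A" "q \<in> U" and W: "\<phi> q \<in> W" "local_orthonormal_frame e d X (U, \<phi>) W v"
  shows "(\<Sum>i=1..d. dir_deriv (frame_field X (U, \<phi>) v i) (\<phi> q) (v i (\<phi> q)) \<bullet> N q) = - (\<Sum>b\<in>Basis. b \<bullet> L b)"
proof -
  have fr: "openin (top_of_set E) W" "W \<subseteq> \<phi> ` U" "\<And>i. i \<in> {1..d} \<Longrightarrow> smooth_on W (v i)"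
    "\<And>i y. i \<in> {1..d} \<Longrightarrow> y \<in> W \<Longrightarrow> v i y \<in> E"
    "\<And>y i j. y \<in> W \<Longrightarrow> i \<in> {1..d} \<Longrightarrow> j \<in> {1..d} \<Longrightarrow> frame_field X (U, \<phi>) v i y \<bullet> frame_field X (U, \<phi>) v j y = (if i = j then 1 else 0)"
    using W(2) unfolding local_orthonormal_frame_def by (auto simp: image_subset_iff)
  have qM: "q \<in> topspace M" using q openin_subset by blast
  have cE: "\<phi> ` U \<subseteq> E" by (rule chart(5)[OF c(1)])
  have y0: "\<phi> q \<in> E" using cE c(2) by blast
  have sub: "subspace E" unfolding coord_space_def by simp
  let ?f = "\<lambda>i. frame_field X (U, \<phi>) v i (\<phi> q)"
  have inv0: "inv_into U \<phi> (\<phi> q) = q" using inv_into_f_f[OF chart(3)[OF c(1)] c(2)] .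
  obtain T F where TF: "smooth_open T F" "\<phi> q \<in> T" "\<And>w. w \<in> T \<Longrightarrow> F w = X (inv_into U \<phi> (pE w))"
    using chart_extension[OF c(1) imageI[OF c(2)] manifold(4)] by metis
  obtain T2 F2 where TF2: "smooth_open T2 F2" "\<phi> q \<in> T2" "\<And>w. w \<in> T2 \<Longrightarrow> F2 w = N (inv_into U \<phi> (pE w))"
    using chart_extension[OF c(1) imageI[OF c(2)] manifold(5)] by metis
  obtain W2 where W2: "open W2" "W = E \<inter> W2" using fr(1) openin_open by metis
  have "openin (top_of_set (\<phi> ` U)) {y \<in> topspace (top_of_set (\<phi> ` U)). inv_into U \<phi> y \<in> O'}"
    using chart(7)[OF c(1)] q(1) by (rule openin_continuous_map_preimage)
  then have "openin (top_of_set E) {y \<in> topspace (top_of_set (\<phi> ` U)). inv_into U \<phi> y \<in> O'}"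
    using chart(4)[OF c(1)] openin_trans by metis
  then obtain W4 where W4: "open W4" "{y \<in> topspace (top_of_set (\<phi> ` U)). inv_into U \<phi> y \<in> O'} = E \<inter> W4"
    unfolding openin_open by blast
  have "\<phi> q \<in> {y \<in> topspace (top_of_set (\<phi> ` U)). inv_into U \<phi> y \<in> O'}" using c(2) q(2) inv0 by simp
  then have "\<phi> q \<in> E \<inter> W4" unfolding W4(2) .
  have FX: "F y = X (inv_into U \<phi> y)" "F2 y = N (inv_into U \<phi> y)" if "y \<in> E" "y \<in> T" "y \<in> T2" for y
    using TF(3)[OF that(2)] TF2(3)[OF that(3)] pE_id[OF that(1)] by auto
  have diffX: "differential X (U, \<phi>) (inv_into U \<phi> y) a = frechet_derivative F (at y) a" if "y \<in> W" "y \<in> T" "a \<in> E" for y a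
  proof -
    have y: "y \<in> \<phi> ` U" using that(1) fr(2) by blast
    then have *: "\<phi> (inv_into U \<phi> y) = y" "inv_into U \<phi> y \<in> U" by (simp_all add: f_inv_into_f inv_into_into)
    show ?thesis using differential_eq[OF c(1) *(2) TF(1) _ _ that(3), of X] that *(1) TF(3) pE_id by simp
  qed
  have f_eq: "?f i = frechet_derivative F (at (\<phi> q)) (v i (\<phi> q))" if "i \<in> {1..d}" for i
    using diffX[OF W(1) TF(2) fr(4)[OF that W(1)]] by (simp add: frame_field_def)
  have summand: "dir_deriv (frame_field X (U, \<phi>) v i) (\<phi> q) (v i (\<phi> q)) \<bullet> N q = - (?f i \<bullet> L (?f i))" if i: "i \<in> {1..d}" for i
  proof -
    define a where "a = v i (\<phi> q)"
    have a: "a \<in> E" using fr(4)[OF i W(1)] by (simp add: a_def)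
    have "\<exists>W' F. \<phi> q \<in> W' \<and> smooth_open W' F \<and> (\<forall>y\<in>W \<inter> W'. F y = v i y)"
      using fr(3)[OF i] W(1) unfolding smooth_on_iff_smooth_open by blast
    then obtain W3 vi where W3: "\<phi> q \<in> W3" "smooth_open W3 vi" "\<And>y. y \<in> W \<inter> W3 \<Longrightarrow> vi y = v i y" by blast
    define S where "S = T \<inter> T2 \<inter> W2 \<inter> W3 \<inter> W4"
    have S: "open S" "\<phi> q \<in> S" unfolding S_def
      using TF(1)[THEN smooth_open_open] TF2(1)[THEN smooth_open_open] W3(2)[THEN smooth_open_open]
        TF(2) TF2(2) W2 W3(1) W4(1) W(1) \<open>\<phi> q \<in> E \<inter> W4\<close> by auto
    have ev: "eventually (\<lambda>t. \<phi> q + t *\<^sub>R a \<in> S \<inter> E) (nhds 0)"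
      using eventually_line_in_open[OF S, of a] by (rule eventually_mono) (use y0 a sub in \<open>auto intro!: subspace_add subspace_scale\<close>)
    define g where "g = (\<lambda>w. \<Sum>b\<in>Basis. (vi w \<bullet> b) *\<^sub>R frechet_derivative F (at w) b)"
    have oTW: "open (T \<inter> W3)" using TF(1)[THEN smooth_open_open] W3(2)[THEN smooth_open_open] by auto
    have "smooth_open (T \<inter> W3) g" unfolding g_def
      using smooth_open_subset[OF TF(1) oTW] smooth_open_subset[OF W3(2) oTW]
      by (intro smooth_open_sum smooth_open_scaleR smooth_open_inner smooth_open_const smooth_open_directional oTW finite_Basis) auto
    then have g': "(g has_derivative frechet_derivative g (at (\<phi> q))) (at (\<phi> q))"
      by (rule smooth_open_deriv) (use TF(2) W3(1) in auto)
    have fg: "frame_field X (U, \<phi>) v i y = g y" and normal0: "g y \<bullet> F2 y = 0"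
      and Nt_eq: "F2 y = Nt (F y)" if "y \<in> S \<inter> E" for y
    proof -
      have y: "y \<in> W" "y \<in> T" "y \<in> T2" "y \<in> W3" "y \<in> W4" "y \<in> E" using that W2(2) by (auto simp: S_def)
      have "frame_field X (U, \<phi>) v i y = frechet_derivative F (at y) (vi y)"
        using diffX[OF y(1,2) fr(4)[OF i y(1)]] W3(3) y by (simp add: frame_field_def)
      then show fg: "frame_field X (U, \<phi>) v i y = g y"
        unfolding g_def using linear_expand[OF smooth_open_linear_deriv[OF TF(1) y(2)]] by metis
      have "inv_into U \<phi> y \<in> U" using y(1) fr(2) by (blast intro: inv_into_into)
      then have "N (inv_into U \<phi> y) \<bullet> frame_field X (U, \<phi>) v i y = 0"
        using normal[OF c(1) _ fr(4)[OF i y(1)]] by (simp add: frame_field_def)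
      then show "g y \<bullet> F2 y = 0" using FX(2)[OF y(6,2,3)] fg by (simp add: inner_commute)
      have "y \<in> {y \<in> topspace (top_of_set (\<phi> ` U)). inv_into U \<phi> y \<in> O'}" unfolding W4(2) using y(5,6) by simp
      then have "inv_into U \<phi> y \<in> O'" by simp
      then show "F2 y = Nt (F y)" using ext FX[OF y(6,2,3)] by simp
    qed
    have 1: "dir_deriv (frame_field X (U, \<phi>) v i) (\<phi> q) a = frechet_derivative g (at (\<phi> q)) a"
      by (rule dir_deriv_eqI(2)[OF g']) (use ev fg in \<open>auto elim: eventually_mono\<close>)
    have at0: "\<phi> q \<in> S \<inter> E" using S y0 by blast
    have F2q: "F2 (\<phi> q) = N q" "F (\<phi> q) = X q" using FX[OF y0 TF(2) TF2(2)] inv0 by auto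
    have gq: "g (\<phi> q) = ?f i" using fg[OF at0] by simp
    have "((\<lambda>w. g w \<bullet> F2 w) has_derivative (\<lambda>h. g (\<phi> q) \<bullet> frechet_derivative F2 (at (\<phi> q)) h + frechet_derivative g (at (\<phi> q)) h \<bullet> F2 (\<phi> q))) (at (\<phi> q))"
      by (rule has_derivative_inner[OF g' smooth_open_deriv[OF TF2(1,2)]])
    moreover have "eventually (\<lambda>t. g (\<phi> q + t *\<^sub>R a) \<bullet> F2 (\<phi> q + t *\<^sub>R a) = g (\<phi> q) \<bullet> F2 (\<phi> q)) (nhds 0)"
      using ev by (rule eventually_mono) (use normal0 at0 in simp)
    ultimately have 2: "g (\<phi> q) \<bullet> frechet_derivative F2 (at (\<phi> q)) a + frechet_derivative g (at (\<phi> q)) a \<bullet> F2 (\<phi> q) = 0"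
      by (rule derivative_zero_of_constant_direction)
    have "(Nt has_derivative L) (at (F (\<phi> q)))" using L(1) F2q by simp
    then have "((\<lambda>w. F2 w - Nt (F w)) has_derivative (\<lambda>h. frechet_derivative F2 (at (\<phi> q)) h - L (frechet_derivative F (at (\<phi> q)) h))) (at (\<phi> q))"
      by (intro has_derivative_diff smooth_open_deriv[OF TF2(1,2)] has_derivative_compose[OF smooth_open_deriv[OF TF(1,2)]])
    moreover have "eventually (\<lambda>t. F2 (\<phi> q + t *\<^sub>R a) - Nt (F (\<phi> q + t *\<^sub>R a)) = F2 (\<phi> q) - Nt (F (\<phi> q))) (nhds 0)"
      using ev by (rule eventually_mono) (use Nt_eq at0 in simp)
    ultimately have "frechet_derivative F2 (at (\<phi> q)) a - L (frechet_derivative F (at (\<phi> q)) a) = 0"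
      by (rule derivative_zero_of_constant_direction)
    then have 3: "frechet_derivative F2 (at (\<phi> q)) a = L (?f i)" using f_eq[OF i] by (simp add: a_def)
    show ?thesis using 1 2 3 gq F2q unfolding a_def by simp
  qed
  define G where "G = (\<lambda>j. if j \<le> d then ?f j else if j = d + 1 then N q else e j)"
  have fE1: "?f j \<in> E1" "?f j \<bullet> N q = 0" if "j \<in> {1..d}" for j
    using differential_in_E1[OF c fr(4)[OF that W(1)]] normal[OF c(1) _ fr(4)[OF that W(1)], of q] c(2) inv0
    by (auto simp: frame_field_def inner_commute)
  have eQ: "x \<bullet> e j = 0" if "x \<in> E1" "j \<in> {1..D}" "\<not> j \<le> d" "j \<noteq> d + 1" for x j
    using that by (intro E1_orth pE1_e) auto
  have GG: "G i \<bullet> G j = (if i = j then 1 else 0)" if "i \<in> {1..D}" "j \<in> {1..D}" for i j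
  proof -
    have NN: "N q \<bullet> N q = 1" "N q \<in> E1" using N_unit[OF qM] N_in[OF qM] by auto
    consider "i \<le> d" | "i = d + 1" | "\<not> i \<le> d" "i \<noteq> d + 1" by blast
    then show ?thesis
    proof cases
      case 1
      then show ?thesis using that fr(5)[OF W(1)] fE1[of i] eQ[of "?f i" j] by (auto simp: G_def)
    next
      case 2
      then show ?thesis using that NN fE1[of j] eQ[of "N q" j] by (auto simp: G_def inner_commute)
    next
      case 3
      then show ?thesis using that e_inner[of i j] fE1[of j] eQ[of "?f j" i] eQ[of "N q" i] NN by (auto simp: G_def inner_commute)
    qed
  qed
  have lin: "linear L" using L(1) has_derivative_linear by blast
  have "(\<Sum>b\<in>Basis. b \<bullet> L b) = (\<Sum>j\<in>{1..D}. G j \<bullet> L (G j))"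
    by (rule trace_orthonormal[symmetric, OF _ _ GG lin]) (simp_all add: D_eq)
  also have "\<dots> = (\<Sum>j\<in>{1..d}. G j \<bullet> L (G j))"
  proof (rule sum.mono_neutral_right)
    show "\<forall>i\<in>{1..D} - {1..d}. G i \<bullet> L (G i) = 0"
      using L(2) L(3)[OF pE1_e] by (auto simp: G_def inner_commute)
  qed (use dD in auto)
  also have "\<dots> = (\<Sum>j\<in>{1..d}. ?f j \<bullet> L (?f j))" by (rule sum.cong) (auto simp: G_def)
  also have "\<dots> = - (\<Sum>i=1..d. dir_deriv (frame_field X (U, \<phi>) v i) (\<phi> q) (v i (\<phi> q)) \<bullet> N q)"
    by (simp add: summand sum_negf)
  finally show ?thesis by simp
qed

text \<open>
  Orthonormal frames exist and all of them give the same value, so the definite description in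
  the definition of the mean curvature denotes it.
\<close>

theorem mean_curvature_eq_trace:
  assumes q: "openin M O'" "q \<in> O'" and ext: "\<And>q'. q' \<in> O' \<Longrightarrow> Nt (X q') = N q'"
    and L: "(Nt has_derivative L) (at (X q))" "L (N q) \<bullet> N q = 0" "\<And>k. pE1 k = 0 \<Longrightarrow> L k \<bullet> k = 0"
  shows "mean_curvature e d A X N q = - (\<Sum>b\<in>Basis. b \<bullet> L b)"
  unfolding mean_curvature_def
proof (rule the_equality)
  have "q \<in> topspace M" using q openin_subset by blast
  then obtain U \<phi> r \<theta> s U0 where "normal_graph e D d M A X N q U \<phi> r \<theta> s U0" by (rule normal_graph_exists)
  then interpret g: normal_graph e D d M A X N q U \<phi> r \<theta> s U0 .
  obtain W v where Wv: "\<phi> q \<in> W" "local_orthonormal_frame e d X (U, \<phi>) W v" using g.frame_exists by blast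
  have "q \<in> U" using g.q0 g.U0 by blast
  from frame_sum[OF q ext L g.c this Wv] Wv g.c this
  show "\<exists>c\<in>A. \<exists>W v. q \<in> fst c \<and> snd c q \<in> W \<and> local_orthonormal_frame e d X c W v \<and>
     - (\<Sum>b\<in>Basis. b \<bullet> L b) = (\<Sum>i = 1..d. dir_deriv (frame_field X c v i) (snd c q) (v i (snd c q)) \<bullet> N q)"
    by (intro bexI[of _ "(U, \<phi>)"] exI[of _ W] exI[of _ v]) auto
next
  fix h assume "\<exists>c\<in>A. \<exists>W v. q \<in> fst c \<and> snd c q \<in> W \<and> local_orthonormal_frame e d X c W v \<and>
     h = (\<Sum>i = 1..d. dir_deriv (frame_field X c v i) (snd c q) (v i (snd c q)) \<bullet> N q)"
  then obtain U \<phi> W v where *: "(U, \<phi>) \<in> A" "q \<in> U" "\<phi> q \<in> W" "local_orthonormal_frame e d X (U, \<phi>) W v"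
    "h = (\<Sum>i = 1..d. dir_deriv (frame_field X (U, \<phi>) v i) (\<phi> q) (v i (\<phi> q)) \<bullet> N q)" by auto
  then show "h = - (\<Sum>b\<in>Basis. b \<bullet> L b)" using frame_sum[OF q ext L *(1-4)] by simp
qed

end

context normal_graph
begin

text \<open>
  These are the integrated forms of the conditions on the derivatives along the normal.
\<close>

lemma vertical_shift:
  assumes z: "z \<in> V" "z + a *\<^sub>R \<nu> \<in> V"
  shows "\<theta> (z + a *\<^sub>R \<nu>) = \<theta> z" "s (z + a *\<^sub>R \<nu>) = s z + a"
proof -
  show "\<theta> (z + a *\<^sub>R \<nu>) = \<theta> z"
  proof (rule euclidean_eqI)
    fix b :: 'a
    have "\<theta> (z + a *\<^sub>R \<nu>) \<bullet> b = \<theta> z \<bullet> b + 0"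
    proof (rule constant_directional_derivative[OF _ convex_ball z])
      show "smooth_open V (\<lambda>z. \<theta> z \<bullet> b)" by (rule smooth_open_linear[OF bounded_linear_inner_left smooth_\<theta>])
      fix y assume y: "y \<in> V"
      have "frechet_derivative (\<lambda>z. \<theta> z \<bullet> b) (at y) (a *\<^sub>R \<nu>) = frechet_derivative \<theta> (at y) (a *\<^sub>R \<nu>) \<bullet> b"
        by (rule frechet_derivative_eqI[OF bounded_linear.has_derivative[OF bounded_linear_inner_left smooth_open_deriv[OF smooth_\<theta> y]]])
      then show "frechet_derivative (\<lambda>z. \<theta> z \<bullet> b) (at y) (a *\<^sub>R \<nu>) = 0"
        using linear_scale[OF smooth_open_linear_deriv[OF smooth_\<theta> y]] D_normal(1)[OF y] by simp
    qed
    then show "\<theta> (z + a *\<^sub>R \<nu>) \<bullet> b = \<theta> z \<bullet> b" by simp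
  qed
  show "s (z + a *\<^sub>R \<nu>) = s z + a"
    by (rule constant_directional_derivative[OF smooth_s convex_ball z])
       (use linear_scale[OF smooth_open_linear_deriv[OF smooth_s]] D_normal(2) in simp)
qed

lemma DNt_shift:
  assumes z: "z \<in> V" "z + a *\<^sub>R \<nu> \<in> V"
  shows "frechet_derivative Nt (at (z + a *\<^sub>R \<nu>)) = frechet_derivative Nt (at z)"
proof -
  have "((\<lambda>y. y + a *\<^sub>R \<nu>) has_derivative (\<lambda>h. h + 0)) (at z)"
    by (rule has_derivative_add[OF has_derivative_ident has_derivative_const])
  then have "((\<lambda>y. Nt (y + a *\<^sub>R \<nu>)) has_derivative (\<lambda>h. frechet_derivative Nt (at (z + a *\<^sub>R \<nu>)) (h + 0))) (at z)"
    by (rule has_derivative_compose[where g=Nt]) (rule smooth_open_deriv[OF smooth_Nt z(2)])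
  moreover have "open (V \<inter> (\<lambda>y. y + a *\<^sub>R \<nu>) -` V)"
    by (intro continuous_open_preimage open_ball continuous_intros)
  ultimately have "(Nt has_derivative (\<lambda>h. frechet_derivative Nt (at (z + a *\<^sub>R \<nu>)) (h + 0))) (at z)"
    by (rule has_derivative_transform_within_open) (use z vertical_shift(1) in \<open>auto simp: Nt_def \<kappa>_def\<close>)
  then have "(Nt has_derivative (frechet_derivative Nt (at (z + a *\<^sub>R \<nu>)))) (at z)" by simp
  then show ?thesis using frechet_derivative_at by blast
qed

lemma projection_in_U0:
  assumes z: "z \<in> V" "pE1 z = z" "X (\<kappa> z) \<in> V"
  shows "\<kappa> z \<in> U0" "X (\<kappa> z) = z + (- s z) *\<^sub>R \<nu>"
proof -
  let ?y = "X (\<kappa> z)"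
  show y: "?y = z + (- s z) *\<^sub>R \<nu>" using X_\<kappa>[OF z(1)] z(2) by simp
  have zV: "z + (- s z) *\<^sub>R \<nu> \<in> V" using z(3) y by simp
  have sy: "s ?y = 0" using vertical_shift(2)[OF z(1) zV] y by simp
  have "\<theta> ?y = \<theta> z" using vertical_shift(1)[OF z(1) zV] y by simp
  then have ky: "\<kappa> ?y = \<kappa> z" by (simp add: \<kappa>_def)
  have "pE1 ?y = ?y" by (rule pE1_id[OF X_in[OF \<kappa>_in[OF z(1)]]])
  then show "\<kappa> z \<in> U0" using \<kappa>_in_U0[OF z(3) _ sy] ky by simp
qed

text \<open>
  The formula holds on a whole neighbourhood of the centre, also off the hypersurface, because
  \<open>Nt\<close> is constant along \<open>\<nu>\<close>. This is what makes it possible to differentiate the mean curvature as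
  an ordinary function.
\<close>

lemma mean_curvature_eq_divergence:
  assumes z: "z \<in> V" "pE1 z = z" "X (\<kappa> z) \<in> V"
  shows "mean_curvature e d A X N (\<kappa> z) = - (\<Sum>b\<in>Basis. frechet_derivative Nt (at z) b \<bullet> b)"
proof -
  let ?y = "X (\<kappa> z)"
  note U0y = projection_in_U0(1)[OF z] and y = projection_in_U0(2)[OF z]
  have ky: "\<kappa> ?y = \<kappa> z" by (rule \<kappa>_X[OF U0y])
  have zV: "z + (- s z) *\<^sub>R \<nu> \<in> V" using z(3) y by simp
  have D: "frechet_derivative Nt (at ?y) = frechet_derivative Nt (at z)" using DNt_shift[OF z(1) zV] y by simp
  have "mean_curvature e d A X N (\<kappa> z) = - (\<Sum>b\<in>Basis. b \<bullet> frechet_derivative Nt (at ?y) b)"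
  proof (rule mean_curvature_eq_trace[OF U0(1) U0y Nt_X smooth_open_deriv[OF smooth_Nt z(3)]])
    show "frechet_derivative Nt (at ?y) (N (\<kappa> z)) \<bullet> N (\<kappa> z) = 0"
      using DNt_orthogonal[OF z(3), of "N (\<kappa> z)"] ky by (simp add: Nt_def)
    show "frechet_derivative Nt (at ?y) k \<bullet> k = 0" if "pE1 k = 0" for k
      using DNt_vertical(2)[OF z(3) that] by simp
  qed
  then show ?thesis by (simp add: D inner_commute)
qed

end

section \<open>The Jacobi equation of the height functions\<close>

locale codimension_one = immersed_hypersurface e D d M A X N
  for e :: "nat \<Rightarrow> 'a::euclidean_space" and D d and M :: "'m topology" and A X N +
  assumes full: "D = d + 1"
begin

lemma pE1_full: "pE1 x = x"
  using coord_proj_all full by simp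

end

locale weighted_hypersurface = codimension_one e D d M A X N
  for e :: "nat \<Rightarrow> 'a::euclidean_space" and D d and M :: "'m topology" and A X N +
  fixes lam :: real
  assumes weighted: "const_weighted_mean_curvature e d M A X N lam"
begin

lemma mean_curvature_weighted:
  "q \<in> topspace M \<Longrightarrow> mean_curvature e d A X N q = lam - (1/2) * (X q \<bullet> N q)"
  using weighted unfolding const_weighted_mean_curvature_def by force

end

text \<open>
  Second derivatives are taken at the centre \<open>z0 = X q0\<close>; there the trace of \<open>D2 (f \<circ> \<kappa>)\<close> over the
  standard basis is the Laplacian of \<open>f\<close> at \<open>q0\<close>.
\<close>

locale weighted_graph = normal_graph e D d M A X N q0 U \<phi> r \<theta> s U0 + weighted_hypersurface e D d M A X N lam
  for e :: "nat \<Rightarrow> 'a::euclidean_space" and D d and M :: "'m topology" and A X N and q0 U \<phi> r \<theta> s U0 lam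
begin

abbreviation "z0 \<equiv> X q0"

abbreviation "DN \<equiv> frechet_derivative Nt (at z0)"

abbreviation "D2 f a b \<equiv> frechet_derivative (\<lambda>y. frechet_derivative f (at y) a) (at z0) b"

text \<open>
  The squared length of the second fundamental form at \<open>q0\<close>: up to sign \<open>DN\<close> is the shape operator,
  extended by \<open>0\<close> to the normal direction.
\<close>

definition "A2 = (\<Sum>b\<in>Basis. DN b \<bullet> DN b)"

definition "height a z = Nt z \<bullet> a"

lemma z0: "z0 \<in> V" by (rule center)

lemma Ds_z0: "frechet_derivative s (at z0) v = \<nu> \<bullet> v"
  using Nt_gradient[OF z0, of v] center(4) \<nu>_facts(2) by simp

lemma smooth_height: "smooth_open V (height a)"
  unfolding height_def[abs_def] by (rule smooth_open_linear[OF bounded_linear_inner_left smooth_Nt])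

lemma D_height: "z \<in> V \<Longrightarrow> frechet_derivative (height a) (at z) v = frechet_derivative Nt (at z) v \<bullet> a"
  unfolding height_def[abs_def]
  by (rule frechet_derivative_eqI[OF bounded_linear.has_derivative[OF bounded_linear_inner_left smooth_open_deriv[OF smooth_Nt]]])

lemma D2_cong: 
  assumes "\<And>z. z \<in> V \<Longrightarrow> frechet_derivative f (at z) a = g z" "smooth_open V f"
  shows "D2 f a b = frechet_derivative g (at z0) b"
  using frechet_derivative_cong[OF open_ball z0 assms(1) smooth_open_differentiable[OF smooth_open_directional[OF assms(2)] z0]]
  by simp

text \<open>
  The divergence of \<open>Nt\<close> is \<open>1/2 X \<bullet> N - lam\<close> along the graph. In its derivative the term with the
  derivative of \<open>X\<close> drops out, because this derivative is tangent.
\<close>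

lemma divergence_derivative:
  "frechet_derivative (\<lambda>z. \<Sum>b\<in>Basis. frechet_derivative Nt (at z) b \<bullet> b) (at z0) v = (1/2) * (z0 \<bullet> DN v)"
  and divergence_z0: "(\<Sum>b\<in>Basis. DN b \<bullet> b) = (1/2) * (z0 \<bullet> \<nu>) - lam"
proof -
  let ?\<rho> = "\<lambda>z. X (\<kappa> z)"
  have s\<rho>: "smooth_open V ?\<rho>" by (rule smooth_along[OF manifold(4)])
  \<comment> \<open>for \<open>z\<close> near the centre the point below \<open>z\<close> lies in the ball again\<close>
  define V1 where "V1 = V \<inter> ?\<rho> -` V"
  have V1: "open V1" unfolding V1_def
    by (rule continuous_open_preimage[OF smooth_open_continuous[OF s\<rho>] open_ball open_ball])
  have z01: "z0 \<in> V1" using z0 center(3) by (simp add: V1_def)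
  have eq: "(\<Sum>b\<in>Basis. frechet_derivative Nt (at z) b \<bullet> b) = (1/2) * (?\<rho> z \<bullet> Nt z) - lam" if "z \<in> V1" for z
    using mean_curvature_eq_divergence[OF _ pE1_full, of z] mean_curvature_weighted[OF \<kappa>_in, of z] that
    by (simp add: V1_def Nt_def)
  show "(\<Sum>b\<in>Basis. DN b \<bullet> b) = (1/2) * (z0 \<bullet> \<nu>) - lam"
    using eq[OF z01] center by simp
  have "((\<lambda>z. (1/2) * (?\<rho> z \<bullet> Nt z) - lam) has_derivative
     (\<lambda>v. (1/2) * (?\<rho> z0 \<bullet> DN v + (pE1 v - frechet_derivative s (at z0) v *\<^sub>R \<nu>) \<bullet> Nt z0) - 0)) (at z0)"
    by (rule has_derivative_diff[OF has_derivative_mult_right[OF has_derivative_inner[OF has_derivative_X\<kappa>[OF z0] smooth_open_deriv[OF smooth_Nt z0]]] has_derivative_const])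
  then have "((\<lambda>z. \<Sum>b\<in>Basis. frechet_derivative Nt (at z) b \<bullet> b) has_derivative
     (\<lambda>v. (1/2) * (?\<rho> z0 \<bullet> DN v + (pE1 v - frechet_derivative s (at z0) v *\<^sub>R \<nu>) \<bullet> Nt z0) - 0)) (at z0)"
    by (rule has_derivative_transform_within_open[OF _ V1 z01]) (rule eq[symmetric])
  from frechet_derivative_eqI[OF this, of v]
  show "frechet_derivative (\<lambda>z. \<Sum>b\<in>Basis. frechet_derivative Nt (at z) b \<bullet> b) (at z0) v = (1/2) * (z0 \<bullet> DN v)"
    using \<nu>_facts(2) by (simp add: center Ds_z0 pE1_full inner_diff_left inner_diff_right inner_commute)
qed

text \<open>
  With \<open>\<omega> = height \<nu>\<close> the gradient relation reads \<open>Nt = \<omega> \<nabla>s\<close>; this is its derivative.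
\<close>

lemma D_height_product:
  assumes z: "z \<in> V"
  shows "frechet_derivative (height a) (at z) v =
    frechet_derivative s (at z) a * frechet_derivative (height \<nu>) (at z) v +
    frechet_derivative (\<lambda>y. frechet_derivative s (at y) a) (at z) v * height \<nu> z"
proof -
  have "((\<lambda>z. frechet_derivative s (at z) a * height \<nu> z) has_derivative
     (\<lambda>v. frechet_derivative s (at z) a * frechet_derivative (height \<nu>) (at z) v +
      frechet_derivative (\<lambda>y. frechet_derivative s (at y) a) (at z) v * height \<nu> z)) (at z)"
    by (rule has_derivative_mult[OF smooth_open_deriv[OF smooth_open_directional[OF smooth_s] z] smooth_open_deriv[OF smooth_height z]])
  then have "(height a has_derivative
     (\<lambda>v. frechet_derivative s (at z) a * frechet_derivative (height \<nu>) (at z) v +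
      frechet_derivative (\<lambda>y. frechet_derivative s (at y) a) (at z) v * height \<nu> z)) (at z)"
    by (rule has_derivative_transform_within_open[OF _ open_ball z]) (simp only: height_def Nt_gradient[of _ a])
  then show ?thesis by (rule frechet_derivative_eqI)
qed

lemma D\<omega>_z0: "frechet_derivative (height \<nu>) (at z0) v = 0"
  using D_height[OF z0] DNt_orthogonal[OF z0, of v] center(4) by simp

lemma DN_eq_D2s: "DN v \<bullet> a = D2 s a v"
  using D_height[OF z0, of a v] D_height_product[OF z0, of a v] D\<omega>_z0[of v] center(4) \<nu>_facts(2) by (simp add: height_def)

lemma DN_symmetric: "DN v \<bullet> a = DN a \<bullet> v"
  using DN_eq_D2s second_derivative_symmetric[OF smooth_s z0] by simp

lemma D2_height:
  "D2 (height a) v w = frechet_derivative (\<lambda>z. frechet_derivative (\<lambda>y. frechet_derivative s (at y) a) (at z) v) (at z0) w + (\<nu> \<bullet> a) * D2 (height \<nu>) v w"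
proof -
  let ?sav = "\<lambda>z. frechet_derivative (\<lambda>y. frechet_derivative s (at y) a) (at z) v"
  have "((\<lambda>z. frechet_derivative s (at z) a * frechet_derivative (height \<nu>) (at z) v + ?sav z * height \<nu> z) has_derivative
    (\<lambda>w. (frechet_derivative s (at z0) a * D2 (height \<nu>) v w + D2 s a w * frechet_derivative (height \<nu>) (at z0) v)
       + (?sav z0 * frechet_derivative (height \<nu>) (at z0) w + frechet_derivative ?sav (at z0) w * height \<nu> z0))) (at z0)"
    by (intro has_derivative_add has_derivative_mult smooth_open_deriv[OF _ z0] smooth_open_directional smooth_s smooth_height)
  from frechet_derivative_eqI[OF this, of w]
  have "frechet_derivative (\<lambda>z. frechet_derivative s (at z) a * frechet_derivative (height \<nu>) (at z) v + ?sav z * height \<nu> z) (at z0) w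
     = (\<nu> \<bullet> a) * D2 (height \<nu>) v w + frechet_derivative ?sav (at z0) w"
    using center(4) \<nu>_facts(2) by (simp add: D\<omega>_z0 Ds_z0 height_def)
  then show ?thesis using D2_cong[OF D_height_product smooth_height, of a v w] by simp
qed

text \<open>
  The Codazzi equation. By the second derivative of \<open>Nt = \<omega> \<nabla>s\<close>, where \<open>\<omega>\<close> is stationary at the
  centre, both sides equal a third derivative of \<open>s\<close>, and these are symmetric.
\<close>

lemma D2_exchange: "D2 (height a) v w - (\<nu> \<bullet> a) * D2 (height \<nu>) v w = D2 (height v) a w - (\<nu> \<bullet> v) * D2 (height \<nu>) a w"
proof -
  have "frechet_derivative (\<lambda>z. frechet_derivative (\<lambda>y. frechet_derivative s (at y) a) (at z) v) (at z0)
      = frechet_derivative (\<lambda>z. frechet_derivative (\<lambda>y. frechet_derivative s (at y) v) (at z) a) (at z0)"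
    by (rule frechet_derivative_cong[OF open_ball z0 second_derivative_symmetric[OF smooth_s]
          smooth_open_differentiable[OF smooth_open_directional[OF smooth_open_directional[OF smooth_s]] z0]])
  then show ?thesis using D2_height[of a v w] D2_height[of v a w] by simp
qed

text \<open>
  Differentiate \<open>|Nt|\<^sup>2 = 1\<close> twice.
\<close>

lemma D2_\<omega>: "D2 (height \<nu>) v w = - (DN v \<bullet> DN w)"
proof -
  let ?Nv = "\<lambda>z. frechet_derivative Nt (at z) v"
  have d: "(?Nv has_derivative frechet_derivative ?Nv (at z0)) (at z0)"
    by (rule smooth_open_deriv[OF smooth_open_directional[OF smooth_Nt] z0])
  have "((\<lambda>z. ?Nv z \<bullet> Nt z) has_derivative (\<lambda>w. ?Nv z0 \<bullet> DN w + frechet_derivative ?Nv (at z0) w \<bullet> Nt z0)) (at z0)"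
    by (rule has_derivative_inner[OF d smooth_open_deriv[OF smooth_Nt z0]])
  moreover have "eventually (\<lambda>t. ?Nv (z0 + t *\<^sub>R w) \<bullet> Nt (z0 + t *\<^sub>R w) = ?Nv z0 \<bullet> Nt z0) (nhds 0)"
    using eventually_line_in_open[OF open_ball z0, of w] by (rule eventually_mono) (use DNt_orthogonal z0 in simp)
  ultimately have 1: "?Nv z0 \<bullet> DN w + frechet_derivative ?Nv (at z0) w \<bullet> Nt z0 = 0"
    by (rule derivative_zero_of_constant_direction)
  have "D2 (height \<nu>) v w = frechet_derivative (\<lambda>z. ?Nv z \<bullet> \<nu>) (at z0) w"
    by (rule D2_cong[OF D_height smooth_height])
  also have "\<dots> = frechet_derivative ?Nv (at z0) w \<bullet> \<nu>"
    by (rule frechet_derivative_eqI[OF bounded_linear.has_derivative[OF bounded_linear_inner_left d]])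
  finally show ?thesis using 1 center(4) by simp
qed

text \<open>
  The trace of the Codazzi equation: the Laplacian of \<open>Nt \<bullet> a\<close> is the derivative along \<open>a\<close> of the
  divergence of \<open>Nt\<close>, plus the Laplacian \<open>- A2\<close> of \<open>\<omega>\<close> times \<open>\<nu> \<bullet> a\<close>. The curvature equation turns the
  former into the drift term, which becomes \<open>1/2 DN z0 \<bullet> a\<close> by the symmetry of \<open>DN\<close>.
\<close>

theorem Jacobi_equation: "(\<Sum>b\<in>Basis. D2 (height a) b b) = (1/2) * (DN z0 \<bullet> a) - A2 * (\<nu> \<bullet> a)"
proof -
  have 1: "D2 (height a) b b = D2 (height b) b a - (\<nu> \<bullet> b) * D2 (height \<nu>) a b + (\<nu> \<bullet> a) * D2 (height \<nu>) b b" for b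
    using D2_exchange[of a b b] second_derivative_symmetric[OF smooth_height z0, of b a b] by simp
  have smb: "smooth_open V (\<lambda>z. frechet_derivative Nt (at z) b \<bullet> b)" for b
    by (rule smooth_open_linear[OF bounded_linear_inner_left smooth_open_directional[OF smooth_Nt]])
  have "(\<Sum>b\<in>Basis. D2 (height b) b a) = (\<Sum>b\<in>Basis. frechet_derivative (\<lambda>z. frechet_derivative Nt (at z) b \<bullet> b) (at z0) a)"
    by (intro sum.cong refl D2_cong D_height smooth_height)
  also have "\<dots> = frechet_derivative (\<lambda>z. \<Sum>b\<in>Basis. frechet_derivative Nt (at z) b \<bullet> b) (at z0) a"
    by (rule frechet_derivative_eqI[OF has_derivative_sum[OF smooth_open_deriv[OF smb z0]], symmetric])
  also have "\<dots> = (1/2) * (DN z0 \<bullet> a)" using divergence_derivative[of a] DN_symmetric[of a z0] by (simp add: inner_commute)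
  finally have 2: "(\<Sum>b\<in>Basis. D2 (height b) b a) = (1/2) * (DN z0 \<bullet> a)" .
  have lin: "linear DN" by (rule smooth_open_linear_deriv[OF smooth_Nt z0])
  have "(\<Sum>b\<in>Basis. (\<nu> \<bullet> b) * D2 (height \<nu>) a b) = - (DN a \<bullet> (\<Sum>b\<in>Basis. (\<nu> \<bullet> b) *\<^sub>R DN b))"
    by (simp add: D2_\<omega> inner_sum_right sum_negf)
  also have "(\<Sum>b\<in>Basis. (\<nu> \<bullet> b) *\<^sub>R DN b) = DN \<nu>" using linear_expand[OF lin, of \<nu>] by simp
  finally have 3: "(\<Sum>b\<in>Basis. (\<nu> \<bullet> b) * D2 (height \<nu>) a b) = 0" using DNt_vertical(1)[OF z0] by simp
  have 4: "(\<Sum>b\<in>Basis. (\<nu> \<bullet> a) * D2 (height \<nu>) b b) = - A2 * (\<nu> \<bullet> a)"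
    by (simp add: D2_\<omega> A2_def sum_negf sum_distrib_left sum_distrib_right mult.commute)
  have "(\<Sum>b\<in>Basis. D2 (height a) b b) = (\<Sum>b\<in>Basis. D2 (height b) b a) - (\<Sum>b\<in>Basis. (\<nu> \<bullet> b) * D2 (height \<nu>) a b) + (\<Sum>b\<in>Basis. (\<nu> \<bullet> a) * D2 (height \<nu>) b b)"
    by (simp only: 1 sum.distrib sum_subtractf)
  then show ?thesis using 2 3 4 by simp
qed

definition "sq_dist p z = (X (\<kappa> z) - p) \<bullet> (X (\<kappa> z) - p)"

lemma smooth_X\<kappa>: "smooth_open V (\<lambda>z. X (\<kappa> z))"
  by (rule smooth_along[OF manifold(4)])

lemma smooth_sq_dist: "smooth_open V (sq_dist p)"
  unfolding sq_dist_def[abs_def] by (intro smooth_open_inner smooth_open_diff smooth_open_const smooth_X\<kappa> open_ball)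

lemma D_sq_dist:
  assumes z: "z \<in> V"
  shows "frechet_derivative (sq_dist p) (at z) v = 2 * ((X (\<kappa> z) - p) \<bullet> (v - frechet_derivative s (at z) v *\<^sub>R \<nu>))"
proof -
  have d: "((\<lambda>z. X (\<kappa> z) - p) has_derivative (\<lambda>v. (pE1 v - frechet_derivative s (at z) v *\<^sub>R \<nu>) - 0)) (at z)"
    by (rule has_derivative_diff[OF has_derivative_X\<kappa>[OF z] has_derivative_const])
  from frechet_derivative_eqI[OF has_derivative_inner[OF d d], of v]
  show ?thesis by (simp add: sq_dist_def[abs_def] pE1_full inner_commute)
qed

lemma D2_sq_dist:
  "D2 (sq_dist p) v v = 2 * ((v - (\<nu> \<bullet> v) *\<^sub>R \<nu>) \<bullet> (v - (\<nu> \<bullet> v) *\<^sub>R \<nu>)) - 2 * ((z0 - p) \<bullet> \<nu>) * (DN v \<bullet> v)"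
proof -
  let ?sv = "\<lambda>z. frechet_derivative s (at z) v"
  have d1: "((\<lambda>z. X (\<kappa> z) - p) has_derivative (\<lambda>v. (pE1 v - frechet_derivative s (at z0) v *\<^sub>R \<nu>) - 0)) (at z0)"
    by (rule has_derivative_diff[OF has_derivative_X\<kappa>[OF z0] has_derivative_const])
  have d2: "((\<lambda>z. v - ?sv z *\<^sub>R \<nu>) has_derivative (\<lambda>w. 0 - D2 s v w *\<^sub>R \<nu>)) (at z0)"
    by (rule has_derivative_diff[OF has_derivative_const
          bounded_linear.has_derivative[OF bounded_linear_scaleR_left smooth_open_deriv[OF smooth_open_directional[OF smooth_s] z0]]])
  have "D2 (sq_dist p) v v = frechet_derivative (\<lambda>z. 2 * ((X (\<kappa> z) - p) \<bullet> (v - ?sv z *\<^sub>R \<nu>))) (at z0) v"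
    by (rule D2_cong[OF D_sq_dist smooth_sq_dist])
  also have "\<dots> = 2 * ((X (\<kappa> z0) - p) \<bullet> (0 - D2 s v v *\<^sub>R \<nu>) + ((pE1 v - frechet_derivative s (at z0) v *\<^sub>R \<nu>) - 0) \<bullet> (v - ?sv z0 *\<^sub>R \<nu>))"
    by (rule frechet_derivative_eqI[OF has_derivative_mult_right[OF has_derivative_inner[OF d1 d2]]])
  finally have "D2 (sq_dist p) v v = 2 * ((z0 - p) \<bullet> (0 - D2 s v v *\<^sub>R \<nu>) + (v - (\<nu> \<bullet> v) *\<^sub>R \<nu>) \<bullet> (v - (\<nu> \<bullet> v) *\<^sub>R \<nu>))"
    by (simp add: center Ds_z0 pE1_full)
  then show ?thesis by (simp add: DN_eq_D2s algebra_simps)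
qed

text \<open>
  The tangent plane contributes \<open>2 d\<close>, and the bending of the graph contributes twice the mean
  curvature times the normal component of \<open>z0 - p\<close>.
\<close>

lemma Laplacian_sq_dist:
  "(\<Sum>b\<in>Basis. D2 (sq_dist p) b b) = 2 * real d + 2 * (lam - (1/2) * (z0 \<bullet> \<nu>)) * ((z0 - p) \<bullet> \<nu>)"
proof -
  have "(b - (\<nu> \<bullet> b) *\<^sub>R \<nu>) \<bullet> (b - (\<nu> \<bullet> b) *\<^sub>R \<nu>) = 1 - (\<nu> \<bullet> b) * (\<nu> \<bullet> b)" if "b \<in> Basis" for b
    using that \<nu>_facts(2) by (simp add: inner_diff_left inner_diff_right inner_commute)
  then have "(\<Sum>b\<in>Basis. D2 (sq_dist p) b b) = (\<Sum>b\<in>Basis. 2 - 2 * ((\<nu> \<bullet> b) * (\<nu> \<bullet> b)) - 2 * ((z0 - p) \<bullet> \<nu>) * (DN b \<bullet> b))"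
    by (intro sum.cong refl) (simp add: D2_sq_dist)
  also have "\<dots> = 2 * real (DIM('a)) - 2 * (\<Sum>b\<in>Basis. (\<nu> \<bullet> b) * (\<nu> \<bullet> b)) - 2 * ((z0 - p) \<bullet> \<nu>) * (\<Sum>b\<in>Basis. DN b \<bullet> b)"
    by (simp add: sum_subtractf sum_distrib_left)
  also have "(\<Sum>b\<in>Basis. (\<nu> \<bullet> b) * (\<nu> \<bullet> b)) = 1" using euclidean_inner[of \<nu> \<nu>] \<nu>_facts(2) by simp
  also have "real (DIM('a)) = real d + 1" using full D_eq by simp
  finally show ?thesis by (simp add: divergence_z0 algebra_simps)
qed

text \<open>
  At a minimum of \<open>N \<bullet> a - \<psi> 0 (|X - p|\<^sup>2)\<close> the two gradients agree, and so do the drift terms, while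
  the Laplacian of the difference is nonnegative. By the Jacobi equation the drift Laplacian of
  \<open>\<psi> 0 (|X - p|\<^sup>2)\<close> is then at most \<open>- A2 (N \<bullet> a)\<close>; the statement writes it out, with \<open>\<psi> j\<close> for the
  \<open>j\<close>-th derivative of \<open>\<psi> 0\<close>.
\<close>

theorem minimum_inequality:
  fixes \<psi> :: "nat \<Rightarrow> real \<Rightarrow> real"
  assumes \<psi>: "\<And>j t. (\<psi> j has_real_derivative \<psi> (Suc j) t) (at t)"
    and O': "openin M O'" "q0 \<in> O'"
    and min: "\<And>q. q \<in> O' \<Longrightarrow> N q0 \<bullet> a - \<psi> 0 ((X q0 - p) \<bullet> (X q0 - p)) \<le> N q \<bullet> a - \<psi> 0 ((X q - p) \<bullet> (X q - p))"
  defines "w \<equiv> X q0 - p" and "t \<equiv> (X q0 - p) \<bullet> (X q0 - p)"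
  shows "4 * \<psi> 2 t * (w \<bullet> w - (w \<bullet> N q0)\<^sup>2) + \<psi> 1 t * (2 * real d + 2 * (lam - (1/2) * (X q0 \<bullet> N q0)) * (w \<bullet> N q0))
      + A2 * (N q0 \<bullet> a) \<le> \<psi> 1 t * (w \<bullet> X q0 - (w \<bullet> N q0) * (X q0 \<bullet> N q0))"
proof -
  define g where "g = (\<lambda>z. height a z - \<psi> 0 (sq_dist p z))"
  have comp: "smooth_open V (\<lambda>z. \<psi> j (sq_dist p z))" for j
    using smooth_open_real_compose[OF smooth_sq_dist, of UNIV "\<lambda>i. \<psi> (i + j)"] \<psi> by auto
  have Dcomp: "((\<lambda>z. \<psi> j (sq_dist p z)) has_derivative (\<lambda>v. \<psi> (Suc j) (sq_dist p z) * frechet_derivative (sq_dist p) (at z) v)) (at z)" if "z \<in> V" for j z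
    using has_derivative_compose[OF smooth_open_deriv[OF smooth_sq_dist that] \<psi>[unfolded has_field_derivative_def]] .
  have sg: "smooth_open V g" unfolding g_def by (rule smooth_open_diff[OF smooth_height comp])
  have Dg: "frechet_derivative g (at z) v = frechet_derivative (height a) (at z) v - \<psi> 1 (sq_dist p z) * frechet_derivative (sq_dist p) (at z) v" if "z \<in> V" for z v
    unfolding g_def using frechet_derivative_eqI[OF has_derivative_diff[OF smooth_open_deriv[OF smooth_height that] Dcomp[OF that, of 0]]] by (simp add: One_nat_def)
  have D2g: "D2 g v v = D2 (height a) v v - (\<psi> 1 t * D2 (sq_dist p) v v + \<psi> 2 t * (frechet_derivative (sq_dist p) (at z0) v)\<^sup>2)" for v
  proof -
    have "D2 g v v = frechet_derivative (\<lambda>z. frechet_derivative (height a) (at z) v - \<psi> 1 (sq_dist p z) * frechet_derivative (sq_dist p) (at z) v) (at z0) v"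
      by (rule D2_cong[OF Dg sg])
    also have "\<dots> = D2 (height a) v v - (\<psi> 1 (sq_dist p z0) * D2 (sq_dist p) v v + (\<psi> (Suc 1) (sq_dist p z0) * frechet_derivative (sq_dist p) (at z0) v) * frechet_derivative (sq_dist p) (at z0) v)"
      by (rule frechet_derivative_eqI[OF has_derivative_diff[OF smooth_open_deriv[OF smooth_open_directional[OF smooth_height] z0]
            has_derivative_mult[OF Dcomp[OF z0] smooth_open_deriv[OF smooth_open_directional[OF smooth_sq_dist] z0]]]])
    finally show ?thesis by (simp add: t_def sq_dist_def center numeral_2_eq_2 One_nat_def power2_eq_square)
  qed
  have "openin (top_of_set V) {z \<in> topspace (top_of_set V). \<kappa> z \<in> O'}"
    using continuous_\<kappa> O'(1) by (rule openin_continuous_map_preimage)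
  then have Dop: "open {z \<in> V. \<kappa> z \<in> O'}" by (simp add: openin_open_eq)
  have gmin: "g z0 \<le> g z" if "z \<in> {z \<in> V. \<kappa> z \<in> O'}" for z
    using min[of "\<kappa> z"] that by (simp add: g_def height_def Nt_def sq_dist_def center)
  have z0D: "z0 \<in> {z \<in> V. \<kappa> z \<in> O'}" using z0 O'(2) center by simp
  note lm = local_minimum_derivatives[OF sg z0 Dop z0D gmin]
  have first: "frechet_derivative (height a) (at z0) v = \<psi> 1 t * frechet_derivative (sq_dist p) (at z0) v" for v
    using lm(1)[of v] Dg[OF z0, of v] by (simp add: t_def sq_dist_def center)
  have "0 \<le> (\<Sum>b\<in>Basis. D2 g b b)" by (rule sum_nonneg) (use lm(2) in blast)
  also have "\<dots> = (\<Sum>b\<in>Basis. D2 (height a) b b) - (\<psi> 1 t * (\<Sum>b\<in>Basis. D2 (sq_dist p) b b) + \<psi> 2 t * (\<Sum>b\<in>Basis. (frechet_derivative (sq_dist p) (at z0) b)\<^sup>2))"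
    by (simp add: D2g sum_subtractf sum.distrib sum_distrib_left)
  finally have main: "\<psi> 1 t * (\<Sum>b\<in>Basis. D2 (sq_dist p) b b) + \<psi> 2 t * (\<Sum>b\<in>Basis. (frechet_derivative (sq_dist p) (at z0) b)\<^sup>2) \<le> (1/2) * (DN z0 \<bullet> a) - A2 * (\<nu> \<bullet> a)"
    using Jacobi_equation[of a] by linarith
  define wT where "wT = w - (w \<bullet> \<nu>) *\<^sub>R \<nu>"
  have Dr: "frechet_derivative (sq_dist p) (at z0) v = 2 * (wT \<bullet> v)" for v
    using D_sq_dist[OF z0, of p v] by (simp add: center Ds_z0 wT_def w_def inner_diff_left inner_diff_right algebra_simps)
  have wT2: "wT \<bullet> wT = w \<bullet> w - (w \<bullet> \<nu>)\<^sup>2"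
    using \<nu>_facts(2) by (simp add: wT_def inner_diff_left inner_diff_right inner_commute power2_eq_square)
  have "(\<Sum>b\<in>Basis. (frechet_derivative (sq_dist p) (at z0) b)\<^sup>2) = 4 * (\<Sum>b\<in>Basis. (wT \<bullet> b) * (wT \<bullet> b))"
    by (simp add: Dr sum_distrib_left power2_eq_square mult_ac)
  also have "\<dots> = 4 * (w \<bullet> w - (w \<bullet> \<nu>)\<^sup>2)" using euclidean_inner[of wT wT] wT2 by simp
  finally have sq: "(\<Sum>b\<in>Basis. (frechet_derivative (sq_dist p) (at z0) b)\<^sup>2) = 4 * (w \<bullet> w - (w \<bullet> \<nu>)\<^sup>2)" .
  have "DN z0 \<bullet> a = \<psi> 1 t * (2 * (wT \<bullet> z0))" using first[of z0] D_height[OF z0, of a z0] Dr by simp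
  moreover have "wT \<bullet> z0 = w \<bullet> z0 - (w \<bullet> \<nu>) * (z0 \<bullet> \<nu>)" by (simp add: wT_def inner_diff_left inner_commute[of \<nu> z0])
  ultimately have drift: "(1/2) * (DN z0 \<bullet> a) = \<psi> 1 t * (w \<bullet> z0 - (w \<bullet> \<nu>) * (z0 \<bullet> \<nu>))" by simp
  show ?thesis using main unfolding sq drift Laplacian_sq_dist w_def[symmetric] by (simp add: algebra_simps)
qed

end

context weighted_hypersurface
begin

lemma weighted_graph_exists:
  assumes "q0 \<in> topspace M"
  obtains U \<phi> r \<theta> s U0 where "weighted_graph e D d M A X N q0 U \<phi> r \<theta> s U0 lam"
proof -
  obtain U \<phi> r \<theta> s U0 where "normal_graph e D d M A X N q0 U \<phi> r \<theta> s U0"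
    using normal_graph_exists[OF assms] .
  then have "weighted_graph e D d M A X N q0 U \<phi> r \<theta> s U0 lam"
    by (intro weighted_graph.intro weighted_hypersurface_axioms)
  then show ?thesis using that by blast
qed

section \<open>The maximum principle for the drift Laplacian\<close>

text \<open>
  For a nonnegative height the curvature term has a sign. In this form the inequality says that
  no function of \<open>|X - p|\<^sup>2\<close> with positive drift Laplacian touches a nonnegative height from below, even after a constant is added to it.
\<close>

lemma superharmonic_test:
  fixes \<psi> :: "nat \<Rightarrow> real \<Rightarrow> real"
  assumes \<psi>: "\<And>j t. (\<psi> j has_real_derivative \<psi> (Suc j) t) (at t)"
    and O': "openin M O'" "q0 \<in> O'"
    and min: "\<And>q. q \<in> O' \<Longrightarrow> N q0 \<bullet> a - \<psi> 0 ((X q0 - p) \<bullet> (X q0 - p)) \<le> N q \<bullet> a - \<psi> 0 ((X q - p) \<bullet> (X q - p))"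
    and nonneg: "0 \<le> N q0 \<bullet> a"
  defines "w \<equiv> X q0 - p" and "t \<equiv> (X q0 - p) \<bullet> (X q0 - p)"
  shows "4 * \<psi> 2 t * (w \<bullet> w - (w \<bullet> N q0)\<^sup>2) + \<psi> 1 t * (2 * real d + 2 * (lam - (1/2) * (X q0 \<bullet> N q0)) * (w \<bullet> N q0))
      \<le> \<psi> 1 t * (w \<bullet> X q0 - (w \<bullet> N q0) * (X q0 \<bullet> N q0))"
proof -
  have "q0 \<in> topspace M" using O' openin_subset by blast
  then obtain U \<phi> r \<theta> s U0 where "weighted_graph e D d M A X N q0 U \<phi> r \<theta> s U0 lam" by (rule weighted_graph_exists)
  then interpret g: weighted_graph e D d M A X N q0 U \<phi> r \<theta> s U0 lam .
  have "0 \<le> g.A2 * (N q0 \<bullet> a)" using nonneg by (intro mult_nonneg_nonneg) (auto simp: g.A2_def intro: sum_nonneg)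
  then show ?thesis using g.minimum_inequality[OF \<psi> O' min] unfolding w_def t_def by linarith
qed

lemma compactin_attains_inf:
  fixes f :: "'m \<Rightarrow> real"
  assumes "compactin M K" "K \<noteq> {}" "continuous_map M euclideanreal f"
  obtains q where "q \<in> K" "\<And>q'. q' \<in> K \<Longrightarrow> f q \<le> f q'"
proof -
  have "compactin euclideanreal (f ` K)" by (rule image_compactin[OF assms(1,3)])
  then obtain y where "y \<in> f ` K" "\<forall>t\<in>f ` K. y \<le> t"
    using compact_attains_inf[of "f ` K"] assms(2) by auto
  then show ?thesis using that by blast
qed

text \<open>
  The drift Laplacian \<open>2 d + 2 lam (X \<bullet> N) - |X|\<^sup>2\<close> of \<open>|X|\<^sup>2\<close> is negative for \<open>|X| > R\<close>. Hence
  \<open>N \<bullet> a + \<epsilon> |X|\<^sup>2\<close>, which has a minimum by properness, takes it where \<open>|X| \<le> R\<close>. As \<open>R\<close> does not depend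
  on \<open>\<epsilon>\<close>, the height is nowhere below its minimum over this compact set.
\<close>

lemma height_attains_minimum:
  assumes proper: "proper_map M euclidean X" and nonneg: "\<And>q. q \<in> topspace M \<Longrightarrow> 0 \<le> N q \<bullet> a"
  obtains q1 where "q1 \<in> topspace M" "\<And>q. q \<in> topspace M \<Longrightarrow> N q1 \<bullet> a \<le> N q \<bullet> a"
proof -
  define R where "R = 2 * \<bar>lam\<bar> + 2 * real d + 1"
  have compact: "compactin M {q \<in> topspace M. X q \<in> cball 0 \<rho>}" for \<rho>
    using compactin_proper_map_preimage[OF proper, of "cball 0 \<rho>"] by simp
  have pert: "\<exists>qe\<in>topspace M. X qe \<in> cball 0 R \<and> (\<forall>q\<in>topspace M. N qe \<bullet> a + \<epsilon> * (X qe \<bullet> X qe) \<le> N q \<bullet> a + \<epsilon> * (X q \<bullet> X q))"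
    if \<epsilon>: "\<epsilon> > 0" for \<epsilon>
  proof -
    let ?g = "\<lambda>q. N q \<bullet> a + \<epsilon> * (X q \<bullet> X q)"
    obtain qs where qs: "qs \<in> topspace M" using manifold(3) by blast
    define \<rho> where "\<rho> = sqrt (?g qs / \<epsilon>)"
    have gs: "0 \<le> ?g qs" using nonneg[OF qs] \<epsilon> by simp
    let ?K = "{q \<in> topspace M. X q \<in> cball 0 \<rho>}"
    have inK: "q \<in> ?K \<longleftrightarrow> \<epsilon> * (X q \<bullet> X q) \<le> ?g qs" if "q \<in> topspace M" for q
    proof -
      have "X q \<in> cball 0 \<rho> \<longleftrightarrow> norm (X q) \<le> \<rho>" by simp
      also have "\<dots> \<longleftrightarrow> (norm (X q))\<^sup>2 \<le> ?g qs / \<epsilon>"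
        unfolding \<rho>_def using real_sqrt_le_iff[of "(norm (X q))\<^sup>2" "?g qs / \<epsilon>"] by simp
      also have "\<dots> \<longleftrightarrow> \<epsilon> * (X q \<bullet> X q) \<le> ?g qs" using \<epsilon> by (simp add: dot_square_norm field_simps)
      finally show ?thesis using that by simp
    qed
    have qsK: "qs \<in> ?K" using inK[OF qs] nonneg[OF qs] qs by simp
    have "continuous_map M euclideanreal (\<lambda>q. X q \<bullet> X q)"
      using continuous_map_compose[OF continuous_X, of euclideanreal "\<lambda>x. x \<bullet> x"] by (simp add: comp_def continuous_intros)
    then have cg: "continuous_map M euclideanreal ?g"
      by (intro continuous_map_add continuous_height continuous_map_real_mult_left)
    obtain qe where qe: "qe \<in> ?K" "\<And>q'. q' \<in> ?K \<Longrightarrow> ?g qe \<le> ?g q'"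
      using compactin_attains_inf[OF compact _ cg, of \<rho>] qsK by blast
    have glob: "?g qe \<le> ?g q" if q: "q \<in> topspace M" for q
    proof (cases "q \<in> ?K")
      case False
      then have "?g qs < ?g q" using inK[OF q] nonneg[OF q] by linarith
      then show ?thesis using qe(2)[OF qsK] by linarith
    qed (rule qe(2))
    have qeM: "qe \<in> topspace M" using qe(1) by simp
    define \<psi> :: "nat \<Rightarrow> real \<Rightarrow> real" where "\<psi> = (\<lambda>j t. if j = 0 then - \<epsilon> * t else if j = 1 then - \<epsilon> else 0)"
    have d: "(\<psi> j has_real_derivative \<psi> (Suc j) t) (at t)" for j t
    proof -
      have "((\<lambda>t. - \<epsilon> * t) has_real_derivative - \<epsilon>) (at t)" by (auto intro!: derivative_eq_intros)
      then show ?thesis by (cases "j = 0") (simp_all add: \<psi>_def One_nat_def)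
    qed
    let ?z = "X qe" and ?n = "N qe"
    have "4 * \<psi> 2 ((X qe - 0) \<bullet> (X qe - 0)) * ((X qe - 0) \<bullet> (X qe - 0) - ((X qe - 0) \<bullet> N qe)\<^sup>2) + \<psi> 1 ((X qe - 0) \<bullet> (X qe - 0)) * (2 * real d + 2 * (lam - (1/2) * (X qe \<bullet> N qe)) * ((X qe - 0) \<bullet> N qe))
      \<le> \<psi> 1 ((X qe - 0) \<bullet> (X qe - 0)) * ((X qe - 0) \<bullet> X qe - ((X qe - 0) \<bullet> N qe) * (X qe \<bullet> N qe))"
      by (rule superharmonic_test[where \<psi>=\<psi> and a=a and p=0, OF d openin_topspace qeM _ nonneg[OF qeM]])
         (use glob in \<open>simp add: \<psi>_def\<close>)
    then have "\<epsilon> * (?z \<bullet> ?z - (?z \<bullet> ?n) * (?z \<bullet> ?n)) \<le> \<epsilon> * (2 * real d + 2 * (lam - (1/2) * (?z \<bullet> ?n)) * (?z \<bullet> ?n))"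
      by (simp add: \<psi>_def)
    then have "?z \<bullet> ?z - (?z \<bullet> ?n) * (?z \<bullet> ?n) \<le> 2 * real d + 2 * (lam - (1/2) * (?z \<bullet> ?n)) * (?z \<bullet> ?n)"
      using \<epsilon> by simp
    then have zz: "?z \<bullet> ?z \<le> 2 * real d + 2 * lam * (?z \<bullet> ?n)" by (simp add: algebra_simps)
    have "\<bar>?z \<bullet> ?n\<bar> \<le> norm ?z" using Cauchy_Schwarz_ineq2[of ?z ?n] N_norm[OF qeM] by simp
    then have "lam * (?z \<bullet> ?n) \<le> \<bar>lam\<bar> * norm ?z"
      by (metis abs_ge_self abs_mult mult_left_mono abs_ge_zero order_trans)
    then have le: "norm ?z * norm ?z \<le> 2 * real d + 2 * \<bar>lam\<bar> * norm ?z"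
      using zz by (simp add: dot_square_norm power2_eq_square)
    have "norm ?z \<le> R"
    proof (rule ccontr)
      assume "\<not> ?thesis"
      then have big: "norm ?z > R" by simp
      then have "norm ?z \<ge> 1" unfolding R_def by simp
      have "2 * real d + 2 * \<bar>lam\<bar> * norm ?z \<le> (2 * real d + 2 * \<bar>lam\<bar>) * norm ?z"
        using mult_left_mono[OF \<open>norm ?z \<ge> 1\<close>, of "2 * real d"] by (simp add: distrib_right)
      also have "\<dots> < R * norm ?z" using \<open>norm ?z \<ge> 1\<close> unfolding R_def by (intro mult_strict_right_mono) linarith+
      also have "\<dots> \<le> norm ?z * norm ?z" using big by (intro mult_right_mono) auto
      finally show False using le by simp
    qed
    then show ?thesis using qeM glob by (intro bexI[of _ qe]) auto
  qed
  let ?K = "{q \<in> topspace M. X q \<in> cball 0 R}"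
  have "?K \<noteq> {}" using pert[of 1] by auto
  from compactin_attains_inf[OF compact this continuous_height, of a]
  obtain q1 where q1: "q1 \<in> ?K" "\<And>q. q \<in> ?K \<Longrightarrow> N q1 \<bullet> a \<le> N q \<bullet> a" by blast
  have "N q1 \<bullet> a \<le> N q \<bullet> a" if q: "q \<in> topspace M" for q
  proof (rule ccontr)
    assume "\<not> ?thesis"
    then have gap: "N q1 \<bullet> a - N q \<bullet> a > 0" by simp
    define \<epsilon> where "\<epsilon> = ((N q1 \<bullet> a - N q \<bullet> a) / 2) / (X q \<bullet> X q + 1)"
    have pos: "X q \<bullet> X q + 1 > 0" by (simp add: add_nonneg_pos)
    then have "\<epsilon> > 0" using gap by (simp add: \<epsilon>_def)
    from pert[OF this] obtain qe where qe: "qe \<in> ?K" "N qe \<bullet> a + \<epsilon> * (X qe \<bullet> X qe) \<le> N q \<bullet> a + \<epsilon> * (X q \<bullet> X q)"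
      using q by auto
    have "N q1 \<bullet> a \<le> N qe \<bullet> a + \<epsilon> * (X qe \<bullet> X qe)" using q1(2)[OF qe(1)] \<open>\<epsilon> > 0\<close> by (simp add: add_increasing2)
    moreover have "\<epsilon> * (X q \<bullet> X q) \<le> \<epsilon> * (X q \<bullet> X q + 1)" using \<open>\<epsilon> > 0\<close> by simp
    moreover have "\<epsilon> * (X q \<bullet> X q + 1) = (N q1 \<bullet> a - N q \<bullet> a) / 2"
      unfolding \<epsilon>_def using pos by (intro nonzero_eq_divide_eq[THEN iffD1, OF _ refl]) simp
    ultimately have "\<epsilon> * (X q \<bullet> X q) \<le> (N q1 \<bullet> a - N q \<bullet> a) / 2" "N q1 \<bullet> a \<le> N q \<bullet> a + \<epsilon> * (X q \<bullet> X q)"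
      using qe(2) by (simp_all only: order_trans)
    then show False using gap by argo
  qed
  then show ?thesis using that q1(1) by blast
qed

end

context weighted_graph
begin

text \<open>
  By the mean value theorem the chord is tangent to the graph at some point between its ends, and
  the normal turns by little inside the ball.
\<close>

lemma chord_nearly_tangent:
  assumes close: "\<And>y. y \<in> cball z0 \<tau> \<Longrightarrow> y \<in> V \<and> norm (Nt y - \<nu>) \<le> 1/4"
    and x: "x \<in> cball z0 \<tau>" "s x = 0" and y: "y \<in> cball z0 \<tau>" "s y = 0"
  shows "\<bar>(x - y) \<bullet> Nt x\<bar> \<le> norm (x - y) / 2"
proof -
  have seg: "y + t *\<^sub>R (x - y) \<in> cball z0 \<tau>" if "0 \<le> t" "t \<le> 1" for t
  proof -
    have "(1 - t) *\<^sub>R y + t *\<^sub>R x \<in> cball z0 \<tau>" using convex_cball[of z0 \<tau>] x y that by (simp only: convex_alt)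
    then show ?thesis by (simp add: algebra_simps)
  qed
  have "\<exists>t>0. t < 1 \<and> s (y + 1 *\<^sub>R (x - y)) - s (y + 0 *\<^sub>R (x - y)) = (1 - 0) * frechet_derivative s (at (y + t *\<^sub>R (x - y))) (x - y)"
    by (rule MVT2) (use seg close smooth_open_line_derivative[OF smooth_s] in auto)
  then obtain t where t: "0 < t" "t < 1" "frechet_derivative s (at (y + t *\<^sub>R (x - y))) (x - y) = 0" using x y by auto
  let ?m = "y + t *\<^sub>R (x - y)"
  have m: "?m \<in> V" "norm (Nt ?m - \<nu>) \<le> 1/4" using close[OF seg[of t]] t by auto
  have "Nt ?m \<bullet> (x - y) = 0" using Nt_gradient[OF m(1), of "x - y"] t(3) by simp
  then have "(x - y) \<bullet> Nt x = (x - y) \<bullet> (Nt x - Nt ?m)" by (simp add: inner_diff_right inner_commute)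
  also have "\<bar>\<dots>\<bar> \<le> norm (x - y) * norm (Nt x - Nt ?m)" by (rule Cauchy_Schwarz_ineq2)
  also have "norm (Nt x - Nt ?m) \<le> 1/4 + 1/4"
    using norm_triangle_ineq4[of "Nt x - \<nu>" "Nt ?m - \<nu>"] m(2) close[OF x(1)] by simp
  finally show ?thesis by (simp add: mult_left_mono)
qed

text \<open>
  Hopf's strong maximum principle with extrinsic balls. Suppose that the height exceeds its
  minimum \<open>m\<close> at a point \<open>p\<close> near \<open>q0\<close>, and let \<open>x2\<close> be the point nearest to \<open>p\<close> where the height is
  \<open>m\<close>. The ball about the midpoint \<open>c\<close> of \<open>p\<close> and \<open>x2\<close> with \<open>x2\<close> on its boundary meets the set
  \<open>{height = m}\<close> only in \<open>x2\<close>. Near \<open>x2\<close> the vector \<open>x - c\<close> is almost tangent, so the barrier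
  \<open>exp (- \<alpha> |x - c|\<^sup>2)\<close> has positive drift Laplacian for large \<open>\<alpha>\<close>. Subtracting a small multiple of it
  from the height produces a local minimum, which \<open>superharmonic_test\<close> excludes.
\<close>

lemma height_locally_constant_at_minimum:
  assumes nonneg: "\<And>q. q \<in> topspace M \<Longrightarrow> 0 \<le> N q \<bullet> a"
    and min: "\<And>q. q \<in> topspace M \<Longrightarrow> N q0 \<bullet> a \<le> N q \<bullet> a"
  shows "\<exists>O'. openin M O' \<and> q0 \<in> O' \<and> (\<forall>q\<in>O'. N q \<bullet> a = N q0 \<bullet> a)"
proof -
  define m where "m = N q0 \<bullet> a"
  have \<eta>_ge: "m \<le> height a x" if "x \<in> V" for x using min[OF \<kappa>_in[OF that]] by (simp add: height_def Nt_def m_def)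
  have cont_n: "continuous_on V (height a)" and cont_s: "continuous_on V s" and cont_N: "continuous_on V Nt"
    using smooth_open_continuous smooth_height smooth_s smooth_Nt by blast+
  have "open (V \<inter> Nt -` ball \<nu> (1/4))" using continuous_open_preimage[OF cont_N open_ball open_ball] .
  moreover have "z0 \<in> V \<inter> Nt -` ball \<nu> (1/4)" using z0 center by simp
  ultimately obtain \<tau> where \<tau>: "\<tau> > 0" "cball z0 \<tau> \<subseteq> V \<inter> Nt -` ball \<nu> (1/4)"
    using open_contains_cball by metis
  have close: "y \<in> V \<and> norm (Nt y - \<nu>) \<le> 1/4" if "y \<in> cball z0 \<tau>" for y
    using subsetD[OF \<tau>(2) that] by (auto simp: dist_norm norm_minus_commute)
  have cV: "cball z0 \<tau> \<subseteq> V" using \<tau>(2) by blast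
  define K where "K = {x \<in> cball z0 \<tau>. s x = 0}"
  have "closed (cball z0 \<tau> \<inter> s -` {0})"
    by (rule continuous_closed_preimage[OF continuous_on_subset[OF cont_s cV]]) auto
  moreover have "K = cball z0 \<tau> \<inter> s -` {0}" by (auto simp: K_def)
  ultimately have "closed K" by simp
  have "bounded K" by (rule bounded_subset[OF bounded_cball[of z0 \<tau>]]) (auto simp: K_def)
  then have cK: "compact K" using \<open>closed K\<close> by (simp add: compact_eq_bounded_closed)
  have KV: "K \<subseteq> V" using cV by (auto simp: K_def)
  have claim: "height a p = m" if p: "p \<in> K" "dist z0 p < \<tau> / 2" for p
  proof (rule ccontr)
    assume np: "height a p \<noteq> m"
    define Z where "Z = {x \<in> K. height a x = m}"
    have "closed (K \<inter> height a -` {m})"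
      by (rule continuous_closed_preimage[OF continuous_on_subset[OF cont_n KV] \<open>closed K\<close>]) simp
    moreover have "Z = K \<inter> height a -` {m}" by (auto simp: Z_def)
    ultimately have "closed Z" by simp
    have z0Z: "z0 \<in> Z" using \<tau>(1) center by (simp add: Z_def K_def height_def m_def)
    obtain x2 where x2: "x2 \<in> Z" "\<And>y. y \<in> Z \<Longrightarrow> dist p x2 \<le> dist p y"
      using distance_attains_inf[OF \<open>closed Z\<close>, of p] z0Z by blast
    define \<rho> where "\<rho> = dist p x2"
    have \<rho>: "\<rho> > 0" using np x2(1) by (auto simp: \<rho>_def Z_def)
    have "\<rho> < \<tau> / 2" using x2(2)[OF z0Z] p(2) by (simp add: \<rho>_def dist_commute)
    then have "dist z0 x2 < \<tau>" using dist_triangle[of z0 x2 p] p(2) by (simp add: \<rho>_def)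
    \<comment> \<open>so small that near \<open>x2\<close> the vector \<open>x - c\<close> differs from \<open>x2 - c\<close> by at most \<open>1/8\<close> of its length\<close>
    define \<tau>2 where "\<tau>2 = min (\<rho> / 16) (\<tau> - dist z0 x2)"
    have \<tau>2: "\<tau>2 > 0" "\<tau>2 \<le> \<rho> / 16" "\<tau>2 \<le> \<tau> - dist z0 x2"
      unfolding \<tau>2_def using \<rho> \<open>dist z0 x2 < \<tau>\<close> by (simp, intro min.cobounded1, intro min.cobounded2)
    have sub: "cball x2 \<tau>2 \<subseteq> cball z0 \<tau>"
    proof
      fix y assume "y \<in> cball x2 \<tau>2"
      then show "y \<in> cball z0 \<tau>" using dist_triangle[of z0 y x2] \<tau>2(3) by simp
    qed
    define c where "c = (1/2) *\<^sub>R (p + x2)"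
    define Dd where "Dd = K \<inter> cball x2 \<tau>2"
    have cD: "compact Dd" unfolding Dd_def by (intro compact_Int_closed cK closed_cball)
    have x2K: "x2 \<in> K" "height a x2 = m" using x2(1) by (auto simp: Z_def)
    have x2D: "x2 \<in> Dd" using x2K \<tau>2(1) by (simp add: Dd_def)
    have x2c: "norm (x2 - c) = \<rho> / 2"
    proof -
      have "x2 - c = (1/2) *\<^sub>R (x2 - p)" by (rule euclidean_eqI) (simp add: c_def inner_diff_left inner_add_left field_simps)
      then show ?thesis by (simp add: \<rho>_def dist_norm norm_minus_commute)
    qed
    \<comment> \<open>parallelogram law; the closed ball about \<open>c\<close> lies, apart from \<open>x2\<close>, closer to \<open>p\<close> than \<open>x2\<close>\<close>
    have par: "(norm (x - p))\<^sup>2 + (norm (x - x2))\<^sup>2 = 2 * (norm (x - c))\<^sup>2 + \<rho>\<^sup>2 / 2" for x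
      unfolding \<rho>_def dist_norm c_def power2_norm_eq_inner
      by (simp add: inner_diff_left inner_diff_right inner_add_left inner_add_right inner_commute field_simps)
    have off: "height a x > m" if x: "x \<in> Dd" "norm (x - c) \<le> \<rho> / 2" "dist x2 x = \<tau>2" for x
    proof -
      have xK: "x \<in> K" using x(1) by (simp add: Dd_def)
      have "(norm (x - c))\<^sup>2 \<le> (\<rho> / 2)\<^sup>2" using x(2) by (intro power_mono) auto
      moreover have "(norm (x - x2))\<^sup>2 > 0" using x(3) \<tau>2(1) by auto
      moreover have "(\<rho> / 2)\<^sup>2 = \<rho>\<^sup>2 / 4" by (simp add: power_divide)
      ultimately have "(norm (x - p))\<^sup>2 < \<rho>\<^sup>2" using par[of x] by linarith
      then have "dist p x < \<rho>" using power_less_imp_less_base \<rho> by (metis dist_norm norm_minus_commute less_imp_le)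
      then have "x \<notin> Z" using x2(2)[of x] by (auto simp: \<rho>_def)
      then show ?thesis using xK \<eta>_ge[of x] KV by (auto simp: Z_def)
    qed
    \<comment> \<open>\<open>x - c\<close> is the mean of the chords \<open>x - p\<close> and \<open>x - x2\<close>. Its normal part is thus at most
      \<open>(17/32 + 1/32) \<rho> / 2 = 9/32 \<rho>\<close>, whereas its length is at least \<open>(1/2 - 1/16) \<rho>\<close>.\<close>
    have tang: "(norm (x - c))\<^sup>2 - ((x - c) \<bullet> Nt x)\<^sup>2 \<ge> \<rho>\<^sup>2 / 10" "norm (x - c) \<le> \<rho>" if x: "x \<in> Dd" for x
    proof -
      have xK: "x \<in> cball z0 \<tau>" "s x = 0" and xx2: "norm (x - x2) \<le> \<rho> / 16"
        using x \<tau>2(2) by (auto simp: Dd_def K_def dist_norm norm_minus_commute)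
      have "\<bar>(x - p) \<bullet> Nt x\<bar> \<le> norm (x - p) / 2" "\<bar>(x - x2) \<bullet> Nt x\<bar> \<le> norm (x - x2) / 2"
        using chord_nearly_tangent[OF close xK] p(1) x2K(1) by (auto simp: K_def)
      moreover have "norm (x - p) \<le> \<rho> / 16 + \<rho>"
        using norm_triangle_ineq[of "x - x2" "x2 - p"] xx2 by (simp add: \<rho>_def dist_norm norm_minus_commute)
      moreover have "(x - c) \<bullet> Nt x = (1/2) * ((x - p) \<bullet> Nt x) + (1/2) * ((x - x2) \<bullet> Nt x)"
        by (simp add: c_def inner_diff_left inner_add_left field_simps)
      ultimately have "\<bar>(x - c) \<bullet> Nt x\<bar> \<le> 9/32 * \<rho>" using xx2 unfolding abs_le_iff by (simp add: field_simps)
      then have "((x - c) \<bullet> Nt x)\<^sup>2 \<le> (9/32 * \<rho>)\<^sup>2" using power_mono[of "\<bar>(x - c) \<bullet> Nt x\<bar>" "9/32 * \<rho>" 2] by simp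
      moreover have "norm (x2 - c) \<le> norm (x - c) + norm (x - x2)"
        using norm_triangle_ineq[of "x - c" "x2 - x"] by (simp add: norm_minus_commute)
      then have "7/16 * \<rho> \<le> norm (x - c)" using x2c xx2 by simp
      then have "(7/16 * \<rho>)\<^sup>2 \<le> (norm (x - c))\<^sup>2" using \<rho> by (intro power_mono) auto
      ultimately have "(7/16 * \<rho>)\<^sup>2 - (9/32 * \<rho>)\<^sup>2 \<le> (norm (x - c))\<^sup>2 - ((x - c) \<bullet> Nt x)\<^sup>2" by linarith
      moreover have "(7/16 * \<rho>)\<^sup>2 - (9/32 * \<rho>)\<^sup>2 = 115/1024 * \<rho>\<^sup>2" by (simp add: power2_eq_square)
      moreover have "\<rho>\<^sup>2 / 10 \<le> 115/1024 * \<rho>\<^sup>2" by simp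
      ultimately show "(norm (x - c))\<^sup>2 - ((x - c) \<bullet> Nt x)\<^sup>2 \<ge> \<rho>\<^sup>2 / 10" by linarith
      show "norm (x - c) \<le> \<rho>" using norm_triangle_ineq[of "x - x2" "x2 - c"] x2c xx2 \<rho> by simp
    qed
    \<comment> \<open>\<open>B\<close> bounds the lower order terms of the drift Laplacian; \<open>\<alpha>\<close> makes the leading term exceed it\<close>
    define B where "B = 2 * real d + 2 * \<bar>lam\<bar> * \<rho> + \<rho> * (norm z0 + \<tau>)"
    have B: "B \<ge> 0" unfolding B_def using \<rho> \<tau>(1) by (intro add_nonneg_nonneg mult_nonneg_nonneg) auto
    define \<alpha> where "\<alpha> = (B + 1) * 10 / (4 * \<rho>\<^sup>2)"
    have \<alpha>: "\<alpha> > 0" "4 * \<alpha> * (\<rho>\<^sup>2 / 10) = B + 1" using \<rho> B by (auto simp: \<alpha>_def)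
    \<comment> \<open>on the part of the small sphere about \<open>x2\<close> inside the ball the height stays away from \<open>m\<close>\<close>
    obtain \<delta> where \<delta>: "\<delta> > 0" "\<And>x. x \<in> Dd \<Longrightarrow> norm (x - c) \<le> \<rho> / 2 \<Longrightarrow> dist x2 x = \<tau>2 \<Longrightarrow> m + 2 * \<delta> \<le> height a x"
    proof -
      define C where "C = Dd \<inter> cball c (\<rho> / 2) \<inter> sphere x2 \<tau>2"
      have C: "compact C" unfolding C_def by (intro compact_Int_closed cD closed_cball closed_sphere)
      have CV: "C \<subseteq> V" using KV by (auto simp: C_def Dd_def)
      have memC: "x \<in> C \<longleftrightarrow> x \<in> Dd \<and> norm (x - c) \<le> \<rho> / 2 \<and> dist x2 x = \<tau>2" for x
        by (auto simp: C_def dist_norm norm_minus_commute)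
      show ?thesis
      proof (cases "C = {}")
        case True
        then show ?thesis using that[of 1] memC by auto
      next
        case False
        obtain x1 where x1: "x1 \<in> C" "\<forall>y\<in>C. height a x1 \<le> height a y"
          using continuous_attains_inf[OF C False continuous_on_subset[OF cont_n CV]] by blast
        have "height a x1 > m" using off x1(1) memC by blast
        show ?thesis
        proof (rule that[of "(height a x1 - m) / 2"])
          show "0 < (height a x1 - m) / 2" using \<open>height a x1 > m\<close> by simp
          fix x assume "x \<in> Dd" "norm (x - c) \<le> \<rho> / 2" "dist x2 x = \<tau>2"
          then have "height a x1 \<le> height a x" using x1(2) memC by blast
          then show "m + 2 * ((height a x1 - m) / 2) \<le> height a x" by argo
        qed
      qed
    qed
    define \<psi> :: "nat \<Rightarrow> real \<Rightarrow> real" where "\<psi> = (\<lambda>j t. \<delta> * ((- \<alpha>) ^ j * exp (- \<alpha> * t)))"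
    have d\<psi>: "(\<psi> j has_real_derivative \<psi> (Suc j) t) (at t)" for j t
      unfolding \<psi>_def by (auto intro!: derivative_eq_intros)
    define \<Psi> where "\<Psi> = (\<lambda>x. height a x - \<psi> 0 ((x - c) \<bullet> (x - c)))"
    have DV: "Dd \<subseteq> V" using KV by (auto simp: Dd_def)
    have "continuous_on Dd \<Psi>" unfolding \<Psi>_def \<psi>_def
      by (intro continuous_intros continuous_on_subset[OF cont_n DV])
    then obtain x3 where x3: "x3 \<in> Dd" "\<And>x. x \<in> Dd \<Longrightarrow> \<Psi> x3 \<le> \<Psi> x"
      using continuous_attains_inf[OF cD] x2D by blast
    have sq: "(x - c) \<bullet> (x - c) = (norm (x - c))\<^sup>2" for x by (simp add: power2_norm_eq_inner)
    have \<psi>0: "\<psi> 0 t = \<delta> * exp (- \<alpha> * t)" for t by (simp add: \<psi>_def)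
    \<comment> \<open>on the small sphere \<open>\<Psi>\<close> exceeds its value at \<open>x2\<close>: inside the ball by the choice of \<open>\<delta>\<close>, outside
      because the barrier is smaller there than at \<open>x2\<close>\<close>
    have "dist x2 x3 \<noteq> \<tau>2"
    proof
      assume sph: "dist x2 x3 = \<tau>2"
      have le: "\<Psi> x3 \<le> m - \<delta> * exp (- \<alpha> * (\<rho> / 2)\<^sup>2)"
        using x3(2)[OF x2D] x2K(2) x2c by (simp add: \<Psi>_def \<psi>0 sq)
      show False
      proof (cases "norm (x3 - c) \<le> \<rho> / 2")
        case True
        have "exp (- \<alpha> * (norm (x3 - c))\<^sup>2) \<le> 1" using \<alpha> by simp
        then have "\<delta> * exp (- \<alpha> * (norm (x3 - c))\<^sup>2) \<le> \<delta>" using \<delta>(1) by (metis mult.right_neutral mult_left_mono less_imp_le)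
        moreover have "m + 2 * \<delta> \<le> height a x3" using \<delta>(2)[OF x3(1) True sph] .
        moreover have "0 < \<delta> * exp (- \<alpha> * (\<rho> / 2)\<^sup>2)" using \<delta>(1) by simp
        ultimately show False using le \<delta>(1) unfolding \<Psi>_def \<psi>0 sq by linarith
      next
        case False
        then have "(\<rho> / 2)\<^sup>2 < (norm (x3 - c))\<^sup>2" using \<rho> by (intro power_strict_mono) auto
        then have "exp (- \<alpha> * (norm (x3 - c))\<^sup>2) < exp (- \<alpha> * (\<rho> / 2)\<^sup>2)" using \<alpha> by simp
        then have "\<delta> * exp (- \<alpha> * (norm (x3 - c))\<^sup>2) < \<delta> * exp (- \<alpha> * (\<rho> / 2)\<^sup>2)" using \<delta>(1) by simp
        then show False using le \<eta>_ge[of x3] x3(1) DV unfolding \<Psi>_def \<psi>0 sq by auto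
      qed
    qed
    then have int: "dist x2 x3 < \<tau>2" using x3(1) by (simp add: Dd_def)
    have x3V: "x3 \<in> V" and sx3: "s x3 = 0" using x3(1) DV by (auto simp: Dd_def K_def)
    define q3 where "q3 = \<kappa> x3"
    have q3U: "q3 \<in> U0" unfolding q3_def by (rule \<kappa>_in_U0[OF x3V pE1_full sx3])
    have Xq3: "X q3 = x3" using X_\<kappa>[OF x3V] sx3 pE1_full by (simp add: q3_def)
    have Nq3: "N q3 = Nt x3" by (simp add: q3_def Nt_def)
    define O' where "O' = U0 \<inter> {q \<in> topspace M. X q \<in> ball x2 \<tau>2}"
    have "openin M {q \<in> topspace M. X q \<in> ball x2 \<tau>2}"
      using continuous_X by (rule openin_continuous_map_preimage) simp
    then have O': "openin M O'" unfolding O'_def using U0(1) by (rule openin_Int[rotated])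
    have q3O: "q3 \<in> O'" using q3U Xq3 int U0_top by (auto simp: O'_def)
    have onO: "X q \<in> Dd \<and> N q \<bullet> a = height a (X q)" if "q \<in> O'" for q
      using that on_U0(3)[of q] subsetD[OF sub, of "X q"] Nt_X[of q] by (auto simp: O'_def Dd_def K_def height_def)
    let ?w = "X q3 - c" and ?t = "(X q3 - c) \<bullet> (X q3 - c)"
    have q3M: "q3 \<in> topspace M" using q3U U0_top by blast
    have test: "4 * \<psi> 2 ?t * (?w \<bullet> ?w - (?w \<bullet> N q3)\<^sup>2) + \<psi> 1 ?t * (2 * real d + 2 * (lam - (1/2) * (X q3 \<bullet> N q3)) * (?w \<bullet> N q3))
      \<le> \<psi> 1 ?t * (?w \<bullet> X q3 - (?w \<bullet> N q3) * (X q3 \<bullet> N q3))"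
    proof (rule superharmonic_test[where \<psi>=\<psi> and a=a and p=c, OF d\<psi> O' q3O _ nonneg[OF q3M]])
      fix q assume "q \<in> O'"
      then have "\<Psi> x3 \<le> \<Psi> (X q)" using onO x3(2) by blast
      then show "N q3 \<bullet> a - \<psi> 0 ((X q3 - c) \<bullet> (X q3 - c)) \<le> N q \<bullet> a - \<psi> 0 ((X q - c) \<bullet> (X q - c))"
        using onO[OF \<open>q \<in> O'\<close>] onO[OF q3O] Xq3 by (simp add: \<Psi>_def)
    qed
    define F where "F = \<delta> * \<alpha> * exp (- \<alpha> * ?t)"
    have F: "F > 0" using \<delta>(1) \<alpha>(1) by (simp add: F_def)
    have \<psi>12: "\<psi> 1 ?t = - F" "\<psi> 2 ?t = \<alpha> * F" by (simp_all add: \<psi>_def F_def power2_eq_square)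
    have "F * (4 * \<alpha> * (?w \<bullet> ?w - (?w \<bullet> N q3)\<^sup>2)) \<le> F * (2 * real d + 2 * lam * (?w \<bullet> N q3) - ?w \<bullet> X q3)"
      using test unfolding \<psi>12 by (simp add: algebra_simps)
    then have ineq: "4 * \<alpha> * (?w \<bullet> ?w - (?w \<bullet> N q3)\<^sup>2) \<le> 2 * real d + 2 * lam * (?w \<bullet> N q3) - ?w \<bullet> X q3" using F by simp
    have wle: "norm ?w \<le> \<rho>" using tang(2)[OF x3(1)] Xq3 by simp
    have "\<rho>\<^sup>2 / 10 \<le> ?w \<bullet> ?w - (?w \<bullet> N q3)\<^sup>2" using tang(1)[OF x3(1)] Xq3 Nq3 by (simp add: power2_norm_eq_inner)
    then have "4 * \<alpha> * (\<rho>\<^sup>2 / 10) \<le> 4 * \<alpha> * (?w \<bullet> ?w - (?w \<bullet> N q3)\<^sup>2)"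
      using \<alpha>(1) by (intro mult_left_mono) auto
    then have lower: "B + 1 \<le> 4 * \<alpha> * (?w \<bullet> ?w - (?w \<bullet> N q3)\<^sup>2)" unfolding \<alpha>(2) .
    have "\<bar>?w \<bullet> N q3\<bar> \<le> norm ?w" using Cauchy_Schwarz_ineq2[of ?w "N q3"] N_norm[OF q3M] by simp
    then have "\<bar>lam * (?w \<bullet> N q3)\<bar> \<le> \<bar>lam\<bar> * \<rho>" unfolding abs_mult using wle by (intro mult_left_mono) auto
    moreover have "norm x3 \<le> norm z0 + \<tau>"
      using norm_triangle_ineq[of z0 "x3 - z0"] x3(1) by (simp add: Dd_def K_def dist_norm norm_minus_commute)
    then have "norm ?w * norm (X q3) \<le> \<rho> * (norm z0 + \<tau>)" using wle Xq3 \<rho> by (intro mult_mono) auto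
    then have "\<bar>?w \<bullet> X q3\<bar> \<le> \<rho> * (norm z0 + \<tau>)" using Cauchy_Schwarz_ineq2[of ?w "X q3"] by linarith
    ultimately have "2 * real d + 2 * lam * (?w \<bullet> N q3) - ?w \<bullet> X q3 \<le> B" unfolding B_def by linarith
    then show False using ineq lower by linarith
  qed
  define O' where "O' = U0 \<inter> {q \<in> topspace M. X q \<in> ball z0 (\<tau> / 2)}"
  have "openin M {q \<in> topspace M. X q \<in> ball z0 (\<tau> / 2)}"
    using continuous_X by (rule openin_continuous_map_preimage) simp
  then have "openin M O'" unfolding O'_def using U0(1) by (rule openin_Int[rotated])
  moreover have "q0 \<in> O'" using q0 q0_in \<tau>(1) by (simp add: O'_def)
  moreover have "N q \<bullet> a = N q0 \<bullet> a" if "q \<in> O'" for q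
  proof -
    have "X q \<in> K" "dist z0 (X q) < \<tau> / 2" using that on_U0(3)[of q] \<tau>(1) by (auto simp: O'_def K_def)
    from claim[OF this] show ?thesis using Nt_X[of q] that by (simp add: O'_def height_def m_def)
  qed
  ultimately show ?thesis by blast
qed

end

context weighted_hypersurface
begin

theorem height_constant:
  assumes proper: "proper_map M euclidean X" and nonneg: "\<And>q. q \<in> topspace M \<Longrightarrow> 0 \<le> N q \<bullet> a"
  obtains k where "\<And>q. q \<in> topspace M \<Longrightarrow> N q \<bullet> a = k"
proof -
  obtain q1 where q1: "q1 \<in> topspace M" "\<And>q. q \<in> topspace M \<Longrightarrow> N q1 \<bullet> a \<le> N q \<bullet> a"
    using height_attains_minimum[OF proper nonneg] by blast
  define Z where "Z = {q \<in> topspace M. N q \<bullet> a \<in> {N q1 \<bullet> a}}"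
  have "closedin M Z" unfolding Z_def using continuous_height by (rule closedin_continuous_map_preimage) simp
  moreover have "openin M Z"
  proof (subst openin_subopen, rule ballI)
    fix q assume q: "q \<in> Z"
    then have qM: "q \<in> topspace M" and eq: "N q \<bullet> a = N q1 \<bullet> a" by (auto simp: Z_def)
    obtain U \<phi> r \<theta> s U0 where "weighted_graph e D d M A X N q U \<phi> r \<theta> s U0 lam" using weighted_graph_exists[OF qM] .
    then interpret g: weighted_graph e D d M A X N q U \<phi> r \<theta> s U0 lam .
    have "\<exists>O'. openin M O' \<and> q \<in> O' \<and> (\<forall>q'\<in>O'. N q' \<bullet> a = N q \<bullet> a)"
      by (rule g.height_locally_constant_at_minimum[OF nonneg]) (use q1(2) eq in auto)
    then obtain O' where O': "openin M O'" "q \<in> O'" "\<forall>q'\<in>O'. N q' \<bullet> a = N q \<bullet> a" by blast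
    moreover have "O' \<subseteq> Z" using eq O'(3) openin_subset[OF O'(1)] by (auto simp: Z_def)
    ultimately show "\<exists>T. openin M T \<and> q \<in> T \<and> T \<subseteq> Z" by blast
  qed
  ultimately have "Z = topspace M"
    using manifold(2) q1(1) unfolding connected_space_clopen_in by (auto simp: Z_def)
  then show ?thesis using that by (auto simp: Z_def)
qed

end

context immersed_hypersurface
begin

section \<open>Lifting translations along tangent directions\<close>

lemma X_locally_injective:
  assumes "q \<in> topspace M"
  obtains U0 where "openin M U0" "q \<in> U0" "inj_on X U0"
proof -
  obtain U \<phi> r \<theta> s U0 where "normal_graph e D d M A X N q U \<phi> r \<theta> s U0" using normal_graph_exists[OF assms] .
  then interpret g: normal_graph e D d M A X N q U \<phi> r \<theta> s U0 .
  show ?thesis using that[OF g.U0(1) g.q0] g.\<kappa>_X by (metis inj_onI)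
qed

text \<open>
  The set where the two lifts agree is closed because \<open>M\<close> is Hausdorff, and open because \<open>X\<close> is
  locally injective.
\<close>

lemma unique_lifting:
  assumes Y: "connected_space Y" and g: "continuous_map Y M g1" "continuous_map Y M g2"
    and X: "\<And>y. y \<in> topspace Y \<Longrightarrow> X (g1 y) = X (g2 y)" and y0: "y0 \<in> topspace Y" "g1 y0 = g2 y0" and y: "y \<in> topspace Y"
  shows "g1 y = g2 y"
proof -
  let ?S = "{y \<in> topspace Y. g1 y = g2 y}"
  have "closedin Y ?S" by (rule closedin_continuous_maps_eq[OF Hausdorff g])
  moreover have "openin Y ?S"
  proof (subst openin_subopen, rule ballI)
    fix y assume "y \<in> ?S"
    then have yY: "y \<in> topspace Y" "g1 y = g2 y" by auto
    have "g1 y \<in> topspace M" using g(1) yY(1) continuous_map_image_subset_topspace by blast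
    then obtain U0 where U0: "openin M U0" "g1 y \<in> U0" "inj_on X U0" by (rule X_locally_injective)
    let ?T = "{y \<in> topspace Y. g1 y \<in> U0} \<inter> {y \<in> topspace Y. g2 y \<in> U0}"
    have "openin Y ?T" using openin_continuous_map_preimage[OF g(1) U0(1)] openin_continuous_map_preimage[OF g(2) U0(1)] by blast
    moreover have "y \<in> ?T" using yY U0(2) by simp
    moreover have "?T \<subseteq> ?S" using X U0(3) by (auto dest: inj_onD)
    ultimately show "\<exists>T. openin Y T \<and> y \<in> T \<and> T \<subseteq> ?S" by blast
  qed
  ultimately have "?S = topspace Y" using Y y0 unfolding connected_space_clopen_in by blast
  then show ?thesis using y by blast
qed

abbreviation "I01 \<equiv> top_of_set {0..1::real}"

text \<open>
  A lift moves \<open>q\<close> along a path that \<open>X\<close> maps to the straight segment from \<open>X q\<close> to \<open>X q + t\<close>.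
\<close>

definition lift :: "'m \<Rightarrow> 'a \<Rightarrow> 'm \<Rightarrow> bool" where
  "lift q t q' \<longleftrightarrow> (\<exists>g. continuous_map I01 M g \<and> g 0 = q \<and> g 1 = q' \<and> (\<forall>\<tau>\<in>{0..1}. X (g \<tau>) = X q + \<tau> *\<^sub>R t))"

lemma lift_unique:
  assumes "lift q t q1" "lift q t q2" shows "q1 = q2"
proof -
  obtain g1 where g1: "continuous_map I01 M g1" "g1 0 = q" "g1 1 = q1" "\<forall>\<tau>\<in>{0..1}. X (g1 \<tau>) = X q + \<tau> *\<^sub>R t"
    using assms(1) unfolding lift_def by blast
  obtain g2 where g2: "continuous_map I01 M g2" "g2 0 = q" "g2 1 = q2" "\<forall>\<tau>\<in>{0..1}. X (g2 \<tau>) = X q + \<tau> *\<^sub>R t"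
    using assms(2) unfolding lift_def by blast
  have "g1 1 = g2 1"
    by (rule unique_lifting[of I01 g1 g2 0 1]) (use g1 g2 in \<open>auto simp: connected_space_subtopology\<close>)
  then show ?thesis using g1 g2 by simp
qed

lemma lift_X: "lift q t q' \<Longrightarrow> X q' = X q + t"
  unfolding lift_def by (metis atLeastAtMost_iff order_refl scaleR_one zero_le_one)

lemma lift_in: "lift q t q' \<Longrightarrow> q' \<in> topspace M"
  unfolding lift_def continuous_map_def by force

lemma lift_reverse:
  assumes "lift q t q'" shows "lift q' (- t) q"
proof -
  obtain g where g: "continuous_map I01 M g" "g 0 = q" "g 1 = q'" "\<forall>\<tau>\<in>{0..1}. X (g \<tau>) = X q + \<tau> *\<^sub>R t"
    using assms unfolding lift_def by blast
  have "continuous_map I01 I01 (\<lambda>\<tau>. 1 - \<tau>)"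
    by (auto simp: continuous_map_in_subtopology intro!: continuous_intros)
  from continuous_map_compose[OF this g(1)] have "continuous_map I01 M (\<lambda>\<tau>. g (1 - \<tau>))" by (simp add: comp_def)
  moreover have "X (g (1 - \<tau>)) = X q' + \<tau> *\<^sub>R (- t)" if "\<tau> \<in> {0..1}" for \<tau>
    using g(4) that lift_X[OF assms] by (simp add: algebra_simps)
  ultimately show ?thesis unfolding lift_def using g(2,3) by (intro exI[of _ "\<lambda>\<tau>. g (1 - \<tau>)"]) auto
qed

lemma lift_join:
  assumes "lift q t q1" "lift q1 t q2" shows "lift q (2 *\<^sub>R t) q2"
proof -
  obtain g1 where g1: "continuous_map I01 M g1" "g1 0 = q" "g1 1 = q1" "\<forall>\<tau>\<in>{0..1}. X (g1 \<tau>) = X q + \<tau> *\<^sub>R t"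
    using assms(1) unfolding lift_def by blast
  obtain g2 where g2: "continuous_map I01 M g2" "g2 0 = q1" "g2 1 = q2" "\<forall>\<tau>\<in>{0..1}. X (g2 \<tau>) = X q1 + \<tau> *\<^sub>R t"
    using assms(2) unfolding lift_def by blast
  define g where "g = (\<lambda>\<tau>::real. if \<tau> \<le> 1/2 then g1 (2 * \<tau>) else g2 (2 * \<tau> - 1))"
  have "continuous_map I01 M g" unfolding g_def
  proof (rule continuous_map_cases_le)
    have "continuous_map (subtopology I01 {x \<in> topspace I01. x \<le> 1/2}) I01 (\<lambda>\<tau>. 2 * \<tau>)"
      by (auto simp: continuous_map_in_subtopology subtopology_subtopology intro!: continuous_intros)
    from continuous_map_compose[OF this g1(1)]
    show "continuous_map (subtopology I01 {x \<in> topspace I01. x \<le> 1/2}) M (\<lambda>\<tau>. g1 (2 * \<tau>))" by (simp add: comp_def)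
    have "continuous_map (subtopology I01 {x \<in> topspace I01. 1/2 \<le> x}) I01 (\<lambda>\<tau>. 2 * \<tau> - 1)"
      by (auto simp: continuous_map_in_subtopology subtopology_subtopology intro!: continuous_intros)
    from continuous_map_compose[OF this g2(1)]
    show "continuous_map (subtopology I01 {x \<in> topspace I01. 1/2 \<le> x}) M (\<lambda>\<tau>. g2 (2 * \<tau> - 1))" by (simp add: comp_def)
    show "g1 (2 * x) = g2 (2 * x - 1)" if "x = 1/2" for x
    proof -
      have "2 * x = 1" "2 * x - 1 = 0" using that by simp_all
      then show ?thesis using g1(3) g2(2) by simp
    qed
  qed (auto intro!: continuous_intros)
  moreover have "X (g \<tau>) = X q + \<tau> *\<^sub>R (2 *\<^sub>R t)" if "\<tau> \<in> {0..1}" for \<tau>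
  proof (cases "\<tau> \<le> 1/2")
    case True
    then have "2 * \<tau> \<in> {0..1}" using that by auto
    then have "X (g1 (2 * \<tau>)) = X q + (2 * \<tau>) *\<^sub>R t" using g1(4) by blast
    then show ?thesis using True by (simp add: g_def mult.commute)
  next
    case False
    then have "2 * \<tau> - 1 \<in> {0..1}" using that by auto
    then have "X (g2 (2 * \<tau> - 1)) = X q1 + (2 * \<tau> - 1) *\<^sub>R t" using g2(4) by blast
    then show ?thesis using False lift_X[OF assms(1)] by (simp add: g_def algebra_simps)
  qed
  ultimately show ?thesis unfolding lift_def using g1(2) g2(3) by (intro exI[of _ g]) (auto simp: g_def)
qed

end

context codimension_one
begin

context
  fixes R :: "'a set"
  assumes R: "subspace R" and tangent: "\<And>q t. q \<in> topspace M \<Longrightarrow> t \<in> R \<Longrightarrow> N q \<bullet> t = 0"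
begin

abbreviation "P \<equiv> prod_topology M (top_of_set R)"

text \<open>
  A pair is liftable if lifts exist near it and can be chosen continuously; by uniqueness such
  local choices fit together.
\<close>

definition liftable :: "'m \<times> 'a \<Rightarrow> bool" where
  "liftable z \<longleftrightarrow> (\<exists>W \<sigma>. openin P W \<and> z \<in> W \<and> continuous_map (subtopology P W) M \<sigma> \<and> (\<forall>w\<in>W. lift (fst w) (snd w) (\<sigma> w)))"

lemma continuous_map_scaled_snd: "continuous_map P (top_of_set R) (\<lambda>w. c *\<^sub>R snd w)"
proof -
  have "continuous_map (top_of_set R) (top_of_set R) (\<lambda>t. c *\<^sub>R t)"
    using R by (auto simp: continuous_map_in_subtopology subspace_scale intro!: continuous_intros)
  from continuous_map_compose[OF continuous_map_snd this, of M] show ?thesis by (simp add: comp_def)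
qed

text \<open>
  Two successive lifts by \<open>t\<close> form a lift by \<open>2 t\<close>, with continuous dependence on the data.
\<close>

lemma liftable_double:
  assumes 1: "liftable (q, t)" and l: "lift q t q1" and 2: "liftable (q1, t)"
  shows "liftable (q, 2 *\<^sub>R t)"
proof -
  obtain W1 \<sigma>1 where W1: "openin P W1" "(q, t) \<in> W1" "continuous_map (subtopology P W1) M \<sigma>1" "\<And>w. w \<in> W1 \<Longrightarrow> lift (fst w) (snd w) (\<sigma>1 w)"
    using 1 unfolding liftable_def by blast
  obtain W2 \<sigma>2 where W2: "openin P W2" "(q1, t) \<in> W2" "continuous_map (subtopology P W2) M \<sigma>2" "\<And>w. w \<in> W2 \<Longrightarrow> lift (fst w) (snd w) (\<sigma>2 w)"
    using 2 unfolding liftable_def by blast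
  have inP: "(q, t) \<in> topspace P" using W1(1,2) openin_subset by blast
  have \<sigma>1q: "\<sigma>1 (q, t) = q1" using lift_unique[OF _ l] W1(4)[OF W1(2)] by simp
  define hf where "hf = (\<lambda>w::'m \<times> 'a. (fst w, (1/2) *\<^sub>R snd w))"
  have hf: "continuous_map P P hf" unfolding hf_def
    by (rule continuous_map_pairedI[OF continuous_map_fst continuous_map_scaled_snd])
  define W where "W = {w \<in> topspace P. hf w \<in> W1}"
  have W: "openin P W" unfolding W_def by (rule openin_continuous_map_preimage[OF hf W1(1)])
  have "continuous_map (subtopology P W) (subtopology P W1) hf"
    using continuous_map_from_subtopology[OF hf, of W] by (auto simp: continuous_map_in_subtopology W_def)
  from continuous_map_compose[OF this W1(3)] have c1: "continuous_map (subtopology P W) M (\<lambda>w. \<sigma>1 (hf w))" by (simp add: comp_def)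
  define k where "k = (\<lambda>w::'m \<times> 'a. (\<sigma>1 (hf w), (1/2) *\<^sub>R snd w))"
  have k: "continuous_map (subtopology P W) P k" unfolding k_def
    by (rule continuous_map_pairedI[OF c1 continuous_map_from_subtopology[OF continuous_map_scaled_snd]])
  define W3 where "W3 = {w \<in> topspace (subtopology P W). k w \<in> W2}"
  have "openin (subtopology P W) W3" unfolding W3_def by (rule openin_continuous_map_preimage[OF k W2(1)])
  then have W3: "openin P W3" "W3 \<subseteq> W" using openin_open_subtopology[OF W] by auto
  have "continuous_map (subtopology P W3) (subtopology P W2) k"
    using continuous_map_from_subtopology[OF k, of W3] W3(2)
    by (auto simp: continuous_map_in_subtopology W3_def subtopology_subtopology inf.absorb2)
  from continuous_map_compose[OF this W2(3)] have "continuous_map (subtopology P W3) M (\<lambda>w. \<sigma>2 (k w))" by (simp add: comp_def)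
  moreover have "lift (fst w) (snd w) (\<sigma>2 (k w))" if "w \<in> W3" for w
  proof -
    have "hf w \<in> W1" "k w \<in> W2" using that W3(2) by (auto simp: W3_def W_def)
    then have "lift (fst w) ((1/2) *\<^sub>R snd w) (\<sigma>1 (hf w))" "lift (\<sigma>1 (hf w)) ((1/2) *\<^sub>R snd w) (\<sigma>2 (k w))"
      using W1(4)[of "hf w"] W2(4)[of "k w"] by (auto simp: hf_def k_def)
    from lift_join[OF this] show ?thesis by simp
  qed
  moreover have "(q, 2 *\<^sub>R t) \<in> W3"
    using inP W1(2) W2(2) \<sigma>1q R by (simp add: W3_def W_def k_def hf_def subspace_scale)
  ultimately show ?thesis unfolding liftable_def using W3(1) by (intro exI[of _ W3] exI[of _ "\<lambda>w. \<sigma>2 (k w)"]) auto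
qed

text \<open>
  In a normal graph the function \<open>s\<close> is constant along directions orthogonal to the normals, so a
  translate of a point of the graph stays on the graph, and \<open>\<kappa>\<close> lifts it.
\<close>

lemma liftable_local:
  assumes "q0 \<in> topspace M"
  shows "\<exists>O' \<delta>. openin M O' \<and> q0 \<in> O' \<and> 0 < \<delta> \<and> (\<forall>q\<in>O'. \<forall>t\<in>R. norm t < \<delta> \<longrightarrow> liftable (q, t))"
proof -
  obtain U \<phi> r \<theta> s U0 where "normal_graph e D d M A X N q0 U \<phi> r \<theta> s U0" using normal_graph_exists[OF assms] .
  then interpret g: normal_graph e D d M A X N q0 U \<phi> r \<theta> s U0 .
  define O' where "O' = U0 \<inter> {q \<in> topspace M. X q \<in> ball (X q0) (r / 2)}"
  have "openin M {q \<in> topspace M. X q \<in> ball (X q0) (r / 2)}"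
    using continuous_X by (rule openin_continuous_map_preimage) simp
  then have O': "openin M O'" unfolding O'_def using g.U0(1) by (rule openin_Int[rotated])
  have "q0 \<in> O'" using g.q0 g.r assms by (simp add: O'_def)
  have inV: "X q + t \<in> g.V" if "q \<in> O'" "norm t < r / 2" for q t
    using that norm_triangle_ineq4[of "X q0 - X q" t] by (auto simp: O'_def dist_norm diff_diff_eq)
  have Xk: "X (g.\<kappa> (X q + t)) = X q + t" if q: "q \<in> O'" and t: "t \<in> R" "norm t < r / 2" for q t
  proof -
    have "s (X q + t) = s (X q) + 0"
    proof (rule constant_directional_derivative[OF g.smooth_s convex_ball])
      show "X q \<in> g.V" "X q + t \<in> g.V" using inV[OF q, of 0] inV[OF q t(2)] g.r by auto
      fix y assume y: "y \<in> g.V"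
      have "g.Nt y \<bullet> t = 0" using tangent[OF g.\<kappa>_in[OF y] t(1)] by (simp add: g.Nt_def)
      then show "frechet_derivative s (at y) t = 0" using g.Nt_gradient[OF y, of t] g.Nt_pos[OF y] by simp
    qed
    then have "s (X q + t) = 0" using g.on_U0(3) q by (simp add: O'_def)
    then show ?thesis using g.X_\<kappa>[OF inV[OF q t(2)]] pE1_full by simp
  qed
  have "liftable (q, t)" if q: "q \<in> O'" and t: "t \<in> R" "norm t < r / 2" for q t
  proof -
    define W where "W = O' \<times> (R \<inter> ball 0 (r / 2))"
    have W: "openin P W" unfolding W_def using O' by (intro openin_prod_Times_iff[THEN iffD2] disjI2 conjI) (auto simp: openin_open)
    have "(q, t) \<in> W" using q t by (simp add: W_def)
    moreover have "continuous_map (subtopology P W) M (\<lambda>w. g.\<kappa> (X (fst w) + snd w))"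
    proof -
      have "continuous_map P euclidean (X \<circ> fst)" by (rule continuous_map_compose[OF continuous_map_fst continuous_X])
      moreover have "continuous_map P euclidean snd"
        using continuous_map_snd[of M "top_of_set R"] continuous_map_into_fulltopology by blast
      ultimately have "continuous_map P euclidean (\<lambda>w. X (fst w) + snd w)"
        by (auto intro: continuous_map_add simp: comp_def)
      then have "continuous_map (subtopology P W) (top_of_set g.V) (\<lambda>w. X (fst w) + snd w)"
        using inV by (auto simp: continuous_map_in_subtopology W_def intro: continuous_map_from_subtopology)
      from continuous_map_compose[OF this g.continuous_\<kappa>] show ?thesis by (simp add: comp_def)
    qed
    moreover have "lift (fst w) (snd w) (g.\<kappa> (X (fst w) + snd w))" if "w \<in> W" for w
    proof -
      have w: "fst w \<in> O'" "snd w \<in> R" "norm (snd w) < r / 2" using that by (auto simp: W_def)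
      have n: "norm (\<tau> *\<^sub>R snd w) < r / 2" if "\<tau> \<in> {0..1}" for \<tau>
        using w(3) that mult_left_le_one_le[of "norm (snd w)" \<tau>] by auto
      have "continuous_map I01 (top_of_set g.V) (\<lambda>\<tau>. X (fst w) + \<tau> *\<^sub>R snd w)"
        using inV[OF w(1) n] by (auto simp: continuous_map_in_subtopology intro!: continuous_intros)
      from continuous_map_compose[OF this g.continuous_\<kappa>]
      have "continuous_map I01 M (\<lambda>\<tau>. g.\<kappa> (X (fst w) + \<tau> *\<^sub>R snd w))" by (simp add: comp_def)
      moreover have "g.\<kappa> (X (fst w)) = fst w" using w(1) by (intro g.\<kappa>_X) (simp add: O'_def)
      ultimately show ?thesis unfolding lift_def
        using Xk[OF w(1) subspace_scale[OF R w(2)] n]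
        by (intro exI[of _ "\<lambda>\<tau>. g.\<kappa> (X (fst w) + \<tau> *\<^sub>R snd w)"]) auto
    qed
    ultimately show ?thesis unfolding liftable_def using W by (intro exI[of _ W] exI[of _ "\<lambda>w. g.\<kappa> (X (fst w) + snd w)"]) auto
  qed
  then show ?thesis using O' \<open>q0 \<in> O'\<close> g.r by (intro exI[of _ O'] exI[of _ "r / 2"]) auto
qed

text \<open>
  On the compact set \<open>{|X| \<le> \<rho>}\<close> all translations shorter than some \<open>\<epsilon>\<close> lift. Halving a translation
  keeps \<open>|X| + |t|\<close> bounded by \<open>\<rho>\<close> at the start and at the midpoint, so doubling reaches every length
  after finitely many steps without leaving this compact set.
\<close>

lemma liftable_everywhere:
  assumes proper: "proper_map M euclidean X" and q: "q \<in> topspace M" and t: "t \<in> R"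
  shows "liftable (q, t)"
proof -
  define \<rho> where "\<rho> = norm (X q) + norm t"
  obtain O' \<delta> where O\<delta>: "\<And>q0. q0 \<in> topspace M \<Longrightarrow> openin M (O' q0) \<and> q0 \<in> O' q0 \<and> 0 < \<delta> q0 \<and> (\<forall>q\<in>O' q0. \<forall>t\<in>R. norm t < \<delta> q0 \<longrightarrow> liftable (q, t))"
    using liftable_local by metis
  have "compactin M {q \<in> topspace M. X q \<in> cball 0 \<rho>}" (is "compactin M ?C")
    using compactin_proper_map_preimage[OF proper, of "cball 0 \<rho>"] by simp
  moreover have "?C \<subseteq> \<Union> (O' ` topspace M)" using O\<delta> by blast
  moreover have "openin M U" if "U \<in> O' ` topspace M" for U using that O\<delta> by blast
  ultimately obtain \<F> where \<F>: "finite \<F>" "\<F> \<subseteq> O' ` topspace M" "?C \<subseteq> \<Union> \<F>"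
    using compactinD[of M ?C "O' ` topspace M"] by blast
  obtain F where "F \<subseteq> topspace M" "finite F" "\<F> = O' ` F"
    using finite_subset_image[OF \<F>(1,2)] by blast
  then have F: "F \<subseteq> topspace M" "finite F" "?C \<subseteq> \<Union> (O' ` F)" using \<F>(3) by blast+
  define \<epsilon> where "\<epsilon> = Min (insert 1 (\<delta> ` F))"
  have \<epsilon>: "\<epsilon> > 0" "\<And>p. p \<in> F \<Longrightarrow> \<epsilon> \<le> \<delta> p" using F(1,2) O\<delta> by (auto simp: \<epsilon>_def)
  have step: "liftable (q, t)" if "q \<in> topspace M" "t \<in> R" "norm (X q) + norm t \<le> \<rho>" "norm t < 2 ^ k * \<epsilon>" for k q t
    using that
  proof (induction k arbitrary: q t)
    case 0
    then have "norm (X q) \<le> \<rho>" using norm_ge_zero[of t] by linarith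
    then have "q \<in> ?C" using 0 by simp
    then obtain p where p: "p \<in> F" "q \<in> O' p" using F(3) by blast
    have "norm t < \<delta> p" using 0(4) \<epsilon>(2)[OF p(1)] by simp
    then show ?case using O\<delta>[of p] p F(1) 0(2) by blast
  next
    case (Suc k)
    let ?h = "(1/2) *\<^sub>R t"
    have h: "?h \<in> R" "norm ?h < 2 ^ k * \<epsilon>" using Suc.prems R by (auto simp: subspace_scale)
    have "norm (X q) + norm ?h \<le> \<rho>" 
    proof -
      have "norm ?h = norm t / 2" by simp
      then show ?thesis using Suc.prems(3) norm_ge_zero[of t] by argo
    qed
    then have 1: "liftable (q, ?h)" using Suc.IH Suc.prems(1) h by blast
    then obtain q1 where l: "lift q ?h q1" unfolding liftable_def by force
    have "norm (X q1) \<le> norm (X q) + norm ?h" unfolding lift_X[OF l] by (rule norm_triangle_ineq)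
    moreover have "norm ?h = norm t / 2" by simp
    ultimately have "norm (X q1) + norm ?h \<le> \<rho>" using Suc.prems(3) by argo
    then have "liftable (q1, ?h)" using Suc.IH[OF lift_in[OF l] h(1) _ h(2)] by blast
    from liftable_double[OF 1 l this] show ?case by simp
  qed
  obtain k :: nat where "norm t / \<epsilon> < 2 ^ k" using real_arch_pow[of 2 "norm t / \<epsilon>"] by auto
  then have "norm t < 2 ^ k * \<epsilon>" using \<epsilon>(1) by (simp add: field_simps)
  then show ?thesis using step[OF q t] by (simp add: \<rho>_def)
qed

theorem translation_action:
  assumes proper: "proper_map M euclidean X"
  obtains \<Phi> where "continuous_map P M \<Phi>" "\<And>q t. q \<in> topspace M \<Longrightarrow> t \<in> R \<Longrightarrow> X (\<Phi> (q, t)) = X q + t"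
    "\<And>q t. q \<in> topspace M \<Longrightarrow> t \<in> R \<Longrightarrow> \<Phi> (q, t) \<in> topspace M"
    "\<And>q t. q \<in> topspace M \<Longrightarrow> t \<in> R \<Longrightarrow> \<Phi> (\<Phi> (q, t), - t) = q"
proof -
  define \<Phi> where "\<Phi> = (\<lambda>w. THE q'. lift (fst w) (snd w) q')"
  have \<Phi>_eq: "\<Phi> w = q'" if "lift (fst w) (snd w) q'" for w q'
    unfolding \<Phi>_def using that lift_unique by blast
  have l: "lift q t (\<Phi> (q, t))" if qt: "q \<in> topspace M" "t \<in> R" for q t
  proof -
    obtain q' where "lift q t q'" using liftable_everywhere[OF proper qt] unfolding liftable_def by force
    then show ?thesis using \<Phi>_eq[of "(q, t)" q'] by simp
  qed
  have "continuous_map P M \<Phi>" unfolding continuous_map_def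
  proof (intro conjI allI impI)
    show "\<Phi> \<in> topspace P \<rightarrow> topspace M" using lift_in[OF l] by auto
    fix S assume S: "openin M S"
    show "openin P {w \<in> topspace P. \<Phi> w \<in> S}"
    proof (subst openin_subopen, rule ballI)
      fix w assume w: "w \<in> {w \<in> topspace P. \<Phi> w \<in> S}"
      then have "liftable w" using liftable_everywhere[OF proper, of "fst w" "snd w"] by auto
      then obtain W \<sigma> where W: "openin P W" "w \<in> W" "continuous_map (subtopology P W) M \<sigma>" "\<And>w. w \<in> W \<Longrightarrow> lift (fst w) (snd w) (\<sigma> w)"
        unfolding liftable_def by blast
      have eq: "\<Phi> w = \<sigma> w" if "w \<in> W" for w using \<Phi>_eq W(4)[OF that] by blast
      have "openin (subtopology P W) {w \<in> topspace (subtopology P W). \<sigma> w \<in> S}"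
        by (rule openin_continuous_map_preimage[OF W(3) S])
      then have "openin P {w \<in> topspace (subtopology P W). \<sigma> w \<in> S}" using openin_open_subtopology[OF W(1)] by blast
      moreover have "w \<in> {w \<in> topspace (subtopology P W). \<sigma> w \<in> S}" using w W(2) eq by auto
      moreover have "{w \<in> topspace (subtopology P W). \<sigma> w \<in> S} \<subseteq> {w \<in> topspace P. \<Phi> w \<in> S}" using eq by auto
      ultimately show "\<exists>T. openin P T \<and> w \<in> T \<and> T \<subseteq> {w \<in> topspace P. \<Phi> w \<in> S}" by blast
    qed
  qed
  moreover have "\<Phi> (\<Phi> (q, t), - t) = q" if "q \<in> topspace M" "t \<in> R" for q t
    using \<Phi>_eq[of "(\<Phi> (q, t), - t)" q] lift_reverse[OF l[OF that]] by simp
  ultimately show ?thesis using that[of \<Phi>] lift_X[OF l] lift_in[OF l] by blast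
qed

end

end

context weighted_hypersurface
begin

section \<open>Hypersurfaces with a positive constant height\<close>

text \<open>
  A constant height has a minimum everywhere. With \<open>\<psi> = 0\<close> the inequality at a minimum says
  \<open>A2 k \<le> 0\<close>.
\<close>

lemma normal_derivative_zero:
  assumes const: "\<And>q. q \<in> topspace M \<Longrightarrow> N q \<bullet> a = k" and k: "k > 0"
    and g: "weighted_graph e D d M A X N q U \<phi> r \<theta> s U0 lam"
  shows "frechet_derivative (normal_graph.Nt N U \<phi> \<theta>) (at (X q)) v = 0"
proof -
  interpret g: weighted_graph e D d M A X N q U \<phi> r \<theta> s U0 lam by fact
  have "4 * 0 * ((X q - 0) \<bullet> (X q - 0) - ((X q - 0) \<bullet> N q)\<^sup>2) + 0 * (2 * real d + 2 * (lam - (1/2) * (X q \<bullet> N q)) * ((X q - 0) \<bullet> N q))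
      + g.A2 * (N q \<bullet> a) \<le> 0 * ((X q - 0) \<bullet> X q - ((X q - 0) \<bullet> N q) * (X q \<bullet> N q))"
    by (rule g.minimum_inequality[where \<psi>="\<lambda>j t. 0" and a=a and p=0, OF _ openin_topspace g.q0_in]) (use const g.q0_in in auto)
  then have "g.A2 * k \<le> 0" using const[OF g.q0_in] by simp
  then have "g.A2 \<le> 0" using k by (simp add: mult_le_0_iff)
  moreover have "g.A2 = 0 \<longleftrightarrow> (\<forall>b\<in>Basis. g.DN b \<bullet> g.DN b = 0)"
    unfolding g.A2_def by (rule sum_nonneg_eq_0_iff) auto
  moreover have "g.A2 \<ge> 0" unfolding g.A2_def by (intro sum_nonneg) auto
  ultimately have "\<forall>b\<in>Basis. g.DN b = 0" by simp
  then show ?thesis using linear_expand[OF smooth_open_linear_deriv[OF g.smooth_Nt g.z0], of v] by simp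
qed

text \<open>
  The derivative of the normal vanishes at each point \<open>\<kappa> z\<close> when computed in the graph centred there;
  the chain rule transports this to the graph at \<open>q0\<close>. Hence \<open>Nt\<close> is constant and \<open>s\<close> is affine.
\<close>

lemma constant_positive_height_imp_flat:
  assumes const: "\<And>q. q \<in> topspace M \<Longrightarrow> N q \<bullet> a = k" and k: "k > 0"
    and q0: "q0 \<in> topspace M"
  shows "\<exists>O'. openin M O' \<and> q0 \<in> O' \<and> (\<forall>q\<in>O'. N q = N q0 \<and> X q \<bullet> N q0 = X q0 \<bullet> N q0)"
proof -
  obtain U \<phi> r \<theta> s U0 where "weighted_graph e D d M A X N q0 U \<phi> r \<theta> s U0 lam" using weighted_graph_exists[OF q0] .
  then interpret g: weighted_graph e D d M A X N q0 U \<phi> r \<theta> s U0 lam .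
  have zero: "(g.Nt has_derivative (\<lambda>h. 0)) (at z within g.V)" if z: "z \<in> g.V" for z
  proof -
    obtain U' \<phi>' r' \<theta>' s' U0' where gr: "weighted_graph e D d M A X N (g.\<kappa> z) U' \<phi>' r' \<theta>' s' U0' lam"
      using weighted_graph_exists[OF g.\<kappa>_in[OF z]] .
    then interpret g': weighted_graph e D d M A X N "g.\<kappa> z" U' \<phi>' r' \<theta>' s' U0' lam .
    define W where "W = {y \<in> g.V. g.\<kappa> y \<in> U0'}"
    have "openin (top_of_set g.V) {y \<in> topspace (top_of_set g.V). g.\<kappa> y \<in> U0'}"
      using g.continuous_\<kappa> g'.U0(1) by (rule openin_continuous_map_preimage)
    then have W: "open W" "z \<in> W" using z g'.q0 by (auto simp: W_def openin_open_eq)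
    have "((\<lambda>y. g'.Nt (X (g.\<kappa> y))) has_derivative (\<lambda>h. g'.DN (pE1 h - frechet_derivative s (at z) h *\<^sub>R N q0))) (at z)"
      by (rule has_derivative_compose[OF g.has_derivative_X\<kappa>[OF z] smooth_open_deriv[OF g'.smooth_Nt g'.z0]])
    then have "((\<lambda>y. g'.Nt (X (g.\<kappa> y))) has_derivative (\<lambda>h. 0)) (at z)"
      using normal_derivative_zero[OF const k gr] by simp
    then have "(g.Nt has_derivative (\<lambda>h. 0)) (at z)"
      by (rule has_derivative_transform_within_open[OF _ W]) (simp add: W_def g'.Nt_X g.Nt_def)
    then show ?thesis by (rule has_derivative_at_withinI)
  qed
  have Nt_const: "g.Nt z = N q0" if "z \<in> g.V" for z
    using has_derivative_zero_unique[OF convex_ball zero that g.center(1)] g.center(4) by simp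
  have "X (g.\<kappa> z) \<bullet> N q0 = X q0 \<bullet> N q0" if z: "z \<in> g.V" for z
  proof -
    let ?w = "X q0 - z"
    have "s (z + ?w) = s z + N q0 \<bullet> ?w"
    proof (rule constant_directional_derivative[OF g.smooth_s convex_ball z])
      show "z + ?w \<in> g.V" using g.center(1) by simp
      fix y assume "y \<in> g.V"
      then show "frechet_derivative s (at y) ?w = N q0 \<bullet> ?w"
        using g.Nt_gradient[of y ?w] Nt_const[of y] g.\<nu>_facts(2) by simp
    qed
    then have "s z = N q0 \<bullet> z - N q0 \<bullet> X q0" using g.center(2) by (simp add: inner_diff_right)
    then show ?thesis using g.X_\<kappa>[OF z] pE1_full g.\<nu>_facts(2)
      by (simp add: inner_diff_left inner_diff_right inner_commute)
  qed
  then have "N q = N q0 \<and> X q \<bullet> N q0 = X q0 \<bullet> N q0" if "q \<in> U0" for q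
    using Nt_const[of "X q"] g.on_U0(1)[OF that] g.\<kappa>_X[OF that] g.Nt_X[OF that] by metis
  then show ?thesis using g.U0(1) g.q0 by blast
qed

text \<open>
  The normal is a constant \<open>\<nu>\<close> and \<open>X\<close> takes values in a hyperplane \<open>\<nu> \<bullet> x = c\<close>. Translating every
  point \<open>q\<close> by the tangent vector \<open>c \<nu> - X q\<close> gives a continuous map of the connected space \<open>M\<close> into
  the fibre of \<open>X\<close> over \<open>c \<nu>\<close>, which is constant since \<open>X\<close> is locally injective. The translates of the
  resulting point \<open>p0\<close> then invert \<open>X\<close>.
\<close>

theorem positive_height_imp_hyperplane:
  assumes proper: "proper_map M euclidean X"
    and const: "\<And>q. q \<in> topspace M \<Longrightarrow> N q \<bullet> a = k" and k: "k > 0"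
  shows "is_hyperplane M X"
proof -
  obtain qs where qs: "qs \<in> topspace M" using manifold(3) by blast
  define \<nu> where "\<nu> = N qs"
  have \<nu>: "\<nu> \<bullet> \<nu> = 1" using N_unit[OF qs] by (simp add: \<nu>_def)
  have N: "N q = \<nu>" if "q \<in> topspace M" for q
    unfolding \<nu>_def
  proof (rule locally_constant_imp_constant[OF _ that qs])
    show "\<exists>O'. openin M O' \<and> q \<in> O' \<and> (\<forall>q'\<in>O'. N q' = N q)" if "q \<in> topspace M" for q
      using constant_positive_height_imp_flat[OF const k that] by blast
  qed
  define c where "c = X qs \<bullet> \<nu>"
  have Xc: "X q \<bullet> \<nu> = c" if "q \<in> topspace M" for q
    unfolding c_def
  proof (rule locally_constant_imp_constant[OF _ that qs])
    show "\<exists>O'. openin M O' \<and> q \<in> O' \<and> (\<forall>q'\<in>O'. X q' \<bullet> \<nu> = X q \<bullet> \<nu>)" if "q \<in> topspace M" for q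
      using constant_positive_height_imp_flat[OF const k that] N[OF that] by auto
  qed
  define R where "R = {t. \<nu> \<bullet> t = 0}"
  have R: "subspace R" by (auto simp: R_def subspace_def inner_add_right)
  have tang: "N q \<bullet> t = 0" if "q \<in> topspace M" "t \<in> R" for q t using N[OF that(1)] that(2) by (simp add: R_def)
  obtain \<Phi> where \<Phi>: "continuous_map (prod_topology M (top_of_set R)) M \<Phi>"
    "\<And>q t. q \<in> topspace M \<Longrightarrow> t \<in> R \<Longrightarrow> X (\<Phi> (q, t)) = X q + t"
    "\<And>q t. q \<in> topspace M \<Longrightarrow> t \<in> R \<Longrightarrow> \<Phi> (q, t) \<in> topspace M"
    "\<And>q t. q \<in> topspace M \<Longrightarrow> t \<in> R \<Longrightarrow> \<Phi> (\<Phi> (q, t), - t) = q"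
    using translation_action[OF R tang proper] by metis
  have XR: "X q - c *\<^sub>R \<nu> \<in> R" if "q \<in> topspace M" for q
    using Xc[OF that] \<nu> by (simp add: R_def inner_diff_right inner_commute)
  have mXR: "c *\<^sub>R \<nu> - X q \<in> R" if "q \<in> topspace M" for q
    using subspace_neg[OF R XR[OF that]] by simp
  define p0 where "p0 = \<Phi> (qs, c *\<^sub>R \<nu> - X qs)"
  have p0: "p0 \<in> topspace M" "X p0 = c *\<^sub>R \<nu>" using \<Phi>(2,3)[OF qs mXR[OF qs]] by (auto simp: p0_def)
  have same: "\<Phi> (q, c *\<^sub>R \<nu> - X q) = p0" if q: "q \<in> topspace M" for q
  proof (rule unique_lifting[of M "\<lambda>q. \<Phi> (q, c *\<^sub>R \<nu> - X q)" "\<lambda>_. p0" qs q, OF manifold(2)])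
    have "continuous_map M (top_of_set R) (\<lambda>q. c *\<^sub>R \<nu> - X q)"
      using mXR by (auto simp: continuous_map_in_subtopology intro!: continuous_map_diff continuous_X)
    then have "continuous_map M (prod_topology M (top_of_set R)) (\<lambda>q. (q, c *\<^sub>R \<nu> - X q))"
      by (intro continuous_map_pairedI continuous_map_id[unfolded id_def])  auto
    from continuous_map_compose[OF this \<Phi>(1)] show "continuous_map M M (\<lambda>q. \<Phi> (q, c *\<^sub>R \<nu> - X q))" by (simp add: comp_def)
    show "continuous_map M M (\<lambda>_. p0)" using p0(1) by simp
    show "X (\<Phi> (y, c *\<^sub>R \<nu> - X y)) = X p0" if "y \<in> topspace M" for y
      using \<Phi>(2)[OF that mXR[OF that]] p0(2) by simp
    show "\<Phi> (qs, c *\<^sub>R \<nu> - X qs) = p0" by (simp add: p0_def)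
  qed (use q qs in auto)
  have inverse: "\<Phi> (p0, X q - c *\<^sub>R \<nu>) = q" if "q \<in> topspace M" for q
    using \<Phi>(4)[OF that mXR[OF that]] same[OF that] by simp
  have "homeomorphic_maps M (top_of_set {x. \<nu> \<bullet> x = c}) X (\<lambda>x. \<Phi> (p0, x - c *\<^sub>R \<nu>))"
    unfolding homeomorphic_maps_def
  proof (intro conjI ballI)
    show "continuous_map M (top_of_set {x. \<nu> \<bullet> x = c}) X"
      using continuous_X Xc by (auto simp: continuous_map_in_subtopology inner_commute)
    have inR: "x - c *\<^sub>R \<nu> \<in> R" if "\<nu> \<bullet> x = c" for x using that \<nu> by (simp add: R_def inner_diff_right)
    have "continuous_map (top_of_set {x. \<nu> \<bullet> x = c}) (top_of_set R) (\<lambda>x. x - c *\<^sub>R \<nu>)"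
      using inR by (auto simp: continuous_map_in_subtopology intro!: continuous_intros)
    then have "continuous_map (top_of_set {x. \<nu> \<bullet> x = c}) (prod_topology M (top_of_set R)) (\<lambda>x. (p0, x - c *\<^sub>R \<nu>))"
      using p0(1) by (intro continuous_map_pairedI) auto
    from continuous_map_compose[OF this \<Phi>(1)]
    show "continuous_map (top_of_set {x. \<nu> \<bullet> x = c}) M (\<lambda>x. \<Phi> (p0, x - c *\<^sub>R \<nu>))" by (simp add: comp_def)
    show "\<Phi> (p0, X q - c *\<^sub>R \<nu>) = q" if "q \<in> topspace M" for q using inverse[OF that] .
    show "X (\<Phi> (p0, y - c *\<^sub>R \<nu>)) = y" if "y \<in> topspace (top_of_set {x. \<nu> \<bullet> x = c})" for y
      using \<Phi>(2)[OF p0(1) inR] that p0(2) by simp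
  qed
  then have "homeomorphic_map M (top_of_set {x. \<nu> \<bullet> x = c}) X" using homeomorphic_map_maps by blast
  then show ?thesis unfolding is_hyperplane_def using \<nu> by (intro exI[of _ \<nu>] exI[of _ c]) auto
qed

end

section \<open>The cross section of a cylinder\<close>

text \<open>
  The normals are orthogonal to the coordinate directions \<open>m + 2, \<dots>, D\<close>, and \<open>\<Phi>\<close> is the action of
  their span \<open>R\<close> by translations. The cross section \<open>slice\<close> is the part of the hypersurface without
  components in these directions.
\<close>

locale cylinder = weighted_hypersurface e D d M A X N lam
  for e :: "nat \<Rightarrow> 'a::euclidean_space" and D d and M :: "'m topology" and A X N lam +
  fixes m :: nat and \<Phi> :: "'m \<times> 'a \<Rightarrow> 'm"
  assumes m: "m + 1 \<le> d"
    and perp: "\<And>q i. q \<in> topspace M \<Longrightarrow> i \<in> {m + 2..D} \<Longrightarrow> N q \<bullet> e i = 0"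
    and \<Phi>: "continuous_map (prod_topology M (top_of_set (span (e ` {m + 2..D})))) M \<Phi>"
      "\<And>q t. q \<in> topspace M \<Longrightarrow> t \<in> span (e ` {m + 2..D}) \<Longrightarrow> X (\<Phi> (q, t)) = X q + t"
      "\<And>q t. q \<in> topspace M \<Longrightarrow> t \<in> span (e ` {m + 2..D}) \<Longrightarrow> \<Phi> (q, t) \<in> topspace M"
      "\<And>q t. q \<in> topspace M \<Longrightarrow> t \<in> span (e ` {m + 2..D}) \<Longrightarrow> \<Phi> (\<Phi> (q, t), - t) = q"
begin

abbreviation "R \<equiv> span (e ` {m + 2..D})"

abbreviation "F \<equiv> coord_space e m"

abbreviation "pR \<equiv> coord_proj e {m + 2..D}"

abbreviation "pF \<equiv> coord_proj e {1..m}"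

definition "slice = {q \<in> topspace M. pR (X q) = 0}"

definition "M' = subtopology M slice"

text \<open>
  The charts of the cross section are restrictions of linear maps composed with \<open>X\<close>. A transition
  map is then a linear map applied to a smooth parametrization, and the parametrization is an
  immersion because the linear map is a left inverse of it.
\<close>

definition slice_atlas :: "('m, 'a) chart set" where
  "slice_atlas = {(U, \<phi>). openin M' U \<and> openin (top_of_set F) (\<phi> ` U) \<and>
     homeomorphic_map (subtopology M' U) (top_of_set (\<phi> ` U)) \<phi> \<and>
     (\<exists>L. bounded_linear L \<and> (\<forall>q\<in>U. \<phi> q = L (X q))) \<and> smooth_on (\<phi> ` U) (X \<circ> inv_into U \<phi>)}"

lemma mD: "m + 1 \<in> {1..D}" "{1..m} \<subseteq> {1..D}" "{m + 2..D} \<subseteq> {1..D}" "m + 1 \<le> D"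
  using m full by auto

lemma F_facts: "x \<in> F \<Longrightarrow> pF x = x" "x \<in> F \<Longrightarrow> pR x = 0" "pF x \<in> F"
proof -
  show "x \<in> F \<Longrightarrow> pF x = x" unfolding coord_space_def by (rule coord_proj_id_iff[OF mD(2), THEN iffD2])
  show "x \<in> F \<Longrightarrow> pR x = 0" unfolding coord_space_def by (rule coord_proj_orthogonal[OF mD(2) _ mD(3)]) auto
  show "pF x \<in> F" unfolding coord_space_def by (rule coord_proj_in_span)
qed

lemma R_facts: "t \<in> R \<Longrightarrow> pR t = t" "t \<in> R \<Longrightarrow> pF t = 0" "pR x \<in> R"
proof -
  show "t \<in> R \<Longrightarrow> pR t = t" by (rule coord_proj_id_iff[OF mD(3), THEN iffD2])
  show "t \<in> R \<Longrightarrow> pF t = 0" by (rule coord_proj_orthogonal[OF mD(3) _ mD(2)]) auto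
  show "pR x \<in> R" by (rule coord_proj_in_span)
qed

lemma pR_zero_inner: "pR x = 0 \<Longrightarrow> t \<in> R \<Longrightarrow> x \<bullet> t = 0"
  using coord_proj_adjoint[of "{m + 2..D}" x t] R_facts(1)[of t] by simp

lemma N_perp: "q \<in> topspace M \<Longrightarrow> pR (N q) = 0" and N_R: "q \<in> topspace M \<Longrightarrow> t \<in> R \<Longrightarrow> N q \<bullet> t = 0"
proof -
  show "pR (N q) = 0" if "q \<in> topspace M" for q using perp[OF that] coord_proj_zero_iff[OF mD(3)] by blast
  then show "q \<in> topspace M \<Longrightarrow> t \<in> R \<Longrightarrow> N q \<bullet> t = 0" using pR_zero_inner by blast
qed

lemma decompose: "pR x = 0 \<Longrightarrow> x = pF x + (x \<bullet> e (m + 1)) *\<^sub>R e (m + 1)"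
proof -
  assume 0: "pR x = 0"
  have eq: "{1..m} \<union> ({m + 1} \<union> {m + 2..D}) = {1..D}" using mD(4) by auto
  have "x = coord_proj e ({1..m} \<union> ({m + 1} \<union> {m + 2..D})) x" unfolding eq coord_proj_all ..
  also have "\<dots> = pF x + coord_proj e ({m + 1} \<union> {m + 2..D}) x" by (rule coord_proj_split) auto
  also have "coord_proj e ({m + 1} \<union> {m + 2..D}) x = coord_proj e {m + 1} x + pR x" by (rule coord_proj_split) auto
  finally show ?thesis using 0 by (simp add: coord_proj_def)
qed

lemma in_F1_iff: "x \<in> coord_space e (m + 1) \<longleftrightarrow> pR x = 0"
proof -
  have "{1..D} - {1..m + 1} = {m + 2..D}" by auto
  moreover have "{1..m + 1} \<subseteq> {1..D}" using mD(4) by auto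
  ultimately show ?thesis
    unfolding coord_space_def coord_proj_zero_iff[OF mD(3)] by (simp only: in_span_iff)
qed

lemma slice_facts: "slice \<subseteq> topspace M" "topspace M' = slice"
  by (auto simp: slice_def M'_def)

lemma openin_M'I: "openin M O' \<Longrightarrow> U = O' \<inter> slice \<Longrightarrow> openin M' U"
  unfolding M'_def openin_subtopology by blast

lemma slice_chart:
  assumes "(U, \<phi>) \<in> slice_atlas"
  shows "openin M' U" "U \<subseteq> slice" "inj_on \<phi> U" "openin (top_of_set F) (\<phi> ` U)" "\<phi> ` U \<subseteq> F"
    "continuous_map (top_of_set (\<phi> ` U)) M (inv_into U \<phi>)" "\<exists>L. bounded_linear L \<and> (\<forall>q\<in>U. \<phi> q = L (X q))"
proof -
  have *: "openin M' U" "openin (top_of_set F) (\<phi> ` U)" "homeomorphic_map (subtopology M' U) (top_of_set (\<phi> ` U)) \<phi>"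
    "\<exists>L. bounded_linear L \<and> (\<forall>q\<in>U. \<phi> q = L (X q))"
    using assms by (auto simp: slice_atlas_def)
  then show "openin M' U" "openin (top_of_set F) (\<phi> ` U)" "\<exists>L. bounded_linear L \<and> (\<forall>q\<in>U. \<phi> q = L (X q))" by auto
  show "U \<subseteq> slice" using *(1) openin_subset slice_facts(2) by metis
  show "\<phi> ` U \<subseteq> F" using *(2) openin_imp_subset by blast
  show "inj_on \<phi> U" using homeomorphic_chart_inverse(1)[OF *(1,3)] .
  show "continuous_map (top_of_set (\<phi> ` U)) M (inv_into U \<phi>)"
    using homeomorphic_chart_inverse(2)[OF *(1,3)] unfolding M'_def by (rule continuous_map_into_fulltopology)
qed

lemma slice_chart_extension:
  assumes c: "(U, \<phi>) \<in> slice_atlas" and q: "q \<in> U" and O': "openin M O'" "q \<in> O'"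
  obtains T H where "smooth_open T H" "\<phi> q \<in> T"
    "\<And>y. y \<in> T \<Longrightarrow> y \<in> F \<Longrightarrow> y \<in> \<phi> ` U \<and> H y = X (inv_into U \<phi> y) \<and> inv_into U \<phi> y \<in> O'"
proof -
  have "smooth_on (\<phi> ` U) (X \<circ> inv_into U \<phi>)" using c by (auto simp: slice_atlas_def)
  then obtain W H where WH: "\<phi> q \<in> W" "smooth_open W H" "\<forall>y\<in>\<phi> ` U \<inter> W. H y = X (inv_into U \<phi> y)"
    unfolding smooth_on_iff_smooth_open using q by fastforce
  have "openin (top_of_set (\<phi> ` U)) {y \<in> topspace (top_of_set (\<phi> ` U)). inv_into U \<phi> y \<in> O'}"
    using slice_chart(6)[OF c] O'(1) by (rule openin_continuous_map_preimage)
  then have "openin (top_of_set F) {y \<in> topspace (top_of_set (\<phi> ` U)). inv_into U \<phi> y \<in> O'}"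
    using slice_chart(4)[OF c] openin_trans by metis
  then obtain W4 where W4: "open W4" "{y \<in> topspace (top_of_set (\<phi> ` U)). inv_into U \<phi> y \<in> O'} = F \<inter> W4"
    unfolding openin_open by blast
  have in4: "y \<in> \<phi> ` U \<and> inv_into U \<phi> y \<in> O'" if "y \<in> F" "y \<in> W4" for y
  proof -
    have "y \<in> {y \<in> topspace (top_of_set (\<phi> ` U)). inv_into U \<phi> y \<in> O'}" unfolding W4(2) using that by simp
    then show ?thesis by simp
  qed
  have "\<phi> q \<in> {y \<in> topspace (top_of_set (\<phi> ` U)). inv_into U \<phi> y \<in> O'}"
    using q O'(2) inv_into_f_f[OF slice_chart(3)[OF c] q] by simp
  then have q4: "\<phi> q \<in> W4" unfolding W4(2) by simp
  have "open (W \<inter> W4)" using smooth_open_open[OF WH(2)] W4(1) by auto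
  then have "smooth_open (W \<inter> W4) H" using smooth_open_subset[OF WH(2)] by blast
  then show ?thesis using that[of "W \<inter> W4" H] WH(1,3) q4 in4 by blast
qed

lemma line_in_F: "y \<in> F \<Longrightarrow> v \<in> F \<Longrightarrow> y + t *\<^sub>R v \<in> F"
  unfolding coord_space_def by (intro span_add span_scale)

lemma slice_differential:
  assumes c: "(U, \<phi>) \<in> slice_atlas" and q: "q \<in> U" and H: "smooth_open T H" "\<phi> q \<in> T"
    "\<And>y. y \<in> T \<Longrightarrow> y \<in> F \<Longrightarrow> y \<in> \<phi> ` U \<and> H y = X (inv_into U \<phi> y) \<and> Pr y" and v: "v \<in> F"
  shows "differential X (U, \<phi>) q v = frechet_derivative H (at (\<phi> q)) v"
  unfolding differential_def fst_conv snd_conv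
proof (rule dir_deriv_eqI(2)[OF smooth_open_deriv[OF H(1,2)]])
  have "\<phi> q \<in> F" using slice_chart(5)[OF c] q by blast
  then show "eventually (\<lambda>t. (X \<circ> inv_into U \<phi>) (\<phi> q + t *\<^sub>R v) = H (\<phi> q + t *\<^sub>R v)) (nhds 0)"
    using eventually_line_in_open[OF smooth_open_open[OF H(1)] H(2), of v] H(3) line_in_F[OF _ v]
    by (auto elim: eventually_mono)
qed

text \<open>
  The reflection \<open>T\<close> that exchanges the normal at \<open>q0\<close> with \<open>e (m + 1)\<close> fixes the directions of \<open>R\<close> and
  carries the tangent space of the cross section at \<open>q0\<close> to the model space. So \<open>pF (T (X q))\<close> is a chart; its
  inverse sends \<open>y\<close> to the point of the graph below \<open>zf y\<close>.
\<close>

lemma slice_chart_exists: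
  assumes q0: "q0 \<in> slice"
  shows "\<exists>U \<phi>. (U, \<phi>) \<in> slice_atlas \<and> q0 \<in> U"
proof -
  have q0M: "q0 \<in> topspace M" using q0 slice_facts by blast
  obtain U1 \<phi>1 r \<theta> s U0 where "normal_graph e D d M A X N q0 U1 \<phi>1 r \<theta> s U0" using normal_graph_exists[OF q0M] .
  then interpret g: normal_graph e D d M A X N q0 U1 \<phi>1 r \<theta> s U0 .
  let ?\<nu> = "N q0" and ?z0 = "X q0"
  have ne: "norm (e (m + 1)) = 1" using e_inner[OF mD(1) mD(1)] by (simp add: norm_eq_1)
  define T where "T = reflection (?\<nu> - e (m + 1))"
  have Te: "T (e (m + 1)) = ?\<nu>" unfolding T_def using reflection_swap[of ?\<nu> "e (m+1)"] ne g.\<nu>_facts(3) by simp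
  have TT: "T (T x) = x" for x unfolding T_def by (rule reflection_involution)
  have T\<nu>: "T ?\<nu> = e (m + 1)" using TT Te by metis
  have Ti: "T x \<bullet> T y = x \<bullet> y" for x y unfolding T_def by (rule reflection_inner)
  have blT: "bounded_linear T" unfolding T_def by (rule bounded_linear_reflection)
  have lT: "linear T" using blT by (rule bounded_linear.linear)
  have Tfix: "T (e i) = e i" if "i \<in> {m + 2..D}" for i
  proof -
    have "e i \<bullet> (?\<nu> - e (m + 1)) = 0"
      using perp[OF q0M that] e_inner[of i "m + 1"] that mD by (auto simp: inner_diff_right inner_commute)
    then show ?thesis by (simp add: T_def reflection_def)
  qed
  have TR: "pR (T x) = 0" if "pR x = 0" for x
  proof -
    have "T x \<bullet> e i = 0" if "i \<in> {m + 2..D}" for i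
      using Ti[of x "e i"] Tfix[OF that] \<open>pR x = 0\<close> coord_proj_zero_iff[OF mD(3)] that by metis
    then show ?thesis using coord_proj_zero_iff[OF mD(3)] by blast
  qed
  define L where "L = (\<lambda>x. pF (T x))"
  have blL: "bounded_linear L" unfolding L_def
    by (rule bounded_linear_compose[OF bounded_linear_coord_proj blT])
  define \<beta> where "\<beta> = ?z0 \<bullet> ?\<nu>"
  define zf where "zf = (\<lambda>y. T y + \<beta> *\<^sub>R ?\<nu>)"
  \<comment> \<open>\<open>zf (L x)\<close> and \<open>x\<close> lie on the same normal line, so the same point of the graph is below them\<close>
  have recover: "zf (L x) = x + (\<beta> - x \<bullet> ?\<nu>) *\<^sub>R ?\<nu>" if "pR x = 0" for x
  proof -
    have "T x = L x + (x \<bullet> ?\<nu>) *\<^sub>R e (m + 1)" using decompose[OF TR[OF that]] Ti[of x ?\<nu>] T\<nu> by (simp add: L_def)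
    then have "T (T x) = T (L x) + (x \<bullet> ?\<nu>) *\<^sub>R ?\<nu>" using Te by (simp add: linear_add[OF lT] linear_scale[OF lT])
    then show ?thesis using TT by (simp add: zf_def algebra_simps)
  qed
  have pR_z0: "pR ?z0 = 0" using q0 by (simp add: slice_def)
  have zL0: "zf (L ?z0) = ?z0" using recover[OF pR_z0] by (simp add: \<beta>_def)
  have szf: "smooth_open UNIV zf" unfolding zf_def
    by (intro smooth_open_add smooth_open_const smooth_open_linear[OF blT] smooth_open_id) auto
  define V2 where "V2 = g.V \<inter> (\<lambda>z. X (g.\<kappa> z)) -` g.V"
  have V2: "open V2" unfolding V2_def
    by (rule continuous_open_preimage[OF smooth_open_continuous[OF g.smooth_along[OF manifold(4)]] open_ball open_ball])
  \<comment> \<open>the condition defining \<open>V2\<close> ensures that the point below \<open>zf y\<close> belongs to \<open>U0\<close>\<close>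
  define Bh where "Bh = zf -` V2"
  have Bh: "open Bh" unfolding Bh_def
    using continuous_open_preimage[OF smooth_open_continuous[OF szf] open_UNIV V2] by simp
  define B where "B = F \<inter> Bh"
  define \<eta> where "\<eta> = (\<lambda>y. g.\<kappa> (zf y))"
  have zV: "zf y \<in> g.V" "X (\<eta> y) \<in> g.V" if "y \<in> Bh" for y using that by (auto simp: Bh_def V2_def \<eta>_def)
  have X\<eta>: "X (\<eta> y) = T y + (\<beta> - s (zf y)) *\<^sub>R ?\<nu>" if "y \<in> Bh" for y
    using g.X_\<kappa>[OF zV(1)[OF that]] pE1_full by (simp add: \<eta>_def zf_def algebra_simps)
  have \<eta>U0: "\<eta> y \<in> U0" if "y \<in> Bh" for y
    using g.projection_in_U0(1)[OF zV(1)[OF that] pE1_full] zV(2)[OF that] by (simp add: \<eta>_def)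
  have \<eta>slice: "\<eta> y \<in> slice" and L\<eta>: "L (X (\<eta> y)) = y" if "y \<in> B" for y
  proof -
    have y: "y \<in> F" "y \<in> Bh" using that by (auto simp: B_def)
    have "pR (X (\<eta> y)) = pR (T y) + (\<beta> - s (zf y)) *\<^sub>R pR ?\<nu>"
      unfolding X\<eta>[OF y(2)] by (simp add: linear_add[OF linear_coord_proj] linear_scale[OF linear_coord_proj])
    then have "pR (X (\<eta> y)) = 0" using TR[OF F_facts(2)[OF y(1)]] N_perp[OF q0M] by simp
    then show "\<eta> y \<in> slice" using g.U0_top \<eta>U0[OF y(2)] by (auto simp: slice_def)
    have "pF (e (m + 1)) = 0" using e_inner mD by (subst coord_proj_zero_iff[OF mD(2)]) auto
    then show "L (X (\<eta> y)) = y"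
      unfolding X\<eta>[OF y(2)] L_def using F_facts(1)[OF y(1)] TT T\<nu>
      by (simp add: linear_add[OF lT] linear_scale[OF lT] linear_add[OF linear_coord_proj] linear_scale[OF linear_coord_proj])
  qed
  define \<phi> where "\<phi> = (\<lambda>q. L (X q))"
  define U where "U = (U0 \<inter> {q \<in> topspace M. \<phi> q \<in> Bh}) \<inter> slice"
  have c\<phi>: "continuous_map M euclidean \<phi>"
  proof -
    have "continuous_map euclidean euclidean L" using linear_continuous_on[OF blL] by simp
    from continuous_map_compose[OF continuous_X this] show ?thesis by (simp add: comp_def \<phi>_def)
  qed
  have "openin M {q \<in> topspace M. \<phi> q \<in> Bh}" using c\<phi> by (rule openin_continuous_map_preimage) (use Bh in simp)
  then have opU: "openin M' U" using g.U0(1) by (intro openin_M'I[OF _ U_def] openin_Int)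
  have \<phi>F: "\<phi> q \<in> F" for q unfolding \<phi>_def L_def by (rule F_facts(3))
  have \<eta>\<phi>: "\<eta> (\<phi> q) = q" if "q \<in> U" for q
  proof -
    have q: "q \<in> U0" "\<phi> q \<in> Bh" "q \<in> slice" using that by (auto simp: U_def)
    have "zf (\<phi> q) = X q + (\<beta> - X q \<bullet> ?\<nu>) *\<^sub>R ?\<nu>" using recover q(3) by (simp add: \<phi>_def slice_def)
    then have "\<theta> (zf (\<phi> q)) = \<theta> (X q)"
      using g.vertical_shift(1)[OF g.on_U0(1)[OF q(1)], of "\<beta> - X q \<bullet> ?\<nu>"] zV(1)[OF q(2)] by simp
    then show ?thesis using g.\<kappa>_X[OF q(1)] by (simp add: \<eta>_def g.\<kappa>_def)
  qed
  have \<eta>B: "\<eta> y \<in> U" "\<phi> (\<eta> y) = y" if "y \<in> B" for y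
    using \<eta>U0 \<eta>slice[OF that] L\<eta>[OF that] that g.U0_top by (auto simp: U_def \<phi>_def B_def)
  have \<phi>B: "\<phi> q \<in> B" if "q \<in> U" for q using that \<phi>F by (auto simp: U_def B_def)
  have img: "\<phi> ` U = B" using \<eta>B \<phi>B by (metis image_eqI image_subsetI subsetI subset_antisym)
  have tsU: "topspace (subtopology M' U) = U" using opU openin_subset by fastforce
  have "homeomorphic_maps (subtopology M' U) (top_of_set B) \<phi> \<eta>"
    unfolding homeomorphic_maps_def
  proof (intro conjI ballI)
    have "continuous_map (subtopology M' U) euclidean \<phi>"
      unfolding M'_def by (intro continuous_map_from_subtopology c\<phi>)
    then show "continuous_map (subtopology M' U) (top_of_set B) \<phi>"
      using \<phi>B tsU by (auto simp: continuous_map_in_subtopology)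
    have "continuous_map (top_of_set B) (top_of_set g.V) zf"
      using zV(1) continuous_on_subset[OF smooth_open_continuous[OF szf] subset_UNIV, of B]
      by (auto simp: continuous_map_in_subtopology B_def)
    from continuous_map_compose[OF this g.continuous_\<kappa>]
    have "continuous_map (top_of_set B) M \<eta>" by (simp add: \<eta>_def comp_def)
    then show "continuous_map (top_of_set B) (subtopology M' U) \<eta>"
      using \<eta>B(1) \<eta>slice unfolding M'_def by (auto simp: continuous_map_in_subtopology)
    show "\<eta> (\<phi> x) = x" if "x \<in> topspace (subtopology M' U)" for x using \<eta>\<phi> that tsU by blast
    show "\<phi> (\<eta> y) = y" if "y \<in> topspace (top_of_set B)" for y using \<eta>B(2) that by simp
  qed
  then have hom: "homeomorphic_map (subtopology M' U) (top_of_set (\<phi> ` U)) \<phi>"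
    unfolding img using homeomorphic_map_maps by blast
  have inj: "inj_on \<phi> U" using \<eta>\<phi> by (metis inj_onI)
  have sm: "smooth_on (\<phi> ` U) (X \<circ> inv_into U \<phi>)"
    unfolding smooth_on_iff_smooth_open
  proof
    fix y assume y: "y \<in> \<phi> ` U"
    have "smooth_open Bh (\<lambda>y. s (zf y))"
      by (rule smooth_open_compose[OF smooth_open_subset[OF szf Bh] g.smooth_s]) (use zV in auto)
    then have "smooth_open Bh (\<lambda>y. zf y - s (zf y) *\<^sub>R ?\<nu>)"
      by (intro smooth_open_diff smooth_open_scaleR smooth_open_const Bh smooth_open_subset[OF szf Bh]) auto
    moreover have "zf y' - s (zf y') *\<^sub>R ?\<nu> = (X \<circ> inv_into U \<phi>) y'" if "y' \<in> \<phi> ` U \<inter> Bh" for y'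
    proof -
      have "y' \<in> B" using that img by blast
      then have "inv_into U \<phi> y' = \<eta> y'" using \<eta>B by (intro inv_into_f_eq[OF inj]) auto
      then show ?thesis using X\<eta>[of y'] that by (simp add: zf_def algebra_simps)
    qed
    moreover have "y \<in> Bh" using y img by (auto simp: B_def)
    ultimately show "\<exists>W F. y \<in> W \<and> smooth_open W F \<and> (\<forall>y\<in>\<phi> ` U \<inter> W. F y = (X \<circ> inv_into U \<phi>) y)" by blast
  qed
  have "openin (top_of_set F) (\<phi> ` U)" unfolding img B_def using Bh by (auto simp: openin_open)
  then have "(U, \<phi>) \<in> slice_atlas" unfolding slice_atlas_def using opU hom sm blL by (auto simp: \<phi>_def)
  moreover have "q0 \<in> U"
    using g.q0 q0 q0M zL0 g.center by (simp add: U_def Bh_def V2_def \<phi>_def)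
  ultimately show ?thesis by blast
qed

text \<open>
  The inverse of \<open>\<Phi>\<close> on the product of cross section and \<open>R\<close>: the first component slides \<open>q\<close> into the
  cross section.
\<close>

definition \<Psi> :: "'m \<Rightarrow> 'm \<times> 'a" where "\<Psi> q = (\<Phi> (q, - pR (X q)), pR (X q))"

lemma mR: "- pR x \<in> R" using R_facts(3) by (simp add: span_neg)

lemma X_retract: "q \<in> topspace M \<Longrightarrow> X (\<Phi> (q, - pR (X q))) = X q - pR (X q)"
  using \<Phi>(2)[OF _ mR] by simp

lemma retract_in: "q \<in> topspace M \<Longrightarrow> \<Phi> (q, - pR (X q)) \<in> slice"
  using \<Phi>(3)[OF _ mR] X_retract R_facts(1)[OF R_facts(3)] by (simp add: slice_def linear_diff[OF linear_coord_proj])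

lemma \<Phi>_\<Psi>: "q \<in> topspace M \<Longrightarrow> \<Phi> (\<Psi> q) = q"
  using \<Phi>(4)[OF _ mR, of q "X q"] by (simp add: \<Psi>_def)

lemma \<Psi>_\<Phi>:
  assumes "q \<in> slice" "t \<in> R" shows "\<Psi> (\<Phi> (q, t)) = (q, t)"
proof -
  have q: "q \<in> topspace M" "pR (X q) = 0" using assms(1) by (auto simp: slice_def)
  have "pR (X (\<Phi> (q, t))) = t" using \<Phi>(2)[OF q(1) assms(2)] q(2) R_facts(1)[OF assms(2)] by (simp add: linear_add[OF linear_coord_proj])
  then show ?thesis using \<Phi>(4)[OF q(1) assms(2)] by (simp add: \<Psi>_def)
qed

lemma continuous_\<Psi>: "continuous_map M (prod_topology M' (top_of_set R)) \<Psi>"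
proof -
  have "continuous_map euclidean euclidean pR" using linear_continuous_on[OF bounded_linear_coord_proj] by simp
  from continuous_map_compose[OF continuous_X this] have "continuous_map M euclidean (\<lambda>q. pR (X q))" by (simp add: comp_def)
  then have 1: "continuous_map M (top_of_set R) (\<lambda>q. pR (X q))" "continuous_map M (top_of_set R) (\<lambda>q. - pR (X q))"
    using R_facts(3) mR by (auto simp: continuous_map_in_subtopology intro!: continuous_map_minus)
  have "continuous_map M (prod_topology M (top_of_set R)) (\<lambda>q. (q, - pR (X q)))"
    by (intro continuous_map_pairedI continuous_map_id[unfolded id_def] 1)
  from continuous_map_compose[OF this \<Phi>(1)] have "continuous_map M M (\<lambda>q. \<Phi> (q, - pR (X q)))" by (simp add: comp_def)
  then have "continuous_map M M' (\<lambda>q. \<Phi> (q, - pR (X q)))" unfolding M'_def using retract_in by (auto simp: continuous_map_in_subtopology)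
  then show ?thesis unfolding \<Psi>_def by (rule continuous_map_pairedI[OF _ 1(1)])
qed

text \<open>
  The cross section is the image of the connected space \<open>M\<close> under the sliding map.
\<close>

lemma connected_slice: "connected_space M'" "slice \<noteq> {}"
proof -
  have "continuous_map M M' (\<lambda>q. fst (\<Psi> q))"
    using continuous_map_compose[OF continuous_\<Psi> continuous_map_fst] by (simp add: comp_def)
  then have "connectedin M' ((\<lambda>q. fst (\<Psi> q)) ` topspace M)"
    using connectedin_continuous_map_image connectedin_topspace manifold(2) by metis
  moreover have "(\<lambda>q. fst (\<Psi> q)) ` topspace M = slice"
  proof
    show "(\<lambda>q. fst (\<Psi> q)) ` topspace M \<subseteq> slice" using retract_in by (auto simp: \<Psi>_def)
    show "slice \<subseteq> (\<lambda>q. fst (\<Psi> q)) ` topspace M"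
    proof
      fix q assume q: "q \<in> slice"
      then have "fst (\<Psi> (\<Phi> (q, 0))) = q" "\<Phi> (q, 0) \<in> topspace M"
        using \<Psi>_\<Phi>[OF q, of 0] \<Phi>(3)[of q 0] slice_facts(1) by (auto simp: span_zero)
      then show "q \<in> (\<lambda>q. fst (\<Psi> q)) ` topspace M" by force
    qed
  qed
  ultimately show "connected_space M'" using connectedin_topspace[of M'] slice_facts(2) by simp
  show "slice \<noteq> {}" using manifold(3) retract_in by blast
qed

lemma smooth_manifold_slice: "smooth_manifold F M' slice_atlas"
  unfolding smooth_manifold_def
proof (intro conjI)
  show "Hausdorff_space M'" unfolding M'_def by (rule Hausdorff_space_subtopology[OF Hausdorff])
  have "second_countable M" using manifold(1) by (simp add: smooth_manifold_def)
  then show "second_countable M'" unfolding M'_def by (rule second_countable_subtopology)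
  show "(\<Union>(U, \<phi>)\<in>slice_atlas. U) = topspace M'"
  proof
    show "(\<Union>(U, \<phi>)\<in>slice_atlas. U) \<subseteq> topspace M'" using slice_chart(2) slice_facts(2) by fastforce
    show "topspace M' \<subseteq> (\<Union>(U, \<phi>)\<in>slice_atlas. U)" using slice_chart_exists slice_facts(2) by fastforce
  qed
  show "\<forall>(U, \<phi>)\<in>slice_atlas. openin M' U \<and> openin (top_of_set F) (\<phi> ` U) \<and> homeomorphic_map (subtopology M' U) (top_of_set (\<phi> ` U)) \<phi>"
    by (auto simp: slice_atlas_def)
  show "\<forall>(U, \<phi>)\<in>slice_atlas. \<forall>(W, \<psi>)\<in>slice_atlas. smooth_on (\<phi> ` (U \<inter> W)) (\<psi> \<circ> inv_into U \<phi>)"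
  proof (intro ballI, clarify)
    fix U \<phi> W \<psi> assume c: "(U, \<phi>) \<in> slice_atlas" and c': "(W, \<psi>) \<in> slice_atlas"
    obtain L where L: "bounded_linear L" "\<forall>q\<in>W. \<psi> q = L (X q)" using slice_chart(7)[OF c'] by blast
    show "smooth_on (\<phi> ` (U \<inter> W)) (\<psi> \<circ> inv_into U \<phi>)" unfolding smooth_on_iff_smooth_open
    proof
      fix y assume "y \<in> \<phi> ` (U \<inter> W)"
      then obtain q where q: "q \<in> U" "y = \<phi> q" by blast
      have "q \<in> topspace M" using q slice_chart(2)[OF c] slice_facts(1) by blast
      then obtain T H where H: "smooth_open T H" "\<phi> q \<in> T"
        "\<And>y. y \<in> T \<Longrightarrow> y \<in> F \<Longrightarrow> y \<in> \<phi> ` U \<and> H y = X (inv_into U \<phi> y) \<and> inv_into U \<phi> y \<in> topspace M"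
        using slice_chart_extension[OF c q(1) openin_topspace] by metis
      have "L (H y') = (\<psi> \<circ> inv_into U \<phi>) y'" if y'T: "y' \<in> \<phi> ` (U \<inter> W) \<inter> T" for y'
      proof -
        obtain q' where q': "q' \<in> U" "q' \<in> W" "y' = \<phi> q'" using y'T by blast
        have "y' \<in> F" using q' slice_chart(5)[OF c] by blast
        then have "H y' = X q'" using H(3)[of y'] y'T q' inv_into_f_f[OF slice_chart(3)[OF c] q'(1)] by simp
        then show ?thesis using L(2) q' inv_into_f_f[OF slice_chart(3)[OF c] q'(1)] by simp
      qed
      then show "\<exists>W' F. y \<in> W' \<and> smooth_open W' F \<and> (\<forall>y\<in>\<phi> ` (U \<inter> W) \<inter> W'. F y = (\<psi> \<circ> inv_into U \<phi>) y)"
        using H(2) q(2) smooth_open_linear[OF L(1) H(1)] by blast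
    qed
  qed
qed

text \<open>
  The normal field is inherited from \<open>M\<close>. It is normal to the cross section because the latter lies in
  the zero set of \<open>s\<close>, whose gradient is a multiple of the normal.
\<close>

theorem hypersurface_slice: "hypersurface e m M' slice_atlas X N"
  unfolding hypersurface_def
proof (intro conjI)
  show "smooth_manifold F M' slice_atlas" by (rule smooth_manifold_slice)
  show "connected_space M'" "topspace M' \<noteq> {}" using connected_slice slice_facts(2) by auto
  show "smooth_fun slice_atlas X" unfolding smooth_fun_def slice_atlas_def by auto
  show "X ` topspace M' \<subseteq> coord_space e (m + 1)" "N ` topspace M' \<subseteq> coord_space e (m + 1)"
    using slice_facts N_perp in_F1_iff by (auto simp: slice_def)
  show "\<forall>q\<in>topspace M'. norm (N q) = 1" using N_norm slice_facts by auto
  show "\<forall>c\<in>slice_atlas. \<forall>q\<in>fst c. \<forall>v\<in>F. differential X c q v = 0 \<longrightarrow> v = 0"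
  proof (intro ballI impI)
    fix c q v assume "c \<in> slice_atlas" and qc: "q \<in> fst c" and v: "v \<in> F" and z: "differential X c q v = 0"
    obtain U \<phi> where cc: "c = (U, \<phi>)" by (cases c)
    have c: "(U, \<phi>) \<in> slice_atlas" and q: "q \<in> U" using \<open>c \<in> slice_atlas\<close> qc cc by auto
    obtain L where L: "bounded_linear L" "\<forall>q\<in>U. \<phi> q = L (X q)" using slice_chart(7)[OF c] by blast
    have "q \<in> topspace M" using q slice_chart(2)[OF c] slice_facts(1) by blast
    then obtain T H where H: "smooth_open T H" "\<phi> q \<in> T"
      "\<And>y. y \<in> T \<Longrightarrow> y \<in> F \<Longrightarrow> y \<in> \<phi> ` U \<and> H y = X (inv_into U \<phi> y) \<and> inv_into U \<phi> y \<in> topspace M"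
      using slice_chart_extension[OF c q openin_topspace] by metis
    have LH: "L (H y) - y = 0" if "y \<in> T" "y \<in> F" for y
      using H(3)[OF that] L(2) by (metis cancel_comm_monoid_add_class.diff_cancel f_inv_into_f inv_into_into)
    have \<phi>q: "\<phi> q \<in> F" using slice_chart(5)[OF c] q by blast
    have "((\<lambda>y. L (H y) - y) has_derivative (\<lambda>h. L (frechet_derivative H (at (\<phi> q)) h) - h)) (at (\<phi> q))"
      by (rule has_derivative_diff[OF bounded_linear.has_derivative[OF L(1) smooth_open_deriv[OF H(1,2)]] has_derivative_ident])
    moreover have "eventually (\<lambda>t. L (H (\<phi> q + t *\<^sub>R v)) - (\<phi> q + t *\<^sub>R v) = L (H (\<phi> q)) - \<phi> q) (nhds 0)"
      using eventually_line_in_open[OF smooth_open_open[OF H(1)] H(2), of v]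
      by (rule eventually_mono) (use LH H(2) \<phi>q line_in_F[OF \<phi>q v] in simp)
    ultimately have "L (frechet_derivative H (at (\<phi> q)) v) - v = 0" by (rule derivative_zero_of_constant_direction)
    moreover have "frechet_derivative H (at (\<phi> q)) v = 0" using slice_differential[OF c q H v] z cc by simp
    ultimately show "v = 0" using linear_0[OF bounded_linear.linear[OF L(1)]] by simp
  qed
  show "smooth_fun slice_atlas N" unfolding smooth_fun_def
  proof clarify
    fix U \<phi> assume c: "(U, \<phi>) \<in> slice_atlas"
    show "smooth_on (\<phi> ` U) (N \<circ> inv_into U \<phi>)" unfolding smooth_on_iff_smooth_open
    proof
      fix y assume "y \<in> \<phi> ` U"
      then obtain q where q: "q \<in> U" "y = \<phi> q" by blast
      have qM: "q \<in> topspace M" using q slice_chart(2)[OF c] slice_facts(1) by blast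
      obtain U1 \<phi>1 r \<theta> s U0 where "normal_graph e D d M A X N q U1 \<phi>1 r \<theta> s U0" using normal_graph_exists[OF qM] .
      then interpret g: normal_graph e D d M A X N q U1 \<phi>1 r \<theta> s U0 .
      obtain T H where H: "smooth_open T H" "\<phi> q \<in> T"
        "\<And>y. y \<in> T \<Longrightarrow> y \<in> F \<Longrightarrow> y \<in> \<phi> ` U \<and> H y = X (inv_into U \<phi> y) \<and> inv_into U \<phi> y \<in> U0"
        using slice_chart_extension[OF c q(1) g.U0(1) g.q0] by metis
      define W where "W = T \<inter> H -` g.V"
      have W: "open W" unfolding W_def
        by (rule continuous_open_preimage[OF smooth_open_continuous[OF H(1)] smooth_open_open[OF H(1)] open_ball])
      have "smooth_open W (\<lambda>y. g.Nt (H y))"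
        by (rule smooth_open_compose[OF smooth_open_subset[OF H(1) W] g.smooth_Nt]) (auto simp: W_def)
      moreover have HV: "H y' \<in> g.V \<and> g.Nt (H y') = (N \<circ> inv_into U \<phi>) y'" if "y' \<in> \<phi> ` U" "y' \<in> T" for y'
        using H(3)[OF that(2)] that(1) slice_chart(5)[OF c] g.on_U0(1) g.Nt_X by auto
      moreover have "y \<in> W" using HV[of y] q H(2) by (simp add: W_def)
      ultimately show "\<exists>W F. y \<in> W \<and> smooth_open W F \<and> (\<forall>y\<in>\<phi> ` U \<inter> W. F y = (N \<circ> inv_into U \<phi>) y)"
        by (intro exI[of _ W] exI[of _ "\<lambda>y. g.Nt (H y)"]) (auto simp: W_def)
    qed
  qed
  show "\<forall>c\<in>slice_atlas. \<forall>q\<in>fst c. \<forall>v\<in>F. N q \<bullet> differential X c q v = 0"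
  proof (intro ballI)
    fix c q v assume "c \<in> slice_atlas" and qc: "q \<in> fst c" and v: "v \<in> F"
    obtain U \<phi> where cc: "c = (U, \<phi>)" by (cases c)
    have c: "(U, \<phi>) \<in> slice_atlas" and q: "q \<in> U" using \<open>c \<in> slice_atlas\<close> qc cc by auto
    have qM: "q \<in> topspace M" using q slice_chart(2)[OF c] slice_facts(1) by blast
    obtain U1 \<phi>1 r \<theta> s U0 where "normal_graph e D d M A X N q U1 \<phi>1 r \<theta> s U0" using normal_graph_exists[OF qM] .
    then interpret g: normal_graph e D d M A X N q U1 \<phi>1 r \<theta> s U0 .
    obtain T H where H: "smooth_open T H" "\<phi> q \<in> T"
      "\<And>y. y \<in> T \<Longrightarrow> y \<in> F \<Longrightarrow> y \<in> \<phi> ` U \<and> H y = X (inv_into U \<phi> y) \<and> inv_into U \<phi> y \<in> U0"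
      using slice_chart_extension[OF c q g.U0(1) g.q0] by metis
    have \<phi>q: "\<phi> q \<in> F" using slice_chart(5)[OF c] q by blast
    have Hq: "H (\<phi> q) = X q" using H(3)[OF H(2) \<phi>q] inv_into_f_f[OF slice_chart(3)[OF c] q] by simp
    have sH: "s (H y) = 0" if "y \<in> T" "y \<in> F" for y using H(3)[OF that] g.on_U0(3) by simp
    have "((\<lambda>y. s (H y)) has_derivative (\<lambda>h. frechet_derivative s (at (X q)) (frechet_derivative H (at (\<phi> q)) h))) (at (\<phi> q))"
      by (rule has_derivative_compose[OF smooth_open_deriv[OF H(1,2)]]) (use smooth_open_deriv[OF g.smooth_s g.center(1)] Hq in simp)
    moreover have "eventually (\<lambda>t. s (H (\<phi> q + t *\<^sub>R v)) = s (H (\<phi> q))) (nhds 0)"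
      using eventually_line_in_open[OF smooth_open_open[OF H(1)] H(2), of v]
      by (rule eventually_mono) (use sH H(2) \<phi>q line_in_F[OF \<phi>q v] in simp)
    ultimately have "frechet_derivative s (at (X q)) (frechet_derivative H (at (\<phi> q)) v) = 0"
      by (rule derivative_zero_of_constant_direction)
    then have "N q \<bullet> frechet_derivative H (at (\<phi> q)) v = 0"
      using g.Nt_gradient[OF g.center(1), of "frechet_derivative H (at (\<phi> q)) v"] g.center(4) by simp
    then show "N q \<bullet> differential X c q v = 0" using slice_differential[OF c q H v] cc by simp
  qed
qed

sublocale S: immersed_hypersurface e D m M' slice_atlas X N
  by unfold_locales (use hypersurface_slice mD in auto)

text \<open>
  The two mean curvatures are traces of the same operator, the derivative of an extension \<open>Nt\<close> of the
  normal. The directions of \<open>R\<close> contribute nothing to the trace, since \<open>Nt\<close> has no components in \<open>R\<close>.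
\<close>

theorem weighted_slice: "const_weighted_mean_curvature e m M' slice_atlas X N lam"
  unfolding const_weighted_mean_curvature_def
proof
  fix q assume "q \<in> topspace M'"
  then have q: "q \<in> slice" "q \<in> topspace M" using slice_facts by auto
  obtain U1 \<phi>1 r \<theta> s U0 where "normal_graph e D d M A X N q U1 \<phi>1 r \<theta> s U0" using normal_graph_exists[OF q(2)] .
  then interpret g: normal_graph e D d M A X N q U1 \<phi>1 r \<theta> s U0 .
  have DN: "(g.Nt has_derivative frechet_derivative g.Nt (at (X q))) (at (X q))"
    by (rule smooth_open_deriv[OF g.smooth_Nt g.center(1)])
  have orth: "frechet_derivative g.Nt (at (X q)) (N q) \<bullet> N q = 0"
    using g.DNt_orthogonal[OF g.center(1)] g.center(4) by simp
  have "mean_curvature e m slice_atlas X N q = - (\<Sum>b\<in>Basis. b \<bullet> frechet_derivative g.Nt (at (X q)) b)"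
  proof (rule S.mean_curvature_eq_trace[OF _ _ _ DN orth])
    show "openin M' (U0 \<inter> slice)" by (rule openin_M'I[OF g.U0(1) refl])
    show "q \<in> U0 \<inter> slice" using g.q0 q by blast
    show "g.Nt (X q') = N q'" if "q' \<in> U0 \<inter> slice" for q' using g.Nt_X that by blast
    fix k assume "coord_proj e {1..m + 1} k = 0"
    then have k: "k \<in> R" using S.pE1_zero(3) R_facts(3) by metis
    have "((\<lambda>z. g.Nt z \<bullet> k) has_derivative (\<lambda>h. frechet_derivative g.Nt (at (X q)) h \<bullet> k)) (at (X q))"
      by (rule bounded_linear.has_derivative[OF bounded_linear_inner_left DN])
    moreover have "eventually (\<lambda>t. g.Nt (X q + t *\<^sub>R k) \<bullet> k = g.Nt (X q) \<bullet> k) (nhds 0)"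
      using eventually_line_in_open[OF open_ball g.center(1), of k]
      by (rule eventually_mono) (use N_R[OF g.\<kappa>_in k] g.center(1) in \<open>simp add: g.Nt_def\<close>)
    ultimately show "frechet_derivative g.Nt (at (X q)) k \<bullet> k = 0" by (rule derivative_zero_of_constant_direction)
  qed
  moreover have "mean_curvature e d A X N q = - (\<Sum>b\<in>Basis. b \<bullet> frechet_derivative g.Nt (at (X q)) b)"
    by (rule mean_curvature_eq_trace[OF g.U0(1) g.q0 g.Nt_X DN orth]) (simp_all add: pE1_full)
  ultimately show "mean_curvature e m slice_atlas X N q + 1 / 2 * (X q \<bullet> N q) = lam"
    using mean_curvature_weighted[OF q(2)] by simp
qed

abbreviation "MR \<equiv> prod_topology M' (top_of_set R)"

lemma topspace_MR: "topspace MR = slice \<times> R"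
  using slice_facts(2) by simp

section \<open>The splitting\<close>

lemma homeomorphic_\<Phi>: "homeomorphic_maps MR M \<Phi> \<Psi>"
  unfolding homeomorphic_maps_def
proof (intro conjI ballI)
  have "MR = subtopology (prod_topology M (top_of_set R)) (slice \<times> R)"
    unfolding M'_def prod_topology_subtopology(1) by simp
  then show "continuous_map MR M \<Phi>" using continuous_map_from_subtopology[OF \<Phi>(1)] by simp
  show "continuous_map M MR \<Psi>" by (rule continuous_\<Psi>)
  show "\<Psi> (\<Phi> x) = x" if "x \<in> topspace MR" for x
    using \<Psi>_\<Phi>[of "fst x" "snd x"] that topspace_MR by auto
  show "\<Phi> (\<Psi> q) = q" if "q \<in> topspace M" for q by (rule \<Phi>_\<Psi>[OF that])
qed

lemma inv_into_\<Phi>: "q \<in> topspace M \<Longrightarrow> inv_into (topspace MR) \<Phi> q = \<Psi> q"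
proof (rule inv_into_f_eq)
  show "inj_on \<Phi> (topspace MR)"
    using homeomorphic_\<Phi> unfolding homeomorphic_maps_def by (metis inj_onI)
  show "q \<in> topspace M \<Longrightarrow> \<Psi> q \<in> topspace MR"
    using homeomorphic_\<Phi> unfolding homeomorphic_maps_def continuous_map_def by auto
qed (rule \<Phi>_\<Psi>)

lemma prod_chart_eq: "prod_chart R (U, \<phi>) = (U \<times> R, \<lambda>(q, t). \<phi> q + t)"
  by (simp add: prod_chart_def)

lemma prod_chart_proj:
  assumes "(U, \<phi>) \<in> slice_atlas" "q \<in> U" "t \<in> R"
  shows "pF (\<phi> q + t) = \<phi> q" "pR (\<phi> q + t) = t"
proof -
  have "\<phi> q \<in> F" using slice_chart(5)[OF assms(1)] assms(2) by blast
  then show "pF (\<phi> q + t) = \<phi> q" "pR (\<phi> q + t) = t"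
    using F_facts R_facts assms(3) by (simp_all add: linear_add[OF linear_coord_proj])
qed

lemma inv_into_prod_chart:
  assumes c: "(U, \<phi>) \<in> slice_atlas" and q: "q \<in> U" and t: "t \<in> R"
  shows "inv_into (U \<times> R) (\<lambda>(q, t). \<phi> q + t) (\<phi> q + t) = (q, t)"
proof (rule inv_into_f_eq)
  show "inj_on (\<lambda>(q, t). \<phi> q + t) (U \<times> R)"
  proof (rule inj_onI, clarify)
    fix q1 t1 q2 t2 assume *: "q1 \<in> U" "t1 \<in> R" "q2 \<in> U" "t2 \<in> R" "\<phi> q1 + t1 = \<phi> q2 + t2"
    then have "\<phi> q1 = \<phi> q2" "t1 = t2" using prod_chart_proj[OF c] by metis+
    then show "q1 = q2 \<and> t1 = t2" using slice_chart(3)[OF c] * by (metis inj_onD)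
  qed
qed (use q t in auto)

text \<open>
  In coordinates \<open>X \<circ> \<Phi>\<close> is \<open>H (pF x) + pR x\<close> with a smooth parametrization \<open>H\<close> of the cross section, and
  near any point a chart of \<open>M\<close> is the smooth function \<open>\<theta>\<close> of \<open>X\<close>.
\<close>

lemma smooth_\<Phi>: "smooth_map (prod_chart R ` slice_atlas) A \<Phi>"
  unfolding smooth_map_def
proof (intro ballI, clarify)
  fix U \<phi> W \<psi> U' \<phi>'
  assume c: "(U, \<phi>) \<in> slice_atlas" and w: "(W, \<psi>) \<in> A" and eq: "(U', \<phi>') = prod_chart R (U, \<phi>)"
  have U': "U' = U \<times> R" "\<phi>' = (\<lambda>(q, t). \<phi> q + t)" using eq unfolding prod_chart_eq by simp_all
  let ?D = "\<phi>' ` {z \<in> U'. \<Phi> z \<in> W}"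
  show "smooth_on ?D (\<psi> \<circ> \<Phi> \<circ> inv_into U' \<phi>')" unfolding smooth_on_iff_smooth_open
  proof
    fix x0 assume "x0 \<in> ?D"
    then obtain q1 t1 where q1: "q1 \<in> U" "t1 \<in> R" "\<Phi> (q1, t1) \<in> W" "x0 = \<phi> q1 + t1" by (auto simp: U')
    obtain r \<theta> s U0 where "normal_graph e D d M A X N (\<Phi> (q1, t1)) W \<psi> r \<theta> s U0"
      using normal_graph_in_chart[OF w q1(3)] .
    then interpret g: normal_graph e D d M A X N "\<Phi> (q1, t1)" W \<psi> r \<theta> s U0 .
    have q1M: "q1 \<in> topspace M" using q1 slice_chart(2)[OF c] slice_facts(1) by blast
    obtain T H where H: "smooth_open T H" "\<phi> q1 \<in> T"
      "\<And>y. y \<in> T \<Longrightarrow> y \<in> F \<Longrightarrow> y \<in> \<phi> ` U \<and> H y = X (inv_into U \<phi> y) \<and> inv_into U \<phi> y \<in> topspace M"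
      using slice_chart_extension[OF c q1(1) openin_topspace q1M] by metis
    let ?S0 = "\<phi>' ` U'"
    define \<beta> where "\<beta> = (\<lambda>x. \<Phi> (inv_into U \<phi> (pF x), pR x))"
    have \<beta>_eq: "\<beta> (\<phi> q + t) = \<Phi> (q, t)" if "q \<in> U" "t \<in> R" for q t
      using prod_chart_proj[OF c that] inv_into_f_f[OF slice_chart(3)[OF c] that(1)] by (simp add: \<beta>_def)
    have "continuous_map (top_of_set ?S0) (top_of_set (\<phi> ` U)) pF"
      using prod_chart_proj[OF c] by (auto simp: continuous_map_in_subtopology U' intro!: linear_continuous_on bounded_linear_coord_proj)
    from continuous_map_compose[OF this slice_chart(6)[OF c]]
    have "continuous_map (top_of_set ?S0) M (\<lambda>x. inv_into U \<phi> (pF x))" by (simp add: comp_def)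
    moreover have "continuous_map (top_of_set ?S0) (top_of_set R) pR"
      using R_facts(3) by (auto simp: continuous_map_in_subtopology intro!: linear_continuous_on bounded_linear_coord_proj)
    ultimately have "continuous_map (top_of_set ?S0) (prod_topology M (top_of_set R)) (\<lambda>x. (inv_into U \<phi> (pF x), pR x))"
      by (rule continuous_map_pairedI)
    from continuous_map_compose[OF this \<Phi>(1)] have "continuous_map (top_of_set ?S0) M \<beta>" by (simp add: \<beta>_def comp_def)
    then have "openin (top_of_set ?S0) {x \<in> topspace (top_of_set ?S0). \<beta> x \<in> U0}"
      using g.U0(1) by (rule openin_continuous_map_preimage)
    then obtain O4 where O4: "open O4" "{x \<in> topspace (top_of_set ?S0). \<beta> x \<in> U0} = ?S0 \<inter> O4"
      unfolding openin_open by blast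
    have x0S: "x0 \<in> ?S0" using q1 by (auto simp: U')
    then have "x0 \<in> {x \<in> topspace (top_of_set ?S0). \<beta> x \<in> U0}" using \<beta>_eq[OF q1(1,2)] q1(4) g.q0 by simp
    then have x0O: "x0 \<in> O4" unfolding O4(2) by blast
    define T1 where "T1 = pF -` T"
    have T1: "open T1" unfolding T1_def
      using continuous_open_preimage[OF linear_continuous_on[OF bounded_linear_coord_proj] open_UNIV smooth_open_open[OF H(1)]] by simp
    have spF: "smooth_open T1 pF" "smooth_open T1 pR"
      using smooth_open_linear[OF bounded_linear_coord_proj smooth_open_id[OF T1]] by auto
    have sG: "smooth_open T1 (\<lambda>x. H (pF x) + pR x)"
      by (rule smooth_open_add[OF smooth_open_compose[OF spF(1) H(1)] spF(2)]) (simp add: T1_def)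
    define T2 where "T2 = T1 \<inter> (\<lambda>x. H (pF x) + pR x) -` g.V"
    have T2: "open T2" unfolding T2_def
      by (rule continuous_open_preimage[OF smooth_open_continuous[OF sG] T1 open_ball])
    have "smooth_open T2 (\<lambda>x. \<theta> (H (pF x) + pR x))"
      by (rule smooth_open_compose[OF smooth_open_subset[OF sG T2] g.smooth_\<theta>]) (auto simp: T2_def)
    moreover have key: "X (\<Phi> (q, t)) = H (pF (\<phi> q + t)) + pR (\<phi> q + t)" if "q \<in> U" "t \<in> R" "\<phi> q + t \<in> T1" for q t
    proof -
      have "\<phi> q \<in> T" "\<phi> q \<in> F" using that prod_chart_proj[OF c that(1,2)] slice_chart(5)[OF c] by (auto simp: T1_def)
      then have "H (\<phi> q) = X q" using H(3)[of "\<phi> q"] inv_into_f_f[OF slice_chart(3)[OF c] that(1)] by simp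
      moreover have "q \<in> topspace M" using that slice_chart(2)[OF c] slice_facts(1) by blast
      ultimately show ?thesis using prod_chart_proj[OF c that(1,2)] \<Phi>(2)[OF _ that(2)] by simp
    qed
    have "x0 \<in> T1" using prod_chart_proj[OF c q1(1,2)] q1(4) H(2) by (simp add: T1_def)
    then have x0T2: "x0 \<in> T2" using key[OF q1(1,2)] q1(4) g.center(1) by (simp add: T2_def)
    have "smooth_open (T2 \<inter> O4) (\<lambda>x. \<theta> (H (pF x) + pR x))"
      by (rule smooth_open_subset[OF calculation]) (use T2 O4(1) in auto)
    moreover have "\<theta> (H (pF x) + pR x) = (\<psi> \<circ> \<Phi> \<circ> inv_into U' \<phi>') x" if x: "x \<in> ?D \<inter> (T2 \<inter> O4)" for x
    proof -
      obtain q t where qt: "q \<in> U" "t \<in> R" "x = \<phi> q + t" using x by (auto simp: U')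
      have "x \<in> ?S0" using x by blast
      then have "x \<in> {x \<in> topspace (top_of_set ?S0). \<beta> x \<in> U0}" unfolding O4(2) using x by blast
      then have "\<Phi> (q, t) \<in> U0" using \<beta>_eq[OF qt(1,2)] qt(3) by simp
      then have "\<theta> (X (\<Phi> (q, t))) = \<psi> (\<Phi> (q, t))" by (rule g.on_U0(2))
      moreover have "X (\<Phi> (q, t)) = H (pF x) + pR x" using key[OF qt(1,2)] x qt(3) by (simp add: T2_def)
      moreover have "inv_into U' \<phi>' x = (q, t)" using inv_into_prod_chart[OF c qt(1,2)] qt(3) by (simp add: U')
      ultimately show ?thesis by simp
    qed
    moreover have "x0 \<in> T2 \<inter> O4" using x0T2 x0O by blast
    ultimately show "\<exists>W' F. x0 \<in> W' \<and> smooth_open W' F \<and> (\<forall>y\<in>?D \<inter> W'. F y = (\<psi> \<circ> \<Phi> \<circ> inv_into U' \<phi>') y)" by blast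
  qed
qed

text \<open>
  The chart \<open>\<phi>\<close> of the cross section is a linear function of \<open>X\<close>, and \<open>X\<close> of the first component of
  \<open>\<Psi> q\<close> is \<open>X q - pR (X q)\<close>.
\<close>

lemma smooth_\<Psi>: "smooth_map A (prod_chart R ` slice_atlas) (inv_into (topspace MR) \<Phi>)"
  unfolding smooth_map_def
proof (intro ballI, clarify)
  fix U \<phi> W \<psi> U' \<phi>'
  assume w: "(W, \<psi>) \<in> A" and c: "(U, \<phi>) \<in> slice_atlas" and eq: "(U', \<phi>') = prod_chart R (U, \<phi>)"
  have U': "U' = U \<times> R" "\<phi>' = (\<lambda>(q, t). \<phi> q + t)" using eq unfolding prod_chart_eq by simp_all
  let ?inv = "inv_into (topspace MR) \<Phi>"
  let ?D = "\<psi> ` {q \<in> W. ?inv q \<in> U'}"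
  obtain L where L: "bounded_linear L" "\<forall>q\<in>U. \<phi> q = L (X q)" using slice_chart(7)[OF c] by blast
  show "smooth_on ?D (\<phi>' \<circ> ?inv \<circ> inv_into W \<psi>)" unfolding smooth_on_iff_smooth_open
  proof
    fix y assume y: "y \<in> ?D"
    then have yW: "y \<in> \<psi> ` W" by blast
    obtain T H where H: "smooth_open T H" "y \<in> T" "\<And>w. w \<in> T \<Longrightarrow> H w = X (inv_into W \<psi> (pE w))"
      using chart_extension[OF w yW manifold(4)] by metis
    have T: "open T" by (rule smooth_open_open[OF H(1)])
    have "smooth_open T (\<lambda>w. L (H w - pR (H w)) + pR (H w))"
      by (intro smooth_open_add smooth_open_linear[OF L(1)] smooth_open_diff smooth_open_linear[OF bounded_linear_coord_proj] H(1))
    moreover have "L (H y' - pR (H y')) + pR (H y') = (\<phi>' \<circ> ?inv \<circ> inv_into W \<psi>) y'" if y': "y' \<in> ?D \<inter> T" for y'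
    proof -
      obtain q where q: "q \<in> W" "?inv q \<in> U'" "y' = \<psi> q" using y' by blast
      have qM: "q \<in> topspace M" using q chart(2)[OF w] by blast
      have inv: "inv_into W \<psi> y' = q" using inv_into_f_f[OF chart(3)[OF w] q(1)] q(3) by simp
      have "y' \<in> E" using q chart(5)[OF w] by blast
      then have HX: "H y' = X q" using H(3)[of y'] y' pE_id inv by simp
      have in_U: "\<Phi> (q, - pR (X q)) \<in> U" using q(2) unfolding inv_into_\<Phi>[OF qM] by (simp add: \<Psi>_def U')
      have "(\<phi>' \<circ> ?inv \<circ> inv_into W \<psi>) y' = \<phi> (\<Phi> (q, - pR (X q))) + pR (X q)"
        using inv inv_into_\<Phi>[OF qM] by (simp add: \<Psi>_def U')
      also have "\<phi> (\<Phi> (q, - pR (X q))) = L (X q - pR (X q))" using L(2) in_U X_retract[OF qM] by simp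
      finally show ?thesis using HX by simp
    qed
    ultimately show "\<exists>W' F. y \<in> W' \<and> smooth_open W' F \<and> (\<forall>y\<in>?D \<inter> W'. F y = (\<phi>' \<circ> ?inv \<circ> inv_into W \<psi>) y)"
      using H(2) by blast
  qed
qed

text \<open>
  In product coordinates \<open>X \<circ> \<Phi>\<close> is the sum of a function of the first factor and the identity of \<open>R\<close>.
\<close>

lemma differential_product:
  assumes c: "(U, \<phi>) \<in> slice_atlas" and q: "q \<in> U" and t: "t \<in> R" and v: "v \<in> F" and w: "w \<in> R"
  shows "differential (X \<circ> \<Phi>) (prod_chart R (U, \<phi>)) (q, t) (v + w) = differential X (U, \<phi>) q v + w"
proof -
  have qM: "q \<in> topspace M" using q slice_chart(2)[OF c] slice_facts(1) by blast
  obtain T H where H: "smooth_open T H" "\<phi> q \<in> T"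
    "\<And>y. y \<in> T \<Longrightarrow> y \<in> F \<Longrightarrow> y \<in> \<phi> ` U \<and> H y = X (inv_into U \<phi> y) \<and> inv_into U \<phi> y \<in> topspace M"
    using slice_chart_extension[OF c q openin_topspace qM] by metis
  have \<phi>q: "\<phi> q \<in> F" using slice_chart(5)[OF c] q by blast
  let ?x = "\<phi> q + t"
  have px: "pF ?x = \<phi> q" by (rule prod_chart_proj(1)[OF c q t])
  have pvw: "pF (v + w) = v" "pR (v + w) = w"
    using F_facts R_facts v w by (simp_all add: linear_add[OF linear_coord_proj])
  have dH: "(H has_derivative frechet_derivative H (at (\<phi> q))) (at (pF ?x))"
    unfolding px by (rule smooth_open_deriv[OF H(1,2)])
  have d: "((\<lambda>x. H (pF x) + pR x) has_derivative (\<lambda>h. frechet_derivative H (at (\<phi> q)) (pF h) + pR h)) (at ?x)"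
    by (rule has_derivative_add[OF has_derivative_compose[OF bounded_linear_imp_has_derivative[OF bounded_linear_coord_proj] dH]
          bounded_linear_imp_has_derivative[OF bounded_linear_coord_proj]])
  have ev: "eventually (\<lambda>\<tau>. ((X \<circ> \<Phi>) \<circ> inv_into (U \<times> R) (\<lambda>(q, t). \<phi> q + t)) (?x + \<tau> *\<^sub>R (v + w)) =
      H (pF (?x + \<tau> *\<^sub>R (v + w))) + pR (?x + \<tau> *\<^sub>R (v + w))) (nhds 0)"
    using eventually_line_in_open[OF smooth_open_open[OF H(1)] H(2), of v]
  proof (rule eventually_mono)
    fix \<tau> assume y: "\<phi> q + \<tau> *\<^sub>R v \<in> T"
    let ?y = "\<phi> q + \<tau> *\<^sub>R v" and ?t = "t + \<tau> *\<^sub>R w"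
    note * = H(3)[OF y line_in_F[OF \<phi>q v]]
    obtain q' where q': "q' \<in> U" "?y = \<phi> q'" using * by blast
    have iq: "inv_into U \<phi> ?y = q'" using q' inv_into_f_f[OF slice_chart(3)[OF c]] by simp
    have tR: "?t \<in> R" using t w by (intro span_add span_scale)
    have eq: "?x + \<tau> *\<^sub>R (v + w) = \<phi> q' + ?t" unfolding q'(2)[symmetric] by (simp add: algebra_simps)
    have "q' \<in> topspace M" using * iq by simp
    then show "((X \<circ> \<Phi>) \<circ> inv_into (U \<times> R) (\<lambda>(q, t). \<phi> q + t)) (?x + \<tau> *\<^sub>R (v + w)) =
      H (pF (?x + \<tau> *\<^sub>R (v + w))) + pR (?x + \<tau> *\<^sub>R (v + w))"
      unfolding eq using inv_into_prod_chart[OF c q'(1) tR] prod_chart_proj[OF c q'(1) tR] \<Phi>(2)[OF _ tR] * iq q'(2) by simp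
  qed
  have "differential (X \<circ> \<Phi>) (prod_chart R (U, \<phi>)) (q, t) (v + w) = frechet_derivative H (at (\<phi> q)) (pF (v + w)) + pR (v + w)"
    unfolding differential_def prod_chart_eq fst_conv snd_conv split_conv
    by (rule dir_deriv_eqI(2)[OF d ev])
  also have "\<dots> = differential X (U, \<phi>) q v + w" using slice_differential[OF c q H v] pvw by simp
  finally show ?thesis .
qed

text \<open>
  The metric is a product metric because the tangent vectors of the cross section have no components in
  \<open>R\<close>.
\<close>

theorem slice_splits: "splits_as_cylinder e n p M A X M' slice_atlas X" if n: "D = n + 1" "n + 2 - p = m + 2" "n - p = m"
  unfolding splits_as_cylinder_def Let_def n(2,3) n(1)[symmetric]
proof (intro exI conjI ballI)
  show "diffeomorphism MR (prod_chart R ` slice_atlas) M A \<Phi>"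
    unfolding diffeomorphism_def using homeomorphic_\<Phi> homeomorphic_map_maps smooth_\<Phi> smooth_\<Psi> by blast
  show "X (\<Phi> (q, t)) = X q + t" if "q \<in> topspace M'" "t \<in> R" for q t
    using \<Phi>(2) that slice_facts by blast
  fix c q t v w r u
  assume "c \<in> slice_atlas" and qc: "q \<in> fst c" and t: "t \<in> R" and v: "v \<in> F" "w \<in> F" and r: "r \<in> R" "u \<in> R"
  obtain U \<phi> where cc: "c = (U, \<phi>)" by (cases c)
  have c: "(U, \<phi>) \<in> slice_atlas" and q: "q \<in> U" using \<open>c \<in> slice_atlas\<close> qc cc by auto
  have perp: "differential X (U, \<phi>) q v \<bullet> t = 0" if "v \<in> F" "t \<in> R" for v t
    using S.differential_in_E1[OF c q that(1)] in_F1_iff pR_zero_inner that(2) by blast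
  show "induced_metric (X \<circ> \<Phi>) (prod_chart R c) (q, t) (v + r) (w + u) = induced_metric X c q v w + r \<bullet> u"
    unfolding induced_metric_def cc differential_product[OF c q t v(1) r(1)] differential_product[OF c q t v(2) r(2)]
    using perp[OF v(1) r(2)] perp[OF v(2) r(1)] by (simp add: inner_add_left inner_add_right inner_commute)
qed

end

section \<open>The dichotomy\<close>

theorem corollary2:
  fixes e :: "nat \<Rightarrow> 'a::euclidean_space"
    and n p :: nat
    and M :: "'m topology" and A :: "('m, 'a) chart set"
    and X N :: "'m \<Rightarrow> 'a"
    and lam :: real
  assumes "bij_betw e {1..n + 1} Basis"
    and "1 \<le> p" and "p \<le> n + 1"
    and "hypersurface e n M A X N"
    and "complete_hypersurface M X"
    and "proper_map M euclidean X"
    and "const_weighted_mean_curvature e n M A X N lam"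
    and "\<forall>q\<in>topspace M. \<forall>i\<in>{n + 2 - p..n + 1}. 0 \<le> N q \<bullet> e i"
  shows "is_hyperplane M X \<or>
    (p \<le> n \<and>
     (\<exists>(M' :: 'm topology) A' X' N'.
        hypersurface e (n - p) M' A' X' N' \<and>
        const_weighted_mean_curvature e (n - p) M' A' X' N' lam \<and>
        splits_as_cylinder e n p M A X M' A' X'))"
proof -
  interpret W: weighted_hypersurface e "n + 1" n M A X N lam
    by unfold_locales (use assms in auto)
  have heights: "\<exists>k. \<forall>q\<in>topspace M. N q \<bullet> e i = k" if "i \<in> {n + 2 - p..n + 1}" for i
    using W.height_constant[OF assms(6), of "e i"] assms(8) that by metis
  show ?thesis
  proof (cases "\<exists>i\<in>{n + 2 - p..n + 1}. \<exists>q\<in>topspace M. N q \<bullet> e i \<noteq> 0")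
    case True
    then obtain i q where i: "i \<in> {n + 2 - p..n + 1}" "q \<in> topspace M" "N q \<bullet> e i \<noteq> 0" by blast
    obtain k where k: "\<And>q. q \<in> topspace M \<Longrightarrow> N q \<bullet> e i = k" using heights[OF i(1)] by blast
    have "k > 0" using k[OF i(2)] i assms(8) by force
    then show ?thesis using W.positive_height_imp_hyperplane[OF assms(6) k] by blast
  next
    case False
    then have perp: "N q \<bullet> e i = 0" if "q \<in> topspace M" "i \<in> {n + 2 - p..n + 1}" for q i using that by blast
    obtain q where q: "q \<in> topspace M" using W.manifold(3) by blast
    have "p \<le> n"
    proof (rule ccontr)
      assume "\<not> p \<le> n"
      then have "p = n + 1" using assms(3) by simp
      then have "N q = 0" using perp[OF q] by (intro W.eq_by_coords) simp
      then show False using W.N_unit[OF q] by simp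
    qed
    define m where "m = n - p"
    have m: "n + 2 - p = m + 2" "m + 1 \<le> n" "n - p = m" using \<open>p \<le> n\<close> assms(2) by (auto simp: m_def)
    define R where "R = span (e ` {m + 2..n + 1})"
    have tangent: "N q \<bullet> t = 0" if q: "q \<in> topspace M" and t: "t \<in> R" for q t
    proof -
      have "coord_proj e {m + 2..n + 1} (N q) = 0"
        using perp[OF q] unfolding m(1) by (subst W.coord_proj_zero_iff) auto
      moreover have "coord_proj e {m + 2..n + 1} t = t"
        using t unfolding R_def by (subst W.coord_proj_id_iff) auto
      ultimately show ?thesis using W.coord_proj_adjoint[of "{m + 2..n + 1}" "N q" t] by simp
    qed
    have "subspace R" by (simp add: R_def)
    from W.translation_action[OF this tangent assms(6)] obtain \<Phi> where
      "continuous_map (prod_topology M (top_of_set R)) M \<Phi>"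
      "\<And>q t. q \<in> topspace M \<Longrightarrow> t \<in> R \<Longrightarrow> X (\<Phi> (q, t)) = X q + t"
      "\<And>q t. q \<in> topspace M \<Longrightarrow> t \<in> R \<Longrightarrow> \<Phi> (q, t) \<in> topspace M"
      "\<And>q t. q \<in> topspace M \<Longrightarrow> t \<in> R \<Longrightarrow> \<Phi> (\<Phi> (q, t), - t) = q" by blast
    then interpret C: cylinder e "n + 1" n M A X N lam m \<Phi>
      unfolding R_def using m perp by unfold_locales auto
    have "hypersurface e m C.M' C.slice_atlas X N" by (rule C.hypersurface_slice)
    moreover have "const_weighted_mean_curvature e m C.M' C.slice_atlas X N lam" by (rule C.weighted_slice)
    moreover have "splits_as_cylinder e n p M A X C.M' C.slice_atlas X"
      by (rule C.slice_splits[OF refl m(1,3)])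
    ultimately show ?thesis unfolding m(3) using \<open>p \<le> n\<close> by blast
  qed
qed

end
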